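(* Let $0 \le \epsilon < \frac12$ be fixed. There is a constant $\alpha>0$ such that for all $k$ and $n$ with $n \ge \frac{1}{\alpha}k$, $$\mathsf{CC}^{\epsilon}(\mathsf{Disj}_k^n) = \Omega(kn),$$ where the constant implicit in $\Omega$ may depend on $\epsilon$ but not on $k$ or $n$.
   Context: Model (asynchronous number-in-hand peer-to-peer model). There are $k$ players $1,\dots,k$. Player $i$ receives an input $x_i\in\mathcal{X}_i$, has a private random string $R_i$, and all players share a public random string $R^p$. Every pair of players is joined by a bidirectional link; messages are delivered in finite but unbounded time, in FIFO order in each direction. The view of player $i$ at a given time consists of $x_i$, $R_i$, $R^p$ and the messages read so far by player $i$. A protocol specifies, for each player $i$ and each local round $\ell\ge1$, functions of the view of player $i$ at the end of local round $\ell-1$ giving: a set $S_i^{\ell,s}\subseteq\{1,\dots,k\}\setminus\{i\}$ and, for each $j$ in it, a self-delimiting message $m_{i,j}^\ell\in\{0,1\}^*$ that player $i$ sends to $j$; a value $O_i^\ell\in\{0,1\}^*\cup\{\bot\}$ — if $O_i^\ell\neq\bot$, player $i$ stops and outputs $O_i^\ell$ (doing nothing further); otherwise a set $S_i^{\ell,r}\subseteq\{1,\dots,k\}\setminus\{i\}$ of players from each of which player $i$ then waits to read one complete message, which ends the local round. A protocol $\pi$ $\epsilon$-computes $f$ if for every input and every value of the random strings every player eventually stops and outputs, and for every input $x$, with probability at least $1-\epsilon$ over the randomness every player outputs $f(x)$. $\mathsf{CC}(\pi)$ is the maximum, over all inputs and all values of the randomness, of the total number of bits sent by all players, and $\mathsf{CC}^\epsilon(f)=\inf\{\mathsf{CC}(\pi):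 \pi\ \epsilon\text{-computes } f\}$. The function $\mathsf{Disj}_k^n$: each player $i$ holds $(x_i^\ell)_{\ell=1}^n\in\{0,1\}^n$ and $\mathsf{Disj}_k^n(x)=\bigvee_{\ell=1}^n\bigwedge_{i=1}^k x_i^\ell$.
   Formalization: The bound is stated for k ≥ 2 players; for k = 1 the single player computes the function without communication, so the complexity is 0 and the claimed bound fails. *)

theory Defs
  imports "HOL-Probability.Probability" "HOL-Library.Sublist"
begin

type_synonym bits = "bool list"
type_synonym coins = "nat \<Rightarrow> bool"

text \<open>Public random string, and the private random string of each player.\<close>
type_synonym randomness = "coins \<times> (nat \<Rightarrow> coins)"

text \<open>
  The players are \<open>1, \<dots>, k\<close>.  In a view, \<open>msgs v j\<close> is the list of the messages read
  so far from player \<open>j\<close>, oldest first.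
\<close>
record 'x view =
  inp :: 'x
  priv :: coins
  pub :: coins
  msgs :: "nat \<Rightarrow> bits list"

text \<open>
  All three components take a player \<open>i\<close>, a local round \<open>l\<close> (numbered from 1) and the view of
  \<open>i\<close> at the end of local round \<open>l - 1\<close>.  The domain of the partial map given by \<open>send\<close> is the
  set of players to which \<open>i\<close> sends, and \<open>None\<close> as output stands for \<open>\<bottom>\<close>.
\<close>
record 'x protocol =
  send :: "nat \<Rightarrow> nat \<Rightarrow> 'x view \<Rightarrow> nat \<Rightarrow> bits option"
  outp :: "nat \<Rightarrow> nat \<Rightarrow> 'x view \<Rightarrow> bits option"
  recv :: "nat \<Rightarrow> nat \<Rightarrow> 'x view \<Rightarrow> nat set"

datatype phase = Ready | Waiting "nat set" | Stopped bits

text \<open>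
  Global configurations.  The link from \<open>i\<close> to \<open>j\<close> is described by the log \<open>sent c i j\<close> of the
  messages sent on it, the number \<open>arrived c i j\<close> of those that have been delivered to \<open>j\<close>,
  and the number \<open>nread c i j\<close> of those that \<open>j\<close> has read; since both counters refer to initial
  segments of the log, delivery is FIFO.
\<close>
record config =
  rnd :: "nat \<Rightarrow> nat"
  phase :: "nat \<Rightarrow> phase"
  sent :: "nat \<Rightarrow> nat \<Rightarrow> bits list"
  arrived :: "nat \<Rightarrow> nat \<Rightarrow> nat"
  nread :: "nat \<Rightarrow> nat \<Rightarrow> nat"

definition init :: config where
  "init = \<lparr>rnd = (\<lambda>_. 1), phase = (\<lambda>_. Ready), sent = (\<lambda>_ _. []),
           arrived = (\<lambda>_ _. 0), nread = (\<lambda>_ _. 0)\<rparr>"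

definition view_of :: "(nat \<Rightarrow> 'x) \<Rightarrow> randomness \<Rightarrow> config \<Rightarrow> nat \<Rightarrow> 'x view" where
  "view_of x r c i =
     \<lparr>inp = x i, priv = snd r i, pub = fst r, msgs = (\<lambda>j. take (nread c j i) (sent c j i))\<rparr>"

datatype event = Act nat | Deliver nat nat

text \<open>
  Events that are not enabled have no effect.  The messages awaited in one local round are
  consumed together, once all of them have arrived.
\<close>
fun step :: "'x protocol \<Rightarrow> (nat \<Rightarrow> 'x) \<Rightarrow> randomness \<Rightarrow> event \<Rightarrow> config \<Rightarrow> config" where
  "step \<pi> x r (Deliver i j) c =
     (if arrived c i j < length (sent c i j)
      then c\<lparr>arrived := (arrived c)(i := (arrived c i)(j := Suc (arrived c i j)))\<rparr>
      else c)"
| "step \<pi> x r (Act i) c =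
     (case phase c i of
        Ready \<Rightarrow>
          (let v = view_of x r c i; l = rnd c i in
           c\<lparr>sent := (sent c)(i := (\<lambda>j. sent c i j @
                (case send \<pi> i l v j of None \<Rightarrow> [] | Some m \<Rightarrow> [m]))),
             phase := (phase c)(i :=
                (case outp \<pi> i l v of Some w \<Rightarrow> Stopped w | None \<Rightarrow> Waiting (recv \<pi> i l v)))\<rparr>)
      | Waiting S \<Rightarrow>
          (if \<forall>j\<in>S. nread c j i < arrived c j i
           then c\<lparr>nread := (\<lambda>j i'. if i' = i \<and> j \<in> S then Suc (nread c j i') else nread c j i'),
                  rnd := (rnd c)(i := Suc (rnd c i)),
                  phase := (phase c)(i := Ready)\<rparr>
           else c)
      | Stopped w \<Rightarrow> c)"

primrec exec :: "'x protocol \<Rightarrow> (nat \<Rightarrow> 'x) \<Rightarrow> randomness \<Rightarrow> (nat \<Rightarrow> event) \<Rightarrow> nat \<Rightarrow> config" where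
  "exec \<pi> x r \<sigma> 0 = init"
| "exec \<pi> x r \<sigma> (Suc t) = step \<pi> x r (\<sigma> t) (exec \<pi> x r \<sigma> t)"

definition events :: "nat \<Rightarrow> event set" where
  "events k = Act ` {1..k} \<union> {Deliver i j | i j. i \<in> {1..k} \<and> j \<in> {1..k} \<and> i \<noteq> j}"

text \<open>
  The schedule is adversarial, subject only to fairness: every message is delivered, and every
  player takes its steps, after finite but unbounded time.
\<close>
definition schedules :: "nat \<Rightarrow> (nat \<Rightarrow> event) set" where
  "schedules k = {\<sigma>. range \<sigma> \<subseteq> events k \<and> (\<forall>e\<in>events k. \<exists>\<^sub>\<infinity>t. \<sigma> t = e)}"

definition inputs :: "nat \<Rightarrow> (nat \<Rightarrow> 'x set) \<Rightarrow> (nat \<Rightarrow> 'x) set" where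
  "inputs k X = (\<Pi>\<^sub>E i\<in>{1..k}. X i)"

definition coin_space :: "coins measure" where
  "coin_space = (\<Pi>\<^sub>M _\<in>UNIV. measure_pmf (bernoulli_pmf (1/2)))"

definition rand_space :: "nat \<Rightarrow> randomness measure" where
  "rand_space k = coin_space \<Otimes>\<^sub>M (\<Pi>\<^sub>M _\<in>{1..k}. coin_space)"

text \<open>
  Messages that player \<open>j\<close>, having view \<open>v\<close> at the end of a local round and then waiting for a
  message from \<open>i\<close>, can possibly get, over all inputs and random strings compatible with \<open>v\<close>.
\<close>
definition possible_messages ::
    "nat \<Rightarrow> (nat \<Rightarrow> 'x set) \<Rightarrow> 'x protocol \<Rightarrow> nat \<Rightarrow> nat \<Rightarrow> 'x view \<Rightarrow> bits set" where
  "possible_messages k X \<pi> i j v =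
     {m. \<exists>x\<in>inputs k X. \<exists>r\<in>space (rand_space k). \<exists>\<sigma>\<in>schedules k. \<exists>t S.
           let c = exec \<pi> x r \<sigma> t in
             phase c j = Waiting S \<and> i \<in> S \<and> view_of x r c j = v \<and>
             nread c i j < length (sent c i j) \<and> m = sent c i j ! nread c i j}"

text \<open>
  A message is self-delimiting if its receiver can tell where it ends, from the bits of the
  message and its own view.  In particular the empty message is possible only where no other
  message is; otherwise empty messages would transmit information at no cost.
\<close>
definition self_delimiting :: "nat \<Rightarrow> (nat \<Rightarrow> 'x set) \<Rightarrow> 'x protocol \<Rightarrow> bool" where
  "self_delimiting k X \<pi> \<longleftrightarrow>
     (\<forall>i\<in>{1..k}. \<forall>j\<in>{1..k}. \<forall>v. \<forall>m\<in>possible_messages k X \<pi> i j v.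
        \<forall>m'\<in>possible_messages k X \<pi> i j v. prefix m m' \<longrightarrow> m = m')"

definition is_protocol :: "nat \<Rightarrow> (nat \<Rightarrow> 'x set) \<Rightarrow> 'x protocol \<Rightarrow> bool" where
  "is_protocol k X \<pi> \<longleftrightarrow>
     (\<forall>i\<in>{1..k}. \<forall>l\<ge>1. \<forall>v.
        dom (send \<pi> i l v) \<subseteq> {1..k} - {i} \<and> recv \<pi> i l v \<subseteq> {1..k} - {i}) \<and>
     self_delimiting k X \<pi>"

definition outputs ::
    "'x protocol \<Rightarrow> (nat \<Rightarrow> 'x) \<Rightarrow> randomness \<Rightarrow> (nat \<Rightarrow> event) \<Rightarrow> nat \<Rightarrow> bits \<Rightarrow> bool" where
  "outputs \<pi> x r \<sigma> i w \<longleftrightarrow> (\<exists>t. phase (exec \<pi> x r \<sigma> t) i = Stopped w)"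

text \<open>
  Non-measurable sets have measure 0, so for \<open>\<epsilon> < 1\<close> the last condition includes measurability
  of the event that all outputs are correct.
\<close>
definition eps_computes ::
    "nat \<Rightarrow> (nat \<Rightarrow> 'x set) \<Rightarrow> 'x protocol \<Rightarrow> real \<Rightarrow> ((nat \<Rightarrow> 'x) \<Rightarrow> bits) \<Rightarrow> bool" where
  "eps_computes k X \<pi> \<epsilon> f \<longleftrightarrow>
     (\<forall>x\<in>inputs k X. \<forall>\<sigma>\<in>schedules k.
        (\<forall>r\<in>space (rand_space k). \<forall>i\<in>{1..k}. \<exists>w. outputs \<pi> x r \<sigma> i w) \<and>
        measure (rand_space k)
          {r \<in> space (rand_space k). \<forall>i\<in>{1..k}. outputs \<pi> x r \<sigma> i (f x)} \<ge> 1 - \<epsilon>)"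

definition bits_sent :: "nat \<Rightarrow> config \<Rightarrow> nat" where
  "bits_sent k c = (\<Sum>i\<in>{1..k}. \<Sum>j\<in>{1..k}. \<Sum>m\<leftarrow>sent c i j. length m)"

text \<open>The value is \<open>\<infinity>\<close> if the number of bits is unbounded.\<close>
definition CC_protocol :: "nat \<Rightarrow> (nat \<Rightarrow> 'x set) \<Rightarrow> 'x protocol \<Rightarrow> enat" where
  "CC_protocol k X \<pi> =
     (SUP x\<in>inputs k X. SUP r\<in>space (rand_space k). SUP \<sigma>\<in>schedules k. SUP t.
        enat (bits_sent k (exec \<pi> x r \<sigma> t)))"

definition CC :: "nat \<Rightarrow> (nat \<Rightarrow> 'x set) \<Rightarrow> real \<Rightarrow> ((nat \<Rightarrow> 'x) \<Rightarrow> bits) \<Rightarrow> enat" where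
  "CC k X \<epsilon> f = (INF \<pi>\<in>{\<pi>. is_protocol k X \<pi> \<and> eps_computes k X \<pi> \<epsilon> f}. CC_protocol k X \<pi>)"

definition disj_inputs :: "nat \<Rightarrow> nat \<Rightarrow> bits set" where
  "disj_inputs n i = {u. length u = n}"

definition Disj :: "nat \<Rightarrow> nat \<Rightarrow> (nat \<Rightarrow> bits) \<Rightarrow> bits" where
  "Disj k n x = [\<exists>l<n. \<forall>i\<in>{1..k}. x i ! l]"

end

theory Submission
  imports Defs
begin

text \<open>
  Fixing the randomness leaves a deterministic protocol whose advantage in telling apart two
  families of inputs is at least \<open>1 - 2\<epsilon>\<close> on average.  In the hard distribution every coordinate
  has a planted zero at a random player; in mode 1 all other players hold 1, in mode 0 they
  hold random bits.  For each player \<open>i\<close> consider the bits read on the links between \<open>i\<close>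
  and the other players.  If few bits cross this cut, then at most coordinates they reveal
  little about the bit of \<open>i\<close> in mode 0, and, to player \<open>i\<close>, little about the mode.  By the rectangle property
  of transcripts these two facts force, at the cuts of \<open>i\<close> and of \<open>z\<close>, the inputs with a zero
  at \<open>i\<close> and \<open>z\<close>, at \<open>i\<close> only, at \<open>z\<close> only, and with no zero at all to look alike, which
  contradicts correctness.  Hence a constant amount of information is revealed for each of
  the \<open>n\<close> coordinates and on average over the \<open>k\<close> cuts, and chain rules add up these
  amounts.

  Entropy is bounded by the number of bits with the help of Kraft's inequality: given the inputs
  on one side of a cut, the strings read by that side from the other one form a prefix-free
  family of tuples, since messages are self-delimiting for their reader, and they determine
  everything that this side sends.
\<close>

section \<open>Averages over cubes of bits and Hellinger distance\<close>

text \<open>Correctness is exploited on columns where the players other than \<open>i\<close> and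
  \<open>z\<close> hold 1, but there the distribution fixes the bit of \<open>i\<close>, so entropy
  says nothing about it. This is why there are two modes: in mode 0 the bit of \<open>i\<close> is
  uniform and its influence is bounded by entropy, mode 1 supplies the columns of interest, and the
  influence of the mode links the two. The price is that the mode correlates the rows. Conditioning
  on all modes would make the rows independent, but would leave no uncertainty in the mode under
  study. The planted zero keeps the AND of every other coordinate at 0, so that one coordinate alone
  decides the value. Squared Hellinger distance is used because entropy controls it and because, for
  probability laws, it depends only on the products of their values, which the rectangle property
  preserves. An asynchronous run has no global order of messages. A transcript is therefore a family
  of strings, one per link.\<close>

definition avg :: "'a set \<Rightarrow> ('a \<Rightarrow> real) \<Rightarrow> real" where
  "avg A g = (\<Sum>x\<in>A. g x) / real (card A)"

definition cube :: "'i set \<Rightarrow> ('i \<Rightarrow> bool) set" where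
  "cube I = (\<Pi>\<^sub>E i\<in>I. UNIV)"

definition law :: "'a set \<Rightarrow> ('a \<Rightarrow> 't) \<Rightarrow> 't \<Rightarrow> real" where
  "law A f t = avg A (\<lambda>x. of_bool (f x = t))"

text \<open>Twice the usual squared Hellinger distance of probability laws. Since no root is taken,
  the triangle inequality costs a factor 2 at each use, which is where many constants below come
  from.\<close>

definition hellinger :: "'t set \<Rightarrow> ('t \<Rightarrow> real) \<Rightarrow> ('t \<Rightarrow> real) \<Rightarrow> real" where
  "hellinger S p q = (\<Sum>t\<in>S. (sqrt (p t) - sqrt (q t))\<^sup>2)"

text \<open>In nats, hence a factor \<open>ln 2\<close> wherever it is compared with a number of
  bits.\<close>

definition ent :: "'t set \<Rightarrow> ('t \<Rightarrow> real) \<Rightarrow> real" where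
  "ent S p = - (\<Sum>t\<in>S. p t * ln (p t))"

lemma finite_cube [simp]: "finite I \<Longrightarrow> finite (cube I)"
  unfolding cube_def by (intro finite_PiE) auto

lemma cube_nonempty [simp]: "cube I \<noteq> {}"
  unfolding cube_def by (simp add: PiE_eq_empty_iff)

lemma override_on_cube [simp]: "\<eta> \<in> cube I \<Longrightarrow> \<omega> \<in> cube I \<Longrightarrow> override_on \<eta> \<omega> J \<in> cube I"
  unfolding cube_def by (auto simp: PiE_iff extensional_def override_on_def)

lemma fun_upd_cube [simp]: "\<eta> \<in> cube I \<Longrightarrow> b \<in> I \<Longrightarrow> \<eta>(b := v) \<in> cube I"
  unfolding cube_def by (auto simp: PiE_iff extensional_def)

lemma avg_cong: "(\<And>x. x \<in> A \<Longrightarrow> f x = g x) \<Longrightarrow> avg A f = avg A g"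
  unfolding avg_def by simp

lemma avg_mono: "(\<And>x. x \<in> A \<Longrightarrow> f x \<le> g x) \<Longrightarrow> avg A f \<le> avg A g"
  unfolding avg_def by (intro divide_right_mono sum_mono) auto

lemma avg_nonneg: "(\<And>x. x \<in> A \<Longrightarrow> 0 \<le> f x) \<Longrightarrow> 0 \<le> avg A f"
  unfolding avg_def by (intro divide_nonneg_nonneg sum_nonneg) auto

lemma avg_add: "avg A (\<lambda>x. f x + g x) = avg A f + avg A g"
  unfolding avg_def by (simp add: sum.distrib add_divide_distrib)

lemma avg_diff: "avg A (\<lambda>x. f x - g x) = avg A f - avg A g"
  unfolding avg_def by (simp add: sum_subtractf diff_divide_distrib)

lemma avg_cmult: "avg A (\<lambda>x. c * f x) = c * avg A f"
  unfolding avg_def by (simp add: sum_distrib_left)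

lemma avg_divide: "avg A (\<lambda>x. f x / c) = avg A f / c"
  unfolding avg_def by (simp add: sum_divide_distrib mult.commute)

lemma avg_const: "finite A \<Longrightarrow> A \<noteq> {} \<Longrightarrow> avg A (\<lambda>x. c) = c"
  unfolding avg_def by simp

lemma avg_sum: "avg A (\<lambda>x. \<Sum>i\<in>S. f i x) = (\<Sum>i\<in>S. avg A (f i))"
  unfolding avg_def by (subst sum.swap) (simp add: sum_divide_distrib)

lemma avg_commute: "avg A (\<lambda>x. avg B (\<lambda>y. f x y)) = avg B (\<lambda>y. avg A (\<lambda>x. f x y))"
  unfolding avg_def
  by (simp add: sum_divide_distrib[symmetric]) (subst sum.swap, simp add: mult.commute)

lemma override_on_exchange: "override_on (override_on \<omega> \<eta> J) (override_on \<eta> \<omega> J) J = \<omega>"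
  by (simp add: override_on_def fun_eq_iff)

text \<open>Law of total expectation for conditioning on the bits in \<open>J\<close>: exchanging
  these bits between two independent samples is an involution on pairs of samples.\<close>

lemma avg_override:
  assumes "finite I"
  shows "avg (cube I) (\<lambda>\<omega>. avg (cube I) (\<lambda>\<eta>. F (override_on \<eta> \<omega> J))) = avg (cube I) F"
proof -
  let ?Q = "cube I"
  have "(\<Sum>\<omega>\<in>?Q. \<Sum>\<eta>\<in>?Q. F (override_on \<eta> \<omega> J))
      = (\<Sum>(\<omega>, \<eta>)\<in>?Q \<times> ?Q. F (override_on \<eta> \<omega> J))"
    by (simp add: sum.cartesian_product)
  also have "\<dots> = (\<Sum>(\<omega>, \<eta>)\<in>?Q \<times> ?Q. F \<eta>)"
    by (rule sum.reindex_bij_witness[of _ "\<lambda>(\<omega>, \<eta>). (override_on \<omega> \<eta> J, override_on \<eta> \<omega> J)"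
          "\<lambda>(\<omega>, \<eta>). (override_on \<omega> \<eta> J, override_on \<eta> \<omega> J)"])
       (auto simp: override_on_exchange)
  also have "\<dots> = real (card ?Q) * sum F ?Q"
    by (simp add: sum.cartesian_product[symmetric])
  finally show ?thesis
    using assms unfolding avg_def by (simp add: sum_divide_distrib[symmetric])
qed

lemma avg_bit:
  assumes "finite I" "b \<in> I"
  shows "avg (cube I) F = (avg (cube I) (\<lambda>\<eta>. F (\<eta>(b := False))) + avg (cube I) (\<lambda>\<eta>. F (\<eta>(b := True)))) / 2"
proof -
  have flip: "sum F (cube I) = (\<Sum>\<eta>\<in>cube I. F (\<eta>(b := \<not> \<eta> b)))"
    by (rule sum.reindex_bij_witness[of _ "\<lambda>\<eta>. \<eta>(b := \<not> \<eta> b)" "\<lambda>\<eta>. \<eta>(b := \<not> \<eta> b)"])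
       (use assms in auto)
  have "F \<eta> + F (\<eta>(b := \<not> \<eta> b)) = F (\<eta>(b := False)) + F (\<eta>(b := True))" for \<eta>
    by (cases "\<eta> b") (auto simp: fun_upd_idem)
  then have "sum F (cube I) + (\<Sum>\<eta>\<in>cube I. F (\<eta>(b := \<not> \<eta> b)))
      = (\<Sum>\<eta>\<in>cube I. F (\<eta>(b := False))) + (\<Sum>\<eta>\<in>cube I. F (\<eta>(b := True)))"
    by (simp add: sum.distrib[symmetric])
  with flip show ?thesis
    unfolding avg_def by (simp add: add_divide_distrib[symmetric] divide_simps)
qed

section \<open>Laws on finite sets, Hellinger distance and entropy\<close>

lemma law_nonneg [simp]: "0 \<le> law A f t"
  unfolding law_def by (intro avg_nonneg) auto

lemma sum_law_mult:
  assumes "finite S" "f ` A \<subseteq> S"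
  shows "(\<Sum>t\<in>S. law A f t * w t) = avg A (\<lambda>x. w (f x))"
proof -
  have "(\<Sum>t\<in>S. law A f t * w t) = avg A (\<lambda>x. \<Sum>t\<in>S. of_bool (f x = t) * w t)"
    unfolding law_def by (subst avg_sum) (simp add: avg_def sum_distrib_right)
  also have "\<dots> = avg A (\<lambda>x. w (f x))"
    using assms by (intro avg_cong) (auto simp: of_bool_def if_distrib[of "\<lambda>c. c * _"] sum.delta' cong: if_cong)
  finally show ?thesis .
qed

lemma sum_law:
  assumes "finite S" "f ` A \<subseteq> S" "finite A" "A \<noteq> {}"
  shows "(\<Sum>t\<in>S. law A f t) = 1"
  using sum_law_mult[OF assms(1,2), of "\<lambda>_. 1"] assms(3,4) by (simp add: avg_const)

lemma hellinger_nonneg [simp]: "0 \<le> hellinger S p q"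
  unfolding hellinger_def by (intro sum_nonneg) auto

lemma hellinger_commute: "hellinger S p q = hellinger S q p"
  unfolding hellinger_def by (simp add: power2_commute)

lemma power2_diff_le: "(a - c)\<^sup>2 \<le> 2 * (a - b)\<^sup>2 + 2 * (b - c)\<^sup>2" for a b c :: real
proof -
  have "0 \<le> ((a - b) - (b - c))\<^sup>2" by simp
  then show ?thesis by (simp add: power2_eq_square algebra_simps)
qed

lemma hellinger_triangle: "hellinger S p r \<le> 2 * hellinger S p q + 2 * hellinger S q r"
  unfolding hellinger_def sum_distrib_left sum.distrib[symmetric] by (intro sum_mono power2_diff_le)

text \<open>For laws of fixed mass only the affinity (Bhattacharyya coefficient) matters, and it
  sees the laws only through the products \<open>p t * q t\<close>.\<close>

lemma hellinger_eq_affinity: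
  assumes "\<And>t. 0 \<le> p t" "\<And>t. 0 \<le> q t"
  shows "hellinger S p q = (\<Sum>t\<in>S. p t) + (\<Sum>t\<in>S. q t) - 2 * (\<Sum>t\<in>S. sqrt (p t * q t))"
  unfolding hellinger_def using assms
  by (simp add: power2_diff sum.distrib sum_subtractf sum_distrib_left real_sqrt_mult algebra_simps)

lemma sqrt_sum_mult_ge:
  assumes "\<And>x. x \<in> A \<Longrightarrow> 0 \<le> p x" "\<And>x. x \<in> A \<Longrightarrow> 0 \<le> q x"
  shows "(\<Sum>x\<in>A. sqrt (p x * q x)) \<le> sqrt ((\<Sum>x\<in>A. p x) * (\<Sum>x\<in>A. q x))"
proof (rule real_le_rsqrt)
  have "(\<Sum>x\<in>A. sqrt (p x) * sqrt (q x))\<^sup>2 \<le> (\<Sum>x\<in>A. (sqrt (p x))\<^sup>2) * (\<Sum>x\<in>A. (sqrt (q x))\<^sup>2)"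
    by (rule Cauchy_Schwarz_ineq_sum)
  then show "(\<Sum>x\<in>A. sqrt (p x * q x))\<^sup>2 \<le> (\<Sum>x\<in>A. p x) * (\<Sum>x\<in>A. q x)"
    using assms by (simp add: real_sqrt_mult)
qed

text \<open>Joint convexity: the affinity is concave by Cauchy-Schwarz, while the masses are
  linear.\<close>

lemma hellinger_avg_le:
  assumes "finite A" "A \<noteq> {}" "\<And>x t. 0 \<le> p x t" "\<And>x t. 0 \<le> q x t"
  shows "hellinger S (\<lambda>t. avg A (\<lambda>x. p x t)) (\<lambda>t. avg A (\<lambda>x. q x t)) \<le> avg A (\<lambda>x. hellinger S (p x) (q x))"
proof -
  have "avg A (\<lambda>x. sqrt (p x t * q x t)) \<le> sqrt (avg A (\<lambda>x. p x t) * avg A (\<lambda>x. q x t))" for t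
  proof -
    have "(\<Sum>x\<in>A. sqrt (p x t * q x t)) \<le> sqrt ((\<Sum>x\<in>A. p x t) * (\<Sum>x\<in>A. q x t))"
      by (intro sqrt_sum_mult_ge assms)
    then have "(\<Sum>x\<in>A. sqrt (p x t * q x t)) / card A \<le> sqrt ((\<Sum>x\<in>A. p x t) * (\<Sum>x\<in>A. q x t)) / card A"
      by (rule divide_right_mono) simp
    then show ?thesis
      unfolding avg_def by (simp add: real_sqrt_divide real_sqrt_mult)
  qed
  then have "(\<Sum>t\<in>S. avg A (\<lambda>x. sqrt (p x t * q x t))) \<le> (\<Sum>t\<in>S. sqrt (avg A (\<lambda>x. p x t) * avg A (\<lambda>x. q x t)))"
    by (intro sum_mono)
  moreover have "avg A (\<lambda>x. hellinger S (p x) (q x)) = (\<Sum>t\<in>S. avg A (\<lambda>x. p x t)) + (\<Sum>t\<in>S. avg A (\<lambda>x. q x t))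
      - 2 * (\<Sum>t\<in>S. avg A (\<lambda>x. sqrt (p x t * q x t)))"
    by (simp add: hellinger_eq_affinity assms avg_add avg_diff avg_cmult avg_sum)
  moreover have "hellinger S (\<lambda>t. avg A (\<lambda>x. p x t)) (\<lambda>t. avg A (\<lambda>x. q x t))
      = (\<Sum>t\<in>S. avg A (\<lambda>x. p x t)) + (\<Sum>t\<in>S. avg A (\<lambda>x. q x t))
      - 2 * (\<Sum>t\<in>S. sqrt (avg A (\<lambda>x. p x t) * avg A (\<lambda>x. q x t)))"
    by (intro hellinger_eq_affinity avg_nonneg assms)
  ultimately show ?thesis by linarith
qed

text \<open>
  The inequality holds pointwise, without normalization of \<open>p\<close> and \<open>q\<close>: it follows from
  \<open>x ln (x / r) \<ge> (sqrt x - sqrt r)\<^sup>2 + x - r\<close> with \<open>r\<close> the midpoint.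
\<close>
lemma ent_midpoint:
  assumes "\<And>t. 0 \<le> p t" "\<And>t. 0 \<le> q t"
  shows "ent S (\<lambda>t. (p t + q t) / 2) \<ge> (ent S p + ent S q) / 2 + hellinger S p q / 4"
proof -
  \<comment> \<open>The bound \<open>x \<le> 2 * r\<close> holds for a midpoint and excludes
    \<open>r = 0 < x\<close>, where the convention \<open>ln 0 = 0\<close> would let the inequality
    fail.\<close>
  have key: "x * ln x - x * ln r \<ge> (sqrt x - sqrt r)\<^sup>2 + x - r" if "0 \<le> x" "x \<le> 2 * r" for x r :: real
  proof (cases "x = 0")
    case True
    then show ?thesis using that by simp
  next
    case False
    then have pos: "0 < x" "0 < r" using that by auto
    have "ln (sqrt (r / x)) \<le> sqrt (r / x) - 1"
      using pos by (intro ln_le_minus_one) simp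
    then have "ln r - ln x \<le> 2 * sqrt (r / x) - 2"
      using pos by (simp add: ln_sqrt ln_div)
    then have "x * (ln r - ln x) \<le> x * (2 * sqrt (r / x) - 2)"
      using pos by (intro mult_left_mono) auto
    also have "x * (2 * sqrt (r / x) - 2) = 2 * (sqrt x * sqrt r) - 2 * x"
    proof -
      have "x * sqrt (r / x) = sqrt x * sqrt r"
        using pos by (simp add: real_sqrt_divide field_simps)
      then show ?thesis by (simp add: algebra_simps)
    qed
    finally show ?thesis
      using pos by (simp add: power2_diff algebra_simps)
  qed
  have pt: "(x * ln x + y * ln y) / 2 - (x + y) / 2 * ln ((x + y) / 2) \<ge> (sqrt x - sqrt y)\<^sup>2 / 4"
    if "0 \<le> x" "0 \<le> y" for x y :: real
  proof -
    define r where "r = (x + y) / 2"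
    have "(sqrt x - sqrt y)\<^sup>2 \<le> 2 * (sqrt x - sqrt r)\<^sup>2 + 2 * (sqrt y - sqrt r)\<^sup>2"
      using power2_diff_le[of "sqrt x" "sqrt y" "sqrt r"] by (simp add: power2_commute)
    moreover have "x * ln x - x * ln r \<ge> (sqrt x - sqrt r)\<^sup>2 + x - r"
      "y * ln y - y * ln r \<ge> (sqrt y - sqrt r)\<^sup>2 + y - r"
      using that by (auto intro!: key simp: r_def)
    moreover have "r * ln r = (x * ln r + y * ln r) / 2" "x + y = 2 * r"
      by (simp_all add: r_def algebra_simps add_divide_distrib)
    ultimately have "(x * ln x + y * ln y) / 2 - r * ln r \<ge> (sqrt x - sqrt y)\<^sup>2 / 4"
      by argo
    then show ?thesis by (simp add: r_def)
  qed
  have "(\<Sum>t\<in>S. (sqrt (p t) - sqrt (q t))\<^sup>2 / 4)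
      \<le> (\<Sum>t\<in>S. (p t * ln (p t) + q t * ln (q t)) / 2 - (p t + q t) / 2 * ln ((p t + q t) / 2))"
    by (intro sum_mono pt assms)
  moreover have "(\<Sum>t\<in>S. (sqrt (p t) - sqrt (q t))\<^sup>2 / 4) = hellinger S p q / 4"
    unfolding hellinger_def by (rule sum_divide_distrib[symmetric])
  moreover have "(\<Sum>t\<in>S. (p t * ln (p t) + q t * ln (q t)) / 2 - (p t + q t) / 2 * ln ((p t + q t) / 2))
      = (- ent S p - ent S q) / 2 + ent S (\<lambda>t. (p t + q t) / 2)"
    unfolding ent_def by (simp only: sum_subtractf sum_divide_distrib[symmetric] sum.distrib) simp
  ultimately show ?thesis by argo
qed

text \<open>Gibbs' inequality against the weights \<open>(1/2) ^ len t\<close>. Kraft's inequality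
  is asked on the support only, since lengths elsewhere are arbitrary and do not affect the
  mean.\<close>

lemma ent_le_length:
  assumes "finite S" "\<And>t. 0 \<le> p t" "(\<Sum>t\<in>S. p t) = 1" "(\<Sum>t\<in>{t\<in>S. p t \<noteq> 0}. (1/2) ^ len t) \<le> (1::real)"
  shows "ent S p \<le> ln 2 * (\<Sum>t\<in>S. p t * real (len t))"
proof -
  let ?S = "{t\<in>S. p t \<noteq> 0}"
  have "- (p t * ln (p t)) - ln 2 * (p t * len t) \<le> (1/2) ^ len t - p t" if "t \<in> ?S" for t
  proof -
    have pos: "p t > 0" using that assms(2)[of t] by auto
    have "ln ((1/2) ^ len t / p t) \<le> (1/2) ^ len t / p t - 1"
      using pos by (intro ln_le_minus_one) simp
    then have "p t * (- (len t * ln 2) - ln (p t)) \<le> p t * ((1/2) ^ len t / p t - 1)"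
      using pos by (intro mult_left_mono) (simp_all add: ln_div ln_realpow)
    then show ?thesis using pos by (simp add: algebra_simps)
  qed
  then have "(\<Sum>t\<in>?S. - (p t * ln (p t)) - ln 2 * (p t * len t)) \<le> (\<Sum>t\<in>?S. (1/2) ^ len t - p t)"
    by (intro sum_mono)
  moreover have "(\<Sum>t\<in>?S. - (p t * ln (p t)) - ln 2 * (p t * len t)) = (\<Sum>t\<in>S. - (p t * ln (p t)) - ln 2 * (p t * len t))"
    using assms(1) by (intro sum.mono_neutral_left) auto
  moreover have "(\<Sum>t\<in>?S. p t) = (\<Sum>t\<in>S. p t)"
    using assms(1) by (intro sum.mono_neutral_left) auto
  ultimately show ?thesis
    using assms(3,4) unfolding ent_def
    by (simp add: sum_subtractf sum_negf sum_distrib_left)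
qed

section \<open>Conditioning on bits and the chain rule\<close>

text \<open>
  In \<open>law (cube I) (\<lambda>\<eta>. f (override_on \<eta> \<omega> J))\<close> the bits in \<open>J\<close> are fixed by \<open>\<omega>\<close> and the others are
  random: it is the conditional law of \<open>f\<close> given these bits.
\<close>
definition cond_hellinger :: "'t set \<Rightarrow> 'i set \<Rightarrow> 'i set \<Rightarrow> (('i \<Rightarrow> bool) \<Rightarrow> 't) \<Rightarrow> (('i \<Rightarrow> bool) \<Rightarrow> 't) \<Rightarrow> real" where
  "cond_hellinger S I J f g = avg (cube I) (\<lambda>\<omega>.
     hellinger S (law (cube I) (\<lambda>\<eta>. f (override_on \<eta> \<omega> J))) (law (cube I) (\<lambda>\<eta>. g (override_on \<eta> \<omega> J))))"

definition cond_ent :: "'t set \<Rightarrow> 'i set \<Rightarrow> 'i set \<Rightarrow> (('i \<Rightarrow> bool) \<Rightarrow> 't) \<Rightarrow> real" where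
  "cond_ent S I J f = avg (cube I) (\<lambda>\<omega>. ent S (law (cube I) (\<lambda>\<eta>. f (override_on \<eta> \<omega> J))))"

lemma cond_hellinger_nonneg [simp]: "0 \<le> cond_hellinger S I J f g"
  unfolding cond_hellinger_def by (intro avg_nonneg) auto

text \<open>Conditioning on fewer bits averages both laws over the bits in \<open>J' - J\<close>
  with the same weights, so joint convexity applies.\<close>

lemma cond_hellinger_mono:
  assumes fin: "finite I" and J: "J \<subseteq> J'"
  shows "cond_hellinger S I J f g \<le> cond_hellinger S I J' f g"
proof -
  let ?Q = "cube I"
  let ?L = "\<lambda>J f \<omega>. law ?Q (\<lambda>\<eta>. f (override_on \<eta> \<omega> J))"
  have refine: "?L J f \<omega> t = avg ?Q (\<lambda>\<omega>'. ?L J' f (override_on \<omega>' \<omega> J) t)" for f :: "_ \<Rightarrow> 'b" and \<omega> t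
  proof -
    have eq: "override_on \<eta> (override_on \<omega>' \<omega> J) J' = override_on (override_on \<eta> \<omega>' J') \<omega> J" for \<eta> \<omega>' :: "'a \<Rightarrow> bool"
      using J by (auto simp: override_on_def fun_eq_iff)
    show ?thesis
      unfolding law_def eq
      by (subst avg_override[OF fin, of "\<lambda>\<theta>. of_bool (f (override_on \<theta> \<omega> J) = t)"]) (rule refl)
  qed
  have "hellinger S (?L J f \<omega>) (?L J g \<omega>)
      \<le> avg ?Q (\<lambda>\<omega>'. hellinger S (?L J' f (override_on \<omega>' \<omega> J)) (?L J' g (override_on \<omega>' \<omega> J)))" for \<omega>
    using hellinger_avg_le[where A="?Q" and S=S and p="\<lambda>\<omega>'. ?L J' f (override_on \<omega>' \<omega> J)"
        and q="\<lambda>\<omega>'. ?L J' g (override_on \<omega>' \<omega> J)"] fin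
    by (simp add: refine[symmetric])
  then have "cond_hellinger S I J f g \<le> avg ?Q (\<lambda>\<omega>. avg ?Q (\<lambda>\<omega>'. hellinger S (?L J' f (override_on \<omega>' \<omega> J)) (?L J' g (override_on \<omega>' \<omega> J))))"
    unfolding cond_hellinger_def by (intro avg_mono)
  also have "\<dots> = cond_hellinger S I J' f g"
    unfolding cond_hellinger_def by (rule avg_override[OF fin, of "\<lambda>\<theta>. hellinger S (?L J' f \<theta>) (?L J' g \<theta>)"])
  finally show ?thesis .
qed

text \<open>Convexity again, but the bits in \<open>K\<close> are substituted instead of being added
  to the conditioning; disjointness makes the two overrides commute. Afterwards the set of bits to
  condition on may be chosen depending on the substituted values.\<close>

lemma cond_hellinger_le_avg_override:
  assumes fin: "finite I" and K: "K \<inter> J = {}"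
  shows "cond_hellinger S I J f g \<le> avg (cube I) (\<lambda>\<upsilon>. cond_hellinger S I J (\<lambda>\<eta>. f (override_on \<eta> \<upsilon> K)) (\<lambda>\<eta>. g (override_on \<eta> \<upsilon> K)))"
proof -
  let ?Q = "cube I"
  let ?L = "\<lambda>f \<omega>. law ?Q (\<lambda>\<eta>. f (override_on \<eta> \<omega> J))"
  let ?M = "\<lambda>f \<omega> \<upsilon>. law ?Q (\<lambda>\<eta>. f (override_on (override_on \<eta> \<omega> J) \<upsilon> K))"
  have refine: "?L f \<omega> t = avg ?Q (\<lambda>\<upsilon>. ?M f \<omega> \<upsilon> t)" for f :: "_ \<Rightarrow> 'b" and \<omega> t
  proof -
    have eq: "override_on (override_on \<eta> \<omega> J) \<upsilon> K = override_on (override_on \<eta> \<upsilon> K) \<omega> J" for \<eta> \<upsilon> :: "'a \<Rightarrow> bool"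
      using K by (auto simp: override_on_def fun_eq_iff)
    show ?thesis
      unfolding law_def eq
      by (subst avg_override[OF fin, of "\<lambda>\<theta>. of_bool (f (override_on \<theta> \<omega> J) = t)"]) (rule refl)
  qed
  have "hellinger S (?L f \<omega>) (?L g \<omega>) \<le> avg ?Q (\<lambda>\<upsilon>. hellinger S (?M f \<omega> \<upsilon>) (?M g \<omega> \<upsilon>))" for \<omega>
    using hellinger_avg_le[where A="?Q" and S=S and p="?M f \<omega>" and q="?M g \<omega>"] fin
    by (simp add: refine[symmetric])
  then have "cond_hellinger S I J f g \<le> avg ?Q (\<lambda>\<omega>. avg ?Q (\<lambda>\<upsilon>. hellinger S (?M f \<omega> \<upsilon>) (?M g \<omega> \<upsilon>)))"
    unfolding cond_hellinger_def by (intro avg_mono)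
  also have "\<dots> = avg ?Q (\<lambda>\<upsilon>. cond_hellinger S I J (\<lambda>\<eta>. f (override_on \<eta> \<upsilon> K)) (\<lambda>\<eta>. g (override_on \<eta> \<upsilon> K)))"
    unfolding cond_hellinger_def by (rule avg_commute)
  finally show ?thesis .
qed

lemma override_on_insert_upd:
  "override_on x (y(b := c)) (insert b J) = (override_on x y J)(b := c)"
  by (auto simp: override_on_def fun_eq_iff)

text \<open>Each value of the bit \<open>b\<close> has weight 1/2, and the term of the other value
  is dropped.\<close>

lemma cond_hellinger_insert_ge:
  assumes "finite I" "b \<in> I"
  shows "cond_hellinger S I (insert b J) f g \<ge> cond_hellinger S I J (\<lambda>\<eta>. f (\<eta>(b := c))) (\<lambda>\<eta>. g (\<eta>(b := c))) / 2"
proof -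
  have "cond_hellinger S I (insert b J) f g = (cond_hellinger S I J (\<lambda>\<eta>. f (\<eta>(b := False))) (\<lambda>\<eta>. g (\<eta>(b := False)))
      + cond_hellinger S I J (\<lambda>\<eta>. f (\<eta>(b := True))) (\<lambda>\<eta>. g (\<eta>(b := True)))) / 2"
    unfolding cond_hellinger_def by (subst avg_bit[OF assms]) (simp add: override_on_insert_upd)
  moreover have "0 \<le> cond_hellinger S I J (\<lambda>\<eta>. f (\<eta>(b := \<not> c))) (\<lambda>\<eta>. g (\<eta>(b := \<not> c)))" by simp
  ultimately show ?thesis by (cases c) auto
qed

text \<open>One step of the chain rule. The entropy drop caused by a uniform bit is a Jensen-Shannon
  divergence, which \<open>ent_midpoint\<close> bounds from below.\<close>

lemma cond_ent_insert:
  assumes fin: "finite I" and b: "b \<in> I" "b \<notin> J"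
  shows "cond_ent S I J f \<ge> cond_ent S I (insert b J) f + cond_hellinger S I J (\<lambda>\<eta>. f (\<eta>(b := False))) (\<lambda>\<eta>. f (\<eta>(b := True))) / 4"
proof -
  let ?Q = "cube I"
  let ?L = "\<lambda>c \<omega>. law ?Q (\<lambda>\<eta>. f ((override_on \<eta> \<omega> J)(b := c)))"
  have "law ?Q (\<lambda>\<eta>. f (override_on \<eta> \<omega> J)) = (\<lambda>t. (?L False \<omega> t + ?L True \<omega> t) / 2)" for \<omega>
  proof
    fix t
    have "override_on (\<eta>(b := c)) \<omega> J = (override_on \<eta> \<omega> J)(b := c)" for \<eta> c
      using b by (auto simp: override_on_def fun_eq_iff)
    then show "law ?Q (\<lambda>\<eta>. f (override_on \<eta> \<omega> J)) t = (?L False \<omega> t + ?L True \<omega> t) / 2"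
      unfolding law_def by (subst avg_bit[OF fin b(1)]) simp
  qed
  then have "ent S (law ?Q (\<lambda>\<eta>. f (override_on \<eta> \<omega> J)))
      \<ge> (ent S (?L False \<omega>) + ent S (?L True \<omega>)) / 2 + hellinger S (?L False \<omega>) (?L True \<omega>) / 4" for \<omega>
    using ent_midpoint[of "?L False \<omega>" "?L True \<omega>" S] by simp
  then have "cond_ent S I J f \<ge> avg ?Q (\<lambda>\<omega>. (ent S (?L False \<omega>) + ent S (?L True \<omega>)) / 2 + hellinger S (?L False \<omega>) (?L True \<omega>) / 4)"
    unfolding cond_ent_def by (intro avg_mono)
  moreover have "cond_ent S I (insert b J) f = (avg ?Q (\<lambda>\<omega>. ent S (?L False \<omega>)) + avg ?Q (\<lambda>\<omega>. ent S (?L True \<omega>))) / 2"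
    unfolding cond_ent_def by (subst avg_bit[OF fin b(1)]) (simp add: override_on_insert_upd)
  ultimately show ?thesis
    unfolding cond_hellinger_def avg_add avg_divide by argo
qed

lemma cond_ent_nonneg:
  assumes "finite I"
  shows "0 \<le> cond_ent S I J f"
proof -
  have "p * ln p \<le> 0" if "0 \<le> p" "p \<le> 1" for p :: real
    using that by (cases "p = 0") (auto intro!: mult_nonneg_nonpos)
  moreover have "law (cube I) h t \<le> 1" for h :: "_ \<Rightarrow> 'b" and t
  proof -
    have "law (cube I) h t \<le> avg (cube I) (\<lambda>_. 1)"
      unfolding law_def by (intro avg_mono) auto
    then show ?thesis using assms by (simp add: avg_const)
  qed
  ultimately show ?thesis
    unfolding cond_ent_def ent_def by (intro avg_nonneg) (auto intro!: sum_nonpos)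
qed

lemma cond_ent_chain:
  fixes n :: nat
  assumes "finite I" "inj_on b {..<n}" "\<And>s. s < n \<Longrightarrow> b s \<in> I"
  shows "(\<Sum>s<n. if b s \<in> J then 0 else
            cond_hellinger S I (J \<union> b ` {..<s}) (\<lambda>\<eta>. f (\<eta>(b s := False))) (\<lambda>\<eta>. f (\<eta>(b s := True))))
         \<le> 4 * cond_ent S I J f"
proof -
  have "(\<Sum>s<m. if b s \<in> J then 0 else
            cond_hellinger S I (J \<union> b ` {..<s}) (\<lambda>\<eta>. f (\<eta>(b s := False))) (\<lambda>\<eta>. f (\<eta>(b s := True))))
         \<le> 4 * (cond_ent S I J f - cond_ent S I (J \<union> b ` {..<m}) f)" if "m \<le> n" for m
    using that
  proof (induction m)
    case (Suc m)
    have ins: "J \<union> b ` {..<Suc m} = insert (b m) (J \<union> b ` {..<m})"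
      by (auto simp: lessThan_Suc)
    show ?case
    proof (cases "b m \<in> J")
      case True
      then have "J \<union> b ` {..<Suc m} = J \<union> b ` {..<m}" unfolding ins by auto
      then show ?thesis using True Suc by simp
    next
      case False
      then have "b m \<notin> J \<union> b ` {..<m}"
        using inj_onD[OF assms(2), of m] Suc.prems by fastforce
      from cond_ent_insert[OF assms(1) assms(3)[of m] this, of S f] Suc False show ?thesis
        unfolding ins by simp
    qed
  qed simp
  from this[of n] cond_ent_nonneg[OF assms(1), of S "J \<union> b ` {..<n}" f] show ?thesis by simp
qed

text \<open>A component that the conditioning determines, with the same value on both sides, does
  not help to separate the laws. This attaches the tail of a row to a transcript at no cost.\<close>

lemma cond_hellinger_pair_le:
  assumes fin: "finite S" "finite V" "finite I"
    and g: "\<And>\<omega>. \<omega> \<in> cube I \<Longrightarrow> \<exists>v\<in>V. \<forall>\<eta>\<in>cube I. g (override_on \<eta> \<omega> J) = v \<and> g' (override_on \<eta> \<omega> J) = v"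
  shows "cond_hellinger (S \<times> V) I J (\<lambda>\<eta>. (f \<eta>, g \<eta>)) (\<lambda>\<eta>. (f' \<eta>, g' \<eta>)) \<le> cond_hellinger S I J f f'"
  unfolding cond_hellinger_def
proof (rule avg_mono)
  fix \<omega> assume "\<omega> \<in> cube I"
  from g[OF this] obtain v where v: "v \<in> V" "\<forall>\<eta>\<in>cube I. g (override_on \<eta> \<omega> J) = v" "\<forall>\<eta>\<in>cube I. g' (override_on \<eta> \<omega> J) = v"
    by blast
  let ?Q = "cube I"
  have L: "law ?Q (\<lambda>\<eta>. (f (override_on \<eta> \<omega> J), g (override_on \<eta> \<omega> J))) (t, w)
      = (if w = v then law ?Q (\<lambda>\<eta>. f (override_on \<eta> \<omega> J)) t else 0)"
    if "\<forall>\<eta>\<in>cube I. g (override_on \<eta> \<omega> J) = v"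
    for t w and f :: "_ \<Rightarrow> 'a" and g
    unfolding law_def using that by (auto simp: avg_def intro!: sum.cong)
  have "hellinger (S \<times> V) (law ?Q (\<lambda>\<eta>. (f (override_on \<eta> \<omega> J), g (override_on \<eta> \<omega> J))))
          (law ?Q (\<lambda>\<eta>. (f' (override_on \<eta> \<omega> J), g' (override_on \<eta> \<omega> J))))
      = (\<Sum>t\<in>S. \<Sum>w\<in>V. if w = v then (sqrt (law ?Q (\<lambda>\<eta>. f (override_on \<eta> \<omega> J)) t) -
           sqrt (law ?Q (\<lambda>\<eta>. f' (override_on \<eta> \<omega> J)) t))\<^sup>2 else 0)"
    unfolding hellinger_def sum.cartesian_product using v(2,3)
    by (intro sum.cong) (auto simp: L split: prod.splits)
  also have "\<dots> = hellinger S (law ?Q (\<lambda>\<eta>. f (override_on \<eta> \<omega> J))) (law ?Q (\<lambda>\<eta>. f' (override_on \<eta> \<omega> J)))"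
    unfolding hellinger_def using v(1) fin by simp
  finally show "hellinger (S \<times> V) (law ?Q (\<lambda>\<eta>. (f (override_on \<eta> \<omega> J), g (override_on \<eta> \<omega> J))))
          (law ?Q (\<lambda>\<eta>. (f' (override_on \<eta> \<omega> J), g' (override_on \<eta> \<omega> J))))
      \<le> hellinger S (law ?Q (\<lambda>\<eta>. f (override_on \<eta> \<omega> J))) (law ?Q (\<lambda>\<eta>. f' (override_on \<eta> \<omega> J)))"
    by simp
qed

text \<open>A separate code is allowed for each value \<open>\<omega>\<close> of the conditioned
  bits, because the decoder is the side of the cut that knows them.\<close>

lemma cond_ent_le_length:
  fixes S :: "'t set" and f :: "('i \<Rightarrow> bool) \<Rightarrow> 't"
  assumes fin: "finite I" "finite S" and f: "f ` cube I \<subseteq> S"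
    and code: "\<And>\<omega>. \<omega> \<in> cube I \<Longrightarrow> \<exists>len::'t \<Rightarrow> nat.
      (\<Sum>t\<in>(\<lambda>\<eta>. f (override_on \<eta> \<omega> J)) ` cube I. (1/2) ^ len t) \<le> (1::real) \<and>
      (\<forall>\<eta>\<in>cube I. len (f (override_on \<eta> \<omega> J)) \<le> c (override_on \<eta> \<omega> J))"
  shows "cond_ent S I J f \<le> ln 2 * avg (cube I) (\<lambda>\<eta>. real (c \<eta>))"
proof -
  let ?Q = "cube I"
  have "ent S (law ?Q (\<lambda>\<eta>. f (override_on \<eta> \<omega> J))) \<le> ln 2 * avg ?Q (\<lambda>\<eta>. real (c (override_on \<eta> \<omega> J)))"
    if \<omega>: "\<omega> \<in> ?Q" for \<omega>
  proof -
    let ?f = "\<lambda>\<eta>. f (override_on \<eta> \<omega> J)"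
    from code[OF \<omega>] obtain len :: "'t \<Rightarrow> nat" where len: "(\<Sum>t\<in>?f ` ?Q. (1/2) ^ len t) \<le> (1::real)"
        "\<And>\<eta>. \<eta> \<in> ?Q \<Longrightarrow> len (?f \<eta>) \<le> c (override_on \<eta> \<omega> J)"
      by blast
    have S: "?f ` ?Q \<subseteq> S" using f \<omega> by auto
    have supp: "{t\<in>S. law ?Q ?f t \<noteq> 0} \<subseteq> ?f ` ?Q"
    proof
      fix t assume t: "t \<in> {t\<in>S. law ?Q ?f t \<noteq> 0}"
      show "t \<in> ?f ` ?Q"
      proof (rule ccontr)
        assume "t \<notin> ?f ` ?Q"
        then have "law ?Q ?f t = 0" unfolding law_def avg_def by (auto intro!: sum.neutral)
        with t show False by simp
      qed
    qed
    have "(\<Sum>t\<in>{t\<in>S. law ?Q ?f t \<noteq> 0}. (1/2) ^ len t) \<le> (\<Sum>t\<in>?f ` ?Q. (1/2) ^ len t :: real)"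
      using supp fin by (intro sum_mono2) auto
    then have "ent S (law ?Q ?f) \<le> ln 2 * (\<Sum>t\<in>S. law ?Q ?f t * real (len t))"
      using fin len(1) S by (intro ent_le_length sum_law) auto
    also have "(\<Sum>t\<in>S. law ?Q ?f t * real (len t)) = avg ?Q (\<lambda>\<eta>. real (len (?f \<eta>)))"
      using S fin by (intro sum_law_mult) auto
    also have "\<dots> \<le> avg ?Q (\<lambda>\<eta>. real (c (override_on \<eta> \<omega> J)))"
      using len(2) by (intro avg_mono) simp
    finally show ?thesis by simp
  qed
  then have "cond_ent S I J f \<le> avg ?Q (\<lambda>\<omega>. ln 2 * avg ?Q (\<lambda>\<eta>. real (c (override_on \<eta> \<omega> J))))"
    unfolding cond_ent_def by (intro avg_mono)
  also have "\<dots> = ln 2 * avg ?Q (\<lambda>\<eta>. real (c \<eta>))"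
    unfolding avg_cmult using avg_override[OF fin(1), of "\<lambda>\<eta>. real (c \<eta>)" J] by simp
  finally show ?thesis .
qed

section \<open>Rectangle property and data processing for laws\<close>

lemma hellinger_cut_paste:
  assumes "\<And>t. 0 \<le> p t" "\<And>t. 0 \<le> q t" "\<And>t. 0 \<le> p' t" "\<And>t. 0 \<le> q' t"
    and "sum p S = 1" "sum q S = 1" "sum p' S = 1" "sum q' S = 1"
    and "\<And>t. p t * q t = p' t * q' t"
  shows "hellinger S p q = hellinger S p' q'"
  using assms by (simp add: hellinger_eq_affinity)

text \<open>
  The hypothesis \<open>same\<close> says that the second component has the same conditional law given the
  first one under \<open>j0\<close> and \<open>j1\<close>.
\<close>
lemma hellinger_transfer:
  assumes nonneg: "\<And>t s. 0 \<le> j0 t s" "\<And>t s. 0 \<le> j1 t s"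
    and fin: "finite S" "finite R"
    and same: "\<And>t s. j0 t s * (\<Sum>s\<in>R. j1 t s) = j1 t s * (\<Sum>s\<in>R. j0 t s)"
  shows "hellinger R (\<lambda>s. \<Sum>t\<in>S. j0 t s) (\<lambda>s. \<Sum>t\<in>S. j1 t s) \<le> hellinger S (\<lambda>t. \<Sum>s\<in>R. j0 t s) (\<lambda>t. \<Sum>s\<in>R. j1 t s)"
proof -
  define p where "p t = (\<Sum>s\<in>R. j0 t s)" for t
  define q where "q t = (\<Sum>s\<in>R. j1 t s)" for t
  have pq: "0 \<le> p t" "0 \<le> q t" for t unfolding p_def q_def by (auto intro!: sum_nonneg nonneg)
  \<comment> \<open>The rows \<open>t\<close> of \<open>j0\<close> and \<open>j1\<close> are
    proportional, so the affinity within a row already equals that of the marginals. Only merging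
    the rows loses something, by Cauchy-Schwarz.\<close>
  have aff: "(\<Sum>s\<in>R. sqrt (j0 t s * j1 t s)) = sqrt (p t * q t)" for t
  proof (cases "p t = 0")
    case True
    then have "j0 t s = 0" if "s \<in> R" for s
      using that nonneg fin unfolding p_def by (simp add: sum_nonneg_eq_0_iff)
    then show ?thesis using True by simp
  next
    case False
    with pq have pos: "0 < p t" by (simp add: order_less_le)
    have "sqrt (j0 t s * j1 t s) = j0 t s * sqrt (q t / p t)" for s
    proof -
      have "j1 t s = j0 t s * (q t / p t)"
        using same[of t s] pos unfolding p_def[symmetric] q_def[symmetric] by (simp add: field_simps)
      then show ?thesis using nonneg(1)[of t s] by (simp add: real_sqrt_mult real_sqrt_divide)
    qed
    then have "(\<Sum>s\<in>R. sqrt (j0 t s * j1 t s)) = p t * sqrt (q t / p t)"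
      by (simp add: p_def sum_distrib_right)
    also have "\<dots> = sqrt (p t * q t)"
      using pos by (simp add: real_sqrt_divide real_sqrt_mult field_simps)
    finally show ?thesis .
  qed
  have "(\<Sum>t\<in>S. sqrt (p t * q t)) = (\<Sum>s\<in>R. \<Sum>t\<in>S. sqrt (j0 t s * j1 t s))"
    unfolding aff[symmetric] by (rule sum.swap)
  also have "\<dots> \<le> (\<Sum>s\<in>R. sqrt ((\<Sum>t\<in>S. j0 t s) * (\<Sum>t\<in>S. j1 t s)))"
    by (intro sum_mono sqrt_sum_mult_ge nonneg)
  finally have aff_le: "(\<Sum>t\<in>S. sqrt (p t * q t)) \<le> (\<Sum>s\<in>R. sqrt ((\<Sum>t\<in>S. j0 t s) * (\<Sum>t\<in>S. j1 t s)))" .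
  have "hellinger R (\<lambda>s. \<Sum>t\<in>S. j0 t s) (\<lambda>s. \<Sum>t\<in>S. j1 t s) = (\<Sum>s\<in>R. \<Sum>t\<in>S. j0 t s) + (\<Sum>s\<in>R. \<Sum>t\<in>S. j1 t s)
      - 2 * (\<Sum>s\<in>R. sqrt ((\<Sum>t\<in>S. j0 t s) * (\<Sum>t\<in>S. j1 t s)))"
    by (intro hellinger_eq_affinity sum_nonneg nonneg)
  moreover have "hellinger S p q = (\<Sum>t\<in>S. p t) + (\<Sum>t\<in>S. q t) - 2 * (\<Sum>t\<in>S. sqrt (p t * q t))"
    by (intro hellinger_eq_affinity pq)
  moreover have "(\<Sum>s\<in>R. \<Sum>t\<in>S. j0 t s) = (\<Sum>t\<in>S. p t)" "(\<Sum>s\<in>R. \<Sum>t\<in>S. j1 t s) = (\<Sum>t\<in>S. q t)"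
    unfolding p_def q_def by (rule sum.swap)+
  ultimately show ?thesis using aff_le unfolding p_def q_def by linarith
qed

lemma sum_law_pair:
  assumes "finite R" "g ` A \<subseteq> R"
  shows "(\<Sum>s\<in>R. law A (\<lambda>x. (f x, g x)) (t, s)) = law A f t"
proof -
  have "(\<Sum>s\<in>R. law A (\<lambda>x. (f x, g x)) (t, s)) = avg A (\<lambda>x. \<Sum>s\<in>R. of_bool (f x = t \<and> g x = s))"
    unfolding law_def by (subst avg_sum) simp
  also have "\<dots> = law A f t"
    unfolding law_def using assms by (intro avg_cong) (auto simp: of_bool_def)
  finally show ?thesis .
qed

lemma sum_law_pair':
  assumes "finite S" "f ` A \<subseteq> S"
  shows "(\<Sum>t\<in>S. law A (\<lambda>x. (f x, g x)) (t, s)) = law A g s"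
proof -
  have "law A (\<lambda>x. (f x, g x)) (t, s) = law A (\<lambda>x. (g x, f x)) (s, t)" for t
    unfolding law_def by (intro avg_cong) auto
  then show ?thesis using sum_law_pair[OF assms, of g s] by simp
qed

lemma law_eq_card: "finite A \<Longrightarrow> law A f t = real (card {x\<in>A. f x = t}) / real (card A)"
  unfolding law_def avg_def by (simp add: of_bool_def sum.If_cases Int_def)

text \<open>Laws under the uniform measure are counts, and exchanging the bits in \<open>K\<close>
  injects the pairs of samples on the left into those on the right.\<close>

lemma law_swap_le:
  assumes fin: "finite I"
    and swap: "\<And>\<eta> \<eta>'. \<eta> \<in> cube I \<Longrightarrow> \<eta>' \<in> cube I \<Longrightarrow> f \<eta> = t \<Longrightarrow> f' \<eta>' = t' \<Longrightarrow>
       g (override_on \<eta> \<eta>' K) = t \<and> g' (override_on \<eta>' \<eta> K) = t'"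
  shows "law (cube I) f t * law (cube I) f' t' \<le> law (cube I) g t * law (cube I) g' t'"
proof -
  let ?Q = "cube I" and ?h = "\<lambda>(\<eta>, \<eta>'). (override_on \<eta> \<eta>' K, override_on \<eta>' \<eta> K)"
  have "card ({x\<in>?Q. f x = t} \<times> {x\<in>?Q. f' x = t'}) \<le> card ({x\<in>?Q. g x = t} \<times> {x\<in>?Q. g' x = t'})"
  proof (rule card_inj_on_le[of ?h])
    show "inj_on ?h ({x\<in>?Q. f x = t} \<times> {x\<in>?Q. f' x = t'})"
      by (rule inj_on_inverseI[of _ ?h]) (auto simp: override_on_exchange)
    show "?h ` ({x\<in>?Q. f x = t} \<times> {x\<in>?Q. f' x = t'}) \<subseteq> {x\<in>?Q. g x = t} \<times> {x\<in>?Q. g' x = t'}"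
      using swap by auto
    show "finite ({x\<in>?Q. g x = t} \<times> {x\<in>?Q. g' x = t'})" using fin by simp
  qed
  then show ?thesis
    using fin by (simp add: law_eq_card card_cartesian_product divide_right_mono
        flip: of_nat_mult)
qed

text \<open>Twice the difference is an inner product of the vector of differences of square roots
  with, up to signs, the vector of their sums. Cauchy-Schwarz applies, and the second vector has
  squared length at most 4.\<close>

lemma power2_law_diff_le_hellinger:
  assumes "finite A" "A \<noteq> {}"
  shows "(law A f True - law A g True)\<^sup>2 \<le> hellinger UNIV (law A f) (law A g)"
proof -
  let ?a = "law A f True" and ?b = "law A g True"
  have "law A h False + law A h True = 1" for h
    using sum_law[OF finite subset_UNIV assms, of h] by (simp add: UNIV_bool)
  then have tot: "law A f False = 1 - ?a" "law A g False = 1 - ?b"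
    by (simp_all add: eq_diff_eq)
  have rng: "0 \<le> ?a" "?a \<le> 1" "0 \<le> ?b" "?b \<le> 1"
    using law_nonneg[of A f False] law_nonneg[of A g False] unfolding tot by auto
  let ?d1 = "sqrt ?a - sqrt ?b" and ?s1 = "sqrt ?a + sqrt ?b"
  let ?d2 = "sqrt (1 - ?a) - sqrt (1 - ?b)" and ?s2 = "sqrt (1 - ?a) + sqrt (1 - ?b)"
  have ds: "?d1 * ?s1 = ?a - ?b" "?d2 * ?s2 = ?b - ?a"
    using rng by (simp_all add: algebra_simps)
  have "(?d1 * ?s1 - ?d2 * ?s2)\<^sup>2 \<le> (?d1\<^sup>2 + ?d2\<^sup>2) * (?s1\<^sup>2 + ?s2\<^sup>2)"
  proof -
    have "0 \<le> (x * w + y * z)\<^sup>2 \<Longrightarrow> (x * z - y * w)\<^sup>2 \<le> (x\<^sup>2 + y\<^sup>2) * (z\<^sup>2 + w\<^sup>2)" for x y z w :: real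
      by (simp add: power2_eq_square algebra_simps)
    then show ?thesis by simp
  qed
  also have "\<dots> \<le> (?d1\<^sup>2 + ?d2\<^sup>2) * 4"
  proof (rule mult_left_mono)
    have "?s1\<^sup>2 + ?s2\<^sup>2 + ?d1\<^sup>2 + ?d2\<^sup>2 = 4"
      using rng by (simp add: power2_eq_square algebra_simps)
    then show "?s1\<^sup>2 + ?s2\<^sup>2 \<le> 4" using zero_le_power2[of ?d1] zero_le_power2[of ?d2] by linarith
  qed simp
  finally have "(2 * (?a - ?b))\<^sup>2 \<le> 4 * (?d1\<^sup>2 + ?d2\<^sup>2)"
    unfolding ds by (simp add: algebra_simps)
  then have "4 * (?a - ?b)\<^sup>2 \<le> 4 * (?d1\<^sup>2 + ?d2\<^sup>2)"
    by (simp only: power_mult_distrib) simp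
  then show ?thesis
    unfolding hellinger_def UNIV_bool by (simp add: tot)
qed

section \<open>Lower bound for cut transcripts\<close>

definition mix :: "nat \<Rightarrow> (nat \<Rightarrow> nat \<Rightarrow> bool) \<Rightarrow> (nat \<Rightarrow> nat \<Rightarrow> bool) \<Rightarrow> nat \<Rightarrow> nat \<Rightarrow> bool" where
  "mix i X X' = (\<lambda>l a. if a = i then X l a else X' l a)"

locale hard_inputs =
  fixes k n :: nat
begin

definition Idx :: "(nat \<times> nat) set" where "Idx = {..<n} \<times> {0..k}"

abbreviation Q :: "(nat \<times> nat \<Rightarrow> bool) set" where "Q \<equiv> cube Idx"

lemma finite_Idx [simp]: "finite Idx"
  unfolding Idx_def by simp

text \<open>
  The random bit \<open>\<omega> (l, 0)\<close> is the mode of coordinate \<open>l\<close>, the bit \<open>\<omega> (l, a)\<close> is the noise of player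
  \<open>a \<ge> 1\<close>, and \<open>\<zeta> l\<close> is the player with the planted zero.
\<close>
definition mat :: "(nat \<Rightarrow> nat) \<Rightarrow> (nat \<times> nat \<Rightarrow> bool) \<Rightarrow> nat \<Rightarrow> nat \<Rightarrow> bool" where
  "mat \<zeta> \<omega> l a \<longleftrightarrow> l < n \<and> 0 < a \<and> a \<noteq> \<zeta> l \<and> (\<omega> (l, 0) \<or> \<omega> (l, a))"

text \<open>
  Coordinate \<open>l\<close> is analysed given the modes of the coordinates before it and the bits that
  player \<open>i\<close> holds after it.  This makes the chain rule for the modes (ascending) and the chain rule
  for the bits of player \<open>i\<close> (descending) refer to the same conditioning, while the inputs of \<open>i\<close> and of
  the others remain independent.
\<close>
definition past :: "nat \<Rightarrow> (nat \<times> nat) set" where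
  "past l = (\<lambda>j. (j, 0)) ` {..<l}"

definition tail :: "nat \<Rightarrow> nat \<Rightarrow> (nat \<Rightarrow> nat \<Rightarrow> bool) \<Rightarrow> bool list" where
  "tail i l X = map (\<lambda>j. X j i) [Suc l..<n]"

lemma finite_tails: "finite {xs :: bool list. length xs = m}"
  using finite_lists_length_eq[of "UNIV :: bool set" m] by simp

text \<open>A sample given only the modes before \<open>l\<close>, with column \<open>l\<close>
  replaced by \<open>c\<close>. The later bits of player \<open>i\<close> are not fixed here; they
  are made visible in \<open>T\<close> instead.\<close>

definition cfg :: "(nat \<Rightarrow> nat) \<Rightarrow> nat \<Rightarrow> (nat \<times> nat \<Rightarrow> bool) \<Rightarrow> (nat \<times> nat \<Rightarrow> bool)
    \<Rightarrow> (nat \<Rightarrow> bool) \<Rightarrow> nat \<Rightarrow> nat \<Rightarrow> bool" where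
  "cfg \<zeta> l \<omega> \<eta> c = (mat \<zeta> (override_on \<eta> \<omega> (past l)))(l := c)"

text \<open>The columns against which the bit of a player is varied: \<open>noisy\<close> belongs to
  mode 0, \<open>all_but\<close> to mode 1, and \<open>all_one\<close> has no planted zero. All
  three take the sample as an argument so that each can be passed to \<open>P\<close>.\<close>

definition noisy :: "nat \<Rightarrow> nat \<Rightarrow> (nat \<times> nat \<Rightarrow> bool) \<Rightarrow> nat \<Rightarrow> bool" where
  "noisy l z \<eta> a \<longleftrightarrow> 0 < a \<and> a \<noteq> z \<and> \<eta> (l, a)"

definition all_but :: "nat \<Rightarrow> (nat \<times> nat \<Rightarrow> bool) \<Rightarrow> nat \<Rightarrow> bool" where
  "all_but z \<eta> a \<longleftrightarrow> 0 < a \<and> a \<noteq> z"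

definition all_one :: "(nat \<times> nat \<Rightarrow> bool) \<Rightarrow> nat \<Rightarrow> bool" where
  "all_one \<eta> a \<longleftrightarrow> 0 < a"

text \<open>The planted player of coordinate \<open>l\<close> affects only the column that is
  replaced. Hence \<open>\<zeta> l\<close> can be averaged over independently of the laws at
  coordinate \<open>l\<close>.\<close>

lemma cfg_update: "cfg (\<zeta>(l := z)) l \<omega> \<eta> c = cfg \<zeta> l \<omega> \<eta> c"
  unfolding cfg_def mat_def by (auto simp: fun_eq_iff)

definition own :: "nat \<Rightarrow> nat \<Rightarrow> (nat \<times> nat) set" where
  "own l i = {(j, i) | j. j < l}"

end

section \<open>Rectangle property at one coordinate\<close>

text \<open>
  \<open>Tr i\<close> is the transcript of the cut between player \<open>i\<close> and the others.  The last two assumptions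
  bound, via Kraft's inequality, the entropy of the transcript given either side of the cut.
\<close>
locale cut_transcripts = hard_inputs k n for k n :: nat +
  fixes Tr :: "nat \<Rightarrow> (nat \<Rightarrow> nat \<Rightarrow> bool) \<Rightarrow> 't"
    and out :: "nat \<Rightarrow> (nat \<Rightarrow> nat \<Rightarrow> bool) \<Rightarrow> bool"
    and cost :: "nat \<Rightarrow> (nat \<Rightarrow> nat \<Rightarrow> bool) \<Rightarrow> nat"
  assumes finite_Tr: "i \<in> {1..k} \<Longrightarrow> finite (range (Tr i))"
    and Tr_mix: "i \<in> {1..k} \<Longrightarrow> Tr i X = \<tau> \<Longrightarrow> Tr i X' = \<tau> \<Longrightarrow> Tr i (mix i X X') = \<tau>"
    and Tr_rest: "i \<in> {1..k} \<Longrightarrow> j \<in> {1..k} \<Longrightarrow> i \<noteq> j \<Longrightarrow> Tr i X = Tr i X' \<Longrightarrow>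
        (\<And>l a. a \<noteq> i \<Longrightarrow> X l a = X' l a) \<Longrightarrow> Tr j X = Tr j X' \<and> out j X = out j X'"
    and code_row: "i \<in> {1..k} \<Longrightarrow> \<exists>len::'t \<Rightarrow> nat.
        (\<Sum>t\<in>Tr i ` {X. \<forall>l. X l i = X0 l i}. (1/2) ^ len t) \<le> (1::real) \<and>
        (\<forall>X. (\<forall>l. X l i = X0 l i) \<longrightarrow> len (Tr i X) \<le> cost i X)"
    and code_rest: "i \<in> {1..k} \<Longrightarrow> \<exists>len::'t \<Rightarrow> nat.
        (\<Sum>t\<in>Tr i ` {X. \<forall>l a. a \<noteq> i \<longrightarrow> X l a = X0 l a}. (1/2) ^ len t) \<le> (1::real) \<and>
        (\<forall>X. (\<forall>l a. a \<noteq> i \<longrightarrow> X l a = X0 l a) \<longrightarrow> len (Tr i X) \<le> cost i X)"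
begin

text \<open>Publishing the tail with the transcript replaces conditioning on it: samples with the
  same \<open>T\<close> agree on the later bits of \<open>i\<close>, so rows can be exchanged
  although the later modes correlate them.\<close>

definition T :: "nat \<Rightarrow> nat \<Rightarrow> (nat \<Rightarrow> nat \<Rightarrow> bool) \<Rightarrow> 't \<times> bool list" where
  "T i l X = (Tr i X, tail i l X)"

definition rng :: "nat \<Rightarrow> nat \<Rightarrow> ('t \<times> bool list) set" where
  "rng i l = range (Tr i) \<times> {xs. length xs = n - Suc l}"

lemma T_in_rng [simp]: "T i l X \<in> rng i l"
  unfolding T_def rng_def tail_def by simp

lemma finite_rng [simp]: "i \<in> {1..k} \<Longrightarrow> finite (rng i l)"
  unfolding rng_def using finite_Tr finite_tails by auto

definition P :: "(nat \<Rightarrow> nat) \<Rightarrow> nat \<Rightarrow> (nat \<times> nat \<Rightarrow> bool) \<Rightarrow> nat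
    \<Rightarrow> ((nat \<times> nat \<Rightarrow> bool) \<Rightarrow> nat \<Rightarrow> bool) \<Rightarrow> bool \<Rightarrow> 't \<times> bool list \<Rightarrow> real" where
  "P \<zeta> l \<omega> i y b = law Q (\<lambda>\<eta>. T i l (cfg \<zeta> l \<omega> \<eta> ((y \<eta>)(i := b))))"

lemma P_update: "P (\<zeta>(l := z)) l \<omega> i y b = P \<zeta> l \<omega> i y b"
  unfolding P_def cfg_update ..

lemma sum_P: "i \<in> {1..k} \<Longrightarrow> (\<Sum>t\<in>rng i l. P \<zeta> l \<omega> i y b t) = 1"
  unfolding P_def by (intro sum_law) auto

lemma P_nonneg [simp]: "0 \<le> P \<zeta> l \<omega> i y b t"
  unfolding P_def by simp

definition fixed_by_rest :: "nat \<Rightarrow> ((nat \<Rightarrow> nat \<Rightarrow> bool) \<Rightarrow> 's) \<Rightarrow> bool" where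
  "fixed_by_rest i g \<longleftrightarrow> (\<forall>X X'. Tr i X = Tr i X' \<longrightarrow> (\<forall>l a. a \<noteq> i \<longrightarrow> X l a = X' l a) \<longrightarrow> g X = g X')"

text \<open>
  Exchanging the noise of player \<open>i\<close> before coordinate \<open>l\<close> between two samples preserves the
  measure and, by the rectangle property, the transcript.
\<close>
lemma law_cfg_swap_le:
  fixes \<zeta> :: "nat \<Rightarrow> nat" and \<omega> :: "nat \<times> nat \<Rightarrow> bool"
  assumes i: "i \<in> {1..k}" and l: "l < n"
    and y: "\<And>\<eta> \<eta>'. y (override_on \<eta> \<eta>' (own l i)) = y \<eta>" "\<And>\<eta> \<eta>'. y' (override_on \<eta> \<eta>' (own l i)) = y' \<eta>"
    and g: "fixed_by_rest i g"
  defines "C \<equiv> \<lambda>\<eta> y b. cfg \<zeta> l \<omega> \<eta> ((y \<eta>)(i := b))"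
  shows "law Q (\<lambda>\<eta>. (T i l (C \<eta> y b), g (C \<eta> y b))) (t, s) * law Q (\<lambda>\<eta>. T i l (C \<eta> y' b')) t
     \<le> law Q (\<lambda>\<eta>. (T i l (C \<eta> y b'), g (C \<eta> y b'))) (t, s) * law Q (\<lambda>\<eta>. T i l (C \<eta> y' b)) t"
proof (rule law_swap_le[where K = "own l i"])
  fix \<eta> \<eta>' :: "nat \<times> nat \<Rightarrow> bool"
  assume "(T i l (C \<eta> y b), g (C \<eta> y b)) = (t, s)" and t': "T i l (C \<eta>' y' b') = t"
  then have t: "T i l (C \<eta> y b) = t" and s: "g (C \<eta> y b) = s" by auto
  from t t' have eq: "Tr i (C \<eta> y b) = fst t" "Tr i (C \<eta>' y' b') = fst t"
      "tail i l (C \<eta> y b) = snd t" "tail i l (C \<eta>' y' b') = snd t"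
    unfolding T_def by auto
  \<comment> \<open>After \<open>l\<close> the row of \<open>i\<close> depends on modes that are not
    fixed, so its noise is not exchanged; equal tails make the two rows agree there anyway. From
    \<open>n\<close> on they are constantly 0.\<close>
  have tl: "C \<eta> y b j i = C \<eta>' y' b' j i" if "l < j" for j
  proof (cases "j < n")
    case True
    then have "map (\<lambda>j. C \<eta> y b j i) [Suc l..<n] = map (\<lambda>j. C \<eta>' y' b' j i) [Suc l..<n]" "j \<in> set [Suc l..<n]"
      using eq(3,4) that unfolding tail_def by auto
    then show ?thesis by (metis map_eq_conv)
  next
    case False
    then show ?thesis using that unfolding C_def cfg_def mat_def by simp
  qed
  let ?\<eta> = "override_on \<eta> \<eta>' (own l i)" and ?\<eta>' = "override_on \<eta>' \<eta> (own l i)"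
  have C: "C ?\<eta> y b' = cfg \<zeta> l \<omega> ?\<eta> ((y \<eta>)(i := b'))" "C ?\<eta>' y' b = cfg \<zeta> l \<omega> ?\<eta>' ((y' \<eta>')(i := b))"
    by (simp_all add: C_def y)
  have row: "C ?\<eta> y b' = mix i (C \<eta>' y' b') (C \<eta> y b)"
    unfolding C
  proof (intro ext)
    fix j a
    consider "a \<noteq> i" | "a = i" "j < l" | "a = i" "j = l" | "a = i" "l < j" by linarith
    then show "cfg \<zeta> l \<omega> ?\<eta> ((y \<eta>)(i := b')) j a = mix i (C \<eta>' y' b') (C \<eta> y b) j a"
    proof cases
      case 4
      then show ?thesis using tl[of j, symmetric] i
        by (auto simp: C_def cfg_def mix_def mat_def override_on_def own_def past_def)
    qed (use i in \<open>auto simp: C_def cfg_def mix_def mat_def override_on_def own_def past_def\<close>)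
  qed
  have row': "C ?\<eta>' y' b = mix i (C \<eta> y b) (C \<eta>' y' b')"
    unfolding C
  proof (intro ext)
    fix j a
    consider "a \<noteq> i" | "a = i" "j < l" | "a = i" "j = l" | "a = i" "l < j" by linarith
    then show "cfg \<zeta> l \<omega> ?\<eta>' ((y' \<eta>')(i := b)) j a = mix i (C \<eta> y b) (C \<eta>' y' b') j a"
    proof cases
      case 4
      then show ?thesis using tl[of j, symmetric] i
        by (auto simp: C_def cfg_def mix_def mat_def override_on_def own_def past_def)
    qed (use i in \<open>auto simp: C_def cfg_def mix_def mat_def override_on_def own_def past_def\<close>)
  qed
  have Tr: "Tr i (C ?\<eta> y b') = fst t" "Tr i (C ?\<eta>' y' b) = fst t"
    unfolding row row' using Tr_mix[OF i] eq by auto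
  have tls: "tail i l (C ?\<eta> y b') = snd t" "tail i l (C ?\<eta>' y' b) = snd t"
    using eq(3,4) unfolding tail_def row row' mix_def by auto
  have "g (C ?\<eta> y b') = g (C \<eta> y b)"
    by (rule g[unfolded fixed_by_rest_def, rule_format]) (use Tr eq in \<open>auto simp: row mix_def\<close>)
  with Tr tls s show "(T i l (C ?\<eta> y b'), g (C ?\<eta> y b')) = (t, s) \<and> T i l (C ?\<eta>' y' b) = t"
    unfolding T_def by (auto simp: prod_eq_iff)
qed simp

lemma law_cfg_swap:
  fixes \<zeta> :: "nat \<Rightarrow> nat" and \<omega> :: "nat \<times> nat \<Rightarrow> bool"
  assumes "i \<in> {1..k}" "l < n"
    and "\<And>\<eta> \<eta>'. y (override_on \<eta> \<eta>' (own l i)) = y \<eta>" "\<And>\<eta> \<eta>'. y' (override_on \<eta> \<eta>' (own l i)) = y' \<eta>"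
    and "fixed_by_rest i g"
  defines "C \<equiv> \<lambda>\<eta> y b. cfg \<zeta> l \<omega> \<eta> ((y \<eta>)(i := b))"
  shows "law Q (\<lambda>\<eta>. (T i l (C \<eta> y b), g (C \<eta> y b))) (t, s) * P \<zeta> l \<omega> i y' b' t
     = law Q (\<lambda>\<eta>. (T i l (C \<eta> y b'), g (C \<eta> y b'))) (t, s) * P \<zeta> l \<omega> i y' b t"
  unfolding C_def P_def
  by (rule order.antisym[OF law_cfg_swap_le[OF assms(1-5)] law_cfg_swap_le[OF assms(1-5)]])

lemma P_cut_paste:
  assumes i: "i \<in> {1..k}" "l < n"
    and y: "\<And>\<eta> \<eta>'. y (override_on \<eta> \<eta>' (own l i)) = y \<eta>" "\<And>\<eta> \<eta>'. y' (override_on \<eta> \<eta>' (own l i)) = y' \<eta>"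
  shows "hellinger (rng i l) (P \<zeta> l \<omega> i y b) (P \<zeta> l \<omega> i y' b') = hellinger (rng i l) (P \<zeta> l \<omega> i y b') (P \<zeta> l \<omega> i y' b)"
proof (rule hellinger_cut_paste)
  fix t
  have "law Q (\<lambda>\<eta>. (T i l (cfg \<zeta> l \<omega> \<eta> ((y \<eta>)(i := b))), ())) (t, ()) = P \<zeta> l \<omega> i y b t" for b
    unfolding P_def law_def by simp
  then show "P \<zeta> l \<omega> i y b t * P \<zeta> l \<omega> i y' b' t = P \<zeta> l \<omega> i y b' t * P \<zeta> l \<omega> i y' b t"
    using law_cfg_swap[OF i y, unfolded fixed_by_rest_def, where g = "\<lambda>_. ()" and s = "()" and b = b and b' = b' and \<zeta> = \<zeta> and \<omega> = \<omega> and t = t] by simp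
qed (use i in \<open>auto simp: sum_P\<close>)

text \<open>Given \<open>T\<close>, the other rows are independent of the bit of \<open>i\<close> in
  column \<open>l\<close>. So \<open>g\<close> arises from \<open>T\<close> by a channel that
  ignores this bit, and data processing applies.\<close>

lemma hellinger_rest_le:
  assumes i: "i \<in> {1..k}" "l < n"
    and y: "\<And>\<eta> \<eta>'. y (override_on \<eta> \<eta>' (own l i)) = y \<eta>"
    and g: "fixed_by_rest i g"
    and R: "finite R" "range g \<subseteq> R"
  shows "hellinger R (law Q (\<lambda>\<eta>. g (cfg \<zeta> l \<omega> \<eta> ((y \<eta>)(i := b))))) (law Q (\<lambda>\<eta>. g (cfg \<zeta> l \<omega> \<eta> ((y \<eta>)(i := b')))))
    \<le> hellinger (rng i l) (P \<zeta> l \<omega> i y b) (P \<zeta> l \<omega> i y b')"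
proof -
  let ?C = "\<lambda>b \<eta>. cfg \<zeta> l \<omega> \<eta> ((y \<eta>)(i := b))"
  let ?j = "\<lambda>b t s. law Q (\<lambda>\<eta>. (T i l (?C b \<eta>), g (?C b \<eta>))) (t, s)"
  have sums: "(\<lambda>t. \<Sum>s\<in>R. ?j b t s) = P \<zeta> l \<omega> i y b"
      "(\<lambda>s. \<Sum>t\<in>rng i l. ?j b t s) = law Q (\<lambda>\<eta>. g (?C b \<eta>))" for b
    unfolding P_def using R i by (auto intro!: ext sum_law_pair sum_law_pair')
  have "hellinger R (\<lambda>s. \<Sum>t\<in>rng i l. ?j b t s) (\<lambda>s. \<Sum>t\<in>rng i l. ?j b' t s)
      \<le> hellinger (rng i l) (\<lambda>t. \<Sum>s\<in>R. ?j b t s) (\<lambda>t. \<Sum>s\<in>R. ?j b' t s)"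
  proof (rule hellinger_transfer)
    show "?j b t s * (\<Sum>s\<in>R. ?j b' t s) = ?j b' t s * (\<Sum>s\<in>R. ?j b t s)" for t s
      using law_cfg_swap[OF i y y g, where b = b and b' = b' and \<zeta> = \<zeta> and \<omega> = \<omega> and t = t and s = s]
        fun_cong[OF sums(1)[of b]] fun_cong[OF sums(1)[of b']] by simp
  qed (use R i in auto)
  then show ?thesis unfolding sums .
qed


section \<open>Information revealed per coordinate\<close>

lemma cond_hellinger_eq_avg_hellinger:
  assumes "\<And>\<eta> \<omega>. y (override_on \<eta> \<omega> (past l)) = y \<eta>" "\<And>\<eta> \<omega>. y' (override_on \<eta> \<omega> (past l)) = y' \<eta>"
  shows "cond_hellinger (rng i l) Idx (past l) (\<lambda>\<theta>. T i l ((mat \<zeta> \<theta>)(l := (y \<theta>)(i := b))))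
        (\<lambda>\<theta>. T i l ((mat \<zeta> \<theta>)(l := (y' \<theta>)(i := b'))))
     = avg Q (\<lambda>\<omega>. hellinger (rng i l) (P \<zeta> l \<omega> i y b) (P \<zeta> l \<omega> i y' b'))"
  unfolding cond_hellinger_def P_def cfg_def assms ..

lemma noisy_past: "noisy l z (override_on \<eta> \<omega> (past l)) = noisy l z \<eta>"
  unfolding noisy_def past_def by (auto simp: override_on_def fun_eq_iff)

lemma all_but_past: "all_but z (override_on \<eta> \<omega> (past l)) = all_but z \<eta>"
  unfolding all_but_def ..

text \<open>All bits but the noise of \<open>i\<close> are conditioned on, so
  \<open>code_rest\<close> bounds the entropy: the decoder knows the other rows. The chain rule
  contributes 4, and restricting to mode 0 another 2.\<close>

lemma row_information:
  assumes i: "i \<in> {1..k}"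
  shows "(\<Sum>l<n. if \<zeta> l = i then 0 else
      avg Q (\<lambda>\<omega>. hellinger (rng i l) (P \<zeta> l \<omega> i (noisy l (\<zeta> l)) False) (P \<zeta> l \<omega> i (noisy l (\<zeta> l)) True)))
    \<le> 8 * ln 2 * avg Q (\<lambda>\<omega>. real (cost i (mat \<zeta> \<omega>)))"
proof -
  let ?S = "range (Tr i)"
  let ?J = "{(j, a). a \<noteq> i} :: (nat \<times> nat) set"
  let ?f = "\<lambda>\<eta>. Tr i (mat \<zeta> \<eta>)"
  \<comment> \<open>In descending order, the bits revealed before coordinate \<open>l\<close> are
    exactly the noise of \<open>i\<close> after it, which determines the tail once the modes are
    known.\<close>
  let ?b = "\<lambda>s. (n - Suc s, i)"
  let ?G = "\<lambda>l. cond_hellinger ?S Idx (?J \<union> {(j, i) | j. l < j \<and> j < n}) (\<lambda>\<eta>. ?f (\<eta>((l, i) := False))) (\<lambda>\<eta>. ?f (\<eta>((l, i) := True)))"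
  have "cond_ent ?S Idx ?J ?f \<le> ln 2 * avg Q (\<lambda>\<eta>. real (cost i (mat \<zeta> \<eta>)))"
  proof (rule cond_ent_le_length)
    fix \<omega> assume "\<omega> \<in> Q"
    have row: "mat \<zeta> (override_on \<eta> \<omega> ?J) l a = mat \<zeta> \<omega> l a" if "a \<noteq> i" for \<eta> l a
      using that i by (auto simp: mat_def override_on_def)
    obtain len :: "'t \<Rightarrow> nat" where len: "(\<Sum>t\<in>Tr i ` {X. \<forall>l a. a \<noteq> i \<longrightarrow> X l a = mat \<zeta> \<omega> l a}. (1/2) ^ len t) \<le> (1::real)"
        "\<And>X. (\<And>l a. a \<noteq> i \<Longrightarrow> X l a = mat \<zeta> \<omega> l a) \<Longrightarrow> len (Tr i X) \<le> cost i X"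
      using code_rest[OF i, of "mat \<zeta> \<omega>"] by blast
    have "(\<Sum>t\<in>(\<lambda>\<eta>. ?f (override_on \<eta> \<omega> ?J)) ` Q. (1/2) ^ len t)
        \<le> (\<Sum>t\<in>Tr i ` {X. \<forall>l a. a \<noteq> i \<longrightarrow> X l a = mat \<zeta> \<omega> l a}. (1/2) ^ len t :: real)"
      using row by (intro sum_mono2) (auto intro!: finite_subset[OF _ finite_Tr[OF i]] imageI)
    with len show "\<exists>len::'t \<Rightarrow> nat. (\<Sum>t\<in>(\<lambda>\<eta>. ?f (override_on \<eta> \<omega> ?J)) ` Q. (1/2) ^ len t) \<le> (1::real) \<and>
        (\<forall>\<eta>\<in>Q. len (?f (override_on \<eta> \<omega> ?J)) \<le> cost i (mat \<zeta> (override_on \<eta> \<omega> ?J)))"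
      using row by (intro exI[of _ len]) fastforce
  qed (use finite_Tr[OF i] in auto)
  moreover have "(\<Sum>s<n. if ?b s \<in> ?J then 0 else cond_hellinger ?S Idx (?J \<union> ?b ` {..<s})
      (\<lambda>\<eta>. ?f (\<eta>(?b s := False))) (\<lambda>\<eta>. ?f (\<eta>(?b s := True)))) \<le> 4 * cond_ent ?S Idx ?J ?f"
    using i by (intro cond_ent_chain) (auto simp: inj_on_def Idx_def)
  moreover have "(\<Sum>s<n. if ?b s \<in> ?J then 0 else cond_hellinger ?S Idx (?J \<union> ?b ` {..<s})
      (\<lambda>\<eta>. ?f (\<eta>(?b s := False))) (\<lambda>\<eta>. ?f (\<eta>(?b s := True)))) = (\<Sum>l<n. ?G l)"
  proof -
    have "?b ` {..<s} = {(j, i) | j. n - Suc s < j \<and> j < n}" if "s < n" for s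
    proof (intro equalityI subsetI)
      fix p assume "p \<in> {(j, i) | j. n - Suc s < j \<and> j < n}"
      then obtain j where "p = (j, i)" "n - Suc s < j" "j < n" by auto
      then have "p = ?b (n - Suc j)" "n - Suc j < s" by auto
      then show "p \<in> ?b ` {..<s}" by blast
    qed (use that in auto)
    then have "(\<Sum>s<n. if ?b s \<in> ?J then 0 else cond_hellinger ?S Idx (?J \<union> ?b ` {..<s})
      (\<lambda>\<eta>. ?f (\<eta>(?b s := False))) (\<lambda>\<eta>. ?f (\<eta>(?b s := True)))) = (\<Sum>s<n. ?G (n - Suc s))"
      by (intro sum.cong) auto
    also have "\<dots> = (\<Sum>l<n. ?G l)" by (rule sum.nat_diff_reindex)
    finally show ?thesis .
  qed
  moreover have "(if \<zeta> l = i then 0 else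
      avg Q (\<lambda>\<omega>. hellinger (rng i l) (P \<zeta> l \<omega> i (noisy l (\<zeta> l)) False) (P \<zeta> l \<omega> i (noisy l (\<zeta> l)) True))) \<le> 2 * ?G l"
    if l: "l < n" for l
  proof (cases "\<zeta> l = i")
    case False
    let ?J' = "?J \<union> {(j, i) | j. l < j \<and> j < n}"
    have "(l, 0) \<in> Idx" using l by (simp add: Idx_def)
    have col: "mat \<zeta> (\<theta>((l, 0) := False, (l, i) := b)) = (mat \<zeta> \<theta>)(l := (noisy l (\<zeta> l) \<theta>)(i := b))" for \<theta> b
      using l i False by (auto simp: fun_eq_iff mat_def noisy_def)
    have "avg Q (\<lambda>\<omega>. hellinger (rng i l) (P \<zeta> l \<omega> i (noisy l (\<zeta> l)) False) (P \<zeta> l \<omega> i (noisy l (\<zeta> l)) True))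
       = cond_hellinger (rng i l) Idx (past l) (\<lambda>\<theta>. T i l (mat \<zeta> (\<theta>((l, 0) := False, (l, i) := False))))
           (\<lambda>\<theta>. T i l (mat \<zeta> (\<theta>((l, 0) := False, (l, i) := True))))"
      unfolding col by (rule cond_hellinger_eq_avg_hellinger[symmetric]) (rule noisy_past)+
    also have "\<dots> \<le> 2 * cond_hellinger (rng i l) Idx (insert (l, 0) (past l)) (\<lambda>\<theta>. T i l (mat \<zeta> (\<theta>((l, i) := False))))
           (\<lambda>\<theta>. T i l (mat \<zeta> (\<theta>((l, i) := True))))"
      using cond_hellinger_insert_ge[OF finite_Idx \<open>(l, 0) \<in> Idx\<close>, of "rng i l" "past l" "\<lambda>\<theta>. T i l (mat \<zeta> (\<theta>((l, i) := False)))" False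
          "\<lambda>\<theta>. T i l (mat \<zeta> (\<theta>((l, i) := True)))"] by simp
    also have "cond_hellinger (rng i l) Idx (insert (l, 0) (past l)) (\<lambda>\<theta>. T i l (mat \<zeta> (\<theta>((l, i) := False))))
           (\<lambda>\<theta>. T i l (mat \<zeta> (\<theta>((l, i) := True))))
        \<le> cond_hellinger (rng i l) Idx ?J' (\<lambda>\<theta>. T i l (mat \<zeta> (\<theta>((l, i) := False))))
           (\<lambda>\<theta>. T i l (mat \<zeta> (\<theta>((l, i) := True))))"
      using i by (intro cond_hellinger_mono) (auto simp: past_def)
    also have "\<dots> \<le> ?G l"
      unfolding rng_def T_def
    proof (rule cond_hellinger_pair_le)
      fix \<omega> assume "\<omega> \<in> Q"
      have "tail i l (mat \<zeta> ((override_on \<eta> \<omega> ?J')((l, i) := b))) = tail i l (mat \<zeta> \<omega>)" for \<eta> b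
        using i by (auto simp: tail_def mat_def override_on_def)
      then show "\<exists>v\<in>{xs. length xs = n - Suc l}. \<forall>\<eta>\<in>Q.
          tail i l (mat \<zeta> ((override_on \<eta> \<omega> ?J')((l, i) := False))) = v \<and>
          tail i l (mat \<zeta> ((override_on \<eta> \<omega> ?J')((l, i) := True))) = v"
        by (intro bexI[of _ "tail i l (mat \<zeta> \<omega>)"]) (auto simp: tail_def)
    qed (use finite_Tr[OF i] finite_tails in auto)
    finally show ?thesis using False by simp
  qed simp
  then have "(\<Sum>l<n. if \<zeta> l = i then 0 else
      avg Q (\<lambda>\<omega>. hellinger (rng i l) (P \<zeta> l \<omega> i (noisy l (\<zeta> l)) False) (P \<zeta> l \<omega> i (noisy l (\<zeta> l)) True)))
     \<le> 2 * (\<Sum>l<n. ?G l)"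
    unfolding sum_distrib_left by (intro sum_mono) auto
  ultimately show ?thesis by linarith
qed

text \<open>
  The mode of coordinate \<open>j\<close> is independent of the bit of player \<open>i\<close> once the noise \<open>\<upsilon> (j, i)\<close> is 1, and
  equals this bit when it is 0.  So the row of \<open>i\<close> is fixed by its noise \<open>\<upsilon>\<close> together with the modes in
  \<open>?J \<upsilon>\<close>, and the remaining modes are still uniform.
\<close>
lemma mode_information:
  assumes i: "i \<in> {1..k}"
  shows "(\<Sum>l<n. if \<zeta> l = i then 0 else
      avg Q (\<lambda>\<omega>. hellinger (rng i l) (P \<zeta> l \<omega> i (noisy l (\<zeta> l)) True) (P \<zeta> l \<omega> i (all_but (\<zeta> l)) True)))
    \<le> 8 * ln 2 * avg Q (\<lambda>\<omega>. real (cost i (mat \<zeta> \<omega>)))"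
proof -
  let ?S = "range (Tr i)"
  let ?U = "{(j, a). a = i} :: (nat \<times> nat) set"
  let ?J = "\<lambda>\<upsilon> :: nat \<times> nat \<Rightarrow> bool. {(j, a). a = 0 \<and> \<not> \<upsilon> (j, i)}"
  let ?b = "\<lambda>s. (s, 0) :: nat \<times> nat"
  let ?m = "\<lambda>\<upsilon> \<eta>. mat \<zeta> (override_on \<eta> \<upsilon> ?U)"
  let ?A = "\<lambda>l \<upsilon>. cond_hellinger (rng i l) Idx (past l) (\<lambda>\<eta>. T i l (?m \<upsilon> (\<eta>((l, 0) := False)))) (\<lambda>\<eta>. T i l (?m \<upsilon> (\<eta>((l, 0) := True))))"
  let ?c = "\<lambda>\<upsilon>. avg Q (\<lambda>\<eta>. real (cost i (?m \<upsilon> \<eta>)))"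
  have main: "(\<Sum>l<n. of_bool (\<upsilon> (l, i)) * ?A l \<upsilon>) \<le> 4 * ln 2 * ?c \<upsilon>" if \<upsilon>: "\<upsilon> \<in> Q" for \<upsilon>
  proof -
    let ?f = "\<lambda>\<eta>. Tr i (?m \<upsilon> \<eta>)"
    have "cond_ent ?S Idx (?J \<upsilon>) ?f \<le> ln 2 * ?c \<upsilon>"
    proof (rule cond_ent_le_length)
      fix \<omega> assume "\<omega> \<in> Q"
      have row: "?m \<upsilon> (override_on \<eta> \<omega> (?J \<upsilon>)) l i = ?m \<upsilon> \<omega> l i" for \<eta> l
        using i by (auto simp: mat_def override_on_def)
      obtain len :: "'t \<Rightarrow> nat" where len: "(\<Sum>t\<in>Tr i ` {X. \<forall>l. X l i = ?m \<upsilon> \<omega> l i}. (1/2) ^ len t) \<le> (1::real)"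
          "\<And>X. (\<And>l. X l i = ?m \<upsilon> \<omega> l i) \<Longrightarrow> len (Tr i X) \<le> cost i X"
        using code_row[OF i, of "?m \<upsilon> \<omega>"] by blast
      have "(\<Sum>t\<in>(\<lambda>\<eta>. ?f (override_on \<eta> \<omega> (?J \<upsilon>))) ` Q. (1/2) ^ len t)
          \<le> (\<Sum>t\<in>Tr i ` {X. \<forall>l. X l i = ?m \<upsilon> \<omega> l i}. (1/2) ^ len t :: real)"
        using row by (intro sum_mono2) (auto intro!: finite_subset[OF _ finite_Tr[OF i]] imageI)
      with len show "\<exists>len::'t \<Rightarrow> nat. (\<Sum>t\<in>(\<lambda>\<eta>. ?f (override_on \<eta> \<omega> (?J \<upsilon>))) ` Q. (1/2) ^ len t) \<le> (1::real) \<and>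
          (\<forall>\<eta>\<in>Q. len (?f (override_on \<eta> \<omega> (?J \<upsilon>))) \<le> cost i (?m \<upsilon> (override_on \<eta> \<omega> (?J \<upsilon>))))"
        using row by (intro exI[of _ len]) fastforce
    qed (use finite_Tr[OF i] in auto)
    moreover have "(\<Sum>s<n. if ?b s \<in> ?J \<upsilon> then 0 else cond_hellinger ?S Idx (?J \<upsilon> \<union> ?b ` {..<s})
        (\<lambda>\<eta>. ?f (\<eta>(?b s := False))) (\<lambda>\<eta>. ?f (\<eta>(?b s := True)))) \<le> 4 * cond_ent ?S Idx (?J \<upsilon>) ?f"
      by (intro cond_ent_chain) (auto simp: inj_on_def Idx_def)
    moreover have "of_bool (\<upsilon> (l, i)) * ?A l \<upsilon> \<le> (if ?b l \<in> ?J \<upsilon> then 0 else cond_hellinger ?S Idx (?J \<upsilon> \<union> ?b ` {..<l})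
        (\<lambda>\<eta>. ?f (\<eta>(?b l := False))) (\<lambda>\<eta>. ?f (\<eta>(?b l := True))))" for l
    proof (cases "\<upsilon> (l, i)")
      case True
      let ?J' = "?J \<upsilon> \<union> ?b ` {..<l}"
      have "?A l \<upsilon> \<le> cond_hellinger (rng i l) Idx ?J' (\<lambda>\<eta>. T i l (?m \<upsilon> (\<eta>((l, 0) := False)))) (\<lambda>\<eta>. T i l (?m \<upsilon> (\<eta>((l, 0) := True))))"
        by (intro cond_hellinger_mono) (auto simp: past_def)
      also have "\<dots> \<le> cond_hellinger ?S Idx ?J' (\<lambda>\<eta>. ?f (\<eta>(?b l := False))) (\<lambda>\<eta>. ?f (\<eta>(?b l := True)))"
        unfolding rng_def T_def
      proof (rule cond_hellinger_pair_le)
        fix \<omega> assume "\<omega> \<in> Q"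
        have "tail i l (?m \<upsilon> ((override_on \<eta> \<omega> ?J')((l, 0) := b))) = tail i l (?m \<upsilon> \<omega>)" for \<eta> b
          using i by (auto simp: tail_def mat_def override_on_def)
        then show "\<exists>v\<in>{xs. length xs = n - Suc l}. \<forall>\<eta>\<in>Q.
            tail i l (?m \<upsilon> ((override_on \<eta> \<omega> ?J')((l, 0) := False))) = v \<and>
            tail i l (?m \<upsilon> ((override_on \<eta> \<omega> ?J')((l, 0) := True))) = v"
          by (intro bexI[of _ "tail i l (?m \<upsilon> \<omega>)"]) (auto simp: tail_def)
      qed (use finite_Tr[OF i] finite_tails in auto)
      finally show ?thesis using True by simp
    qed simp
    then have "(\<Sum>l<n. of_bool (\<upsilon> (l, i)) * ?A l \<upsilon>) \<le> (\<Sum>s<n. if ?b s \<in> ?J \<upsilon> then 0 else cond_hellinger ?S Idx (?J \<upsilon> \<union> ?b ` {..<s})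
        (\<lambda>\<eta>. ?f (\<eta>(?b s := False))) (\<lambda>\<eta>. ?f (\<eta>(?b s := True))))"
      by (intro sum_mono)
    ultimately show ?thesis by linarith
  qed
  have "(\<Sum>l<n. avg Q (\<lambda>\<upsilon>. of_bool (\<upsilon> (l, i)) * ?A l \<upsilon>)) = avg Q (\<lambda>\<upsilon>. \<Sum>l<n. of_bool (\<upsilon> (l, i)) * ?A l \<upsilon>)"
    by (rule avg_sum[symmetric])
  also have "\<dots> \<le> avg Q (\<lambda>\<upsilon>. 4 * ln 2 * ?c \<upsilon>)"
    by (intro avg_mono main)
  also have "\<dots> = 4 * ln 2 * avg Q (\<lambda>\<omega>. real (cost i (mat \<zeta> \<omega>)))"
    unfolding avg_cmult using avg_override[OF finite_Idx, of "\<lambda>\<omega>. real (cost i (mat \<zeta> \<omega>))" ?U] by simp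
  finally have total: "(\<Sum>l<n. avg Q (\<lambda>\<upsilon>. of_bool (\<upsilon> (l, i)) * ?A l \<upsilon>)) \<le> 4 * ln 2 * avg Q (\<lambda>\<omega>. real (cost i (mat \<zeta> \<omega>)))" .
  have "(if \<zeta> l = i then 0 else
      avg Q (\<lambda>\<omega>. hellinger (rng i l) (P \<zeta> l \<omega> i (noisy l (\<zeta> l)) True) (P \<zeta> l \<omega> i (all_but (\<zeta> l)) True)))
      \<le> 2 * avg Q (\<lambda>\<upsilon>. of_bool (\<upsilon> (l, i)) * ?A l \<upsilon>)" if l: "l < n" for l
  proof (cases "\<zeta> l = i")
    case True
    then show ?thesis by (auto intro!: avg_nonneg)
  next
    case False
    let ?F = "\<lambda>b \<theta>. T i l (mat \<zeta> (\<theta>((l, 0) := b, (l, i) := True)))"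
    have Idx: "(l, i) \<in> Idx" using l i by (simp add: Idx_def)
    have cols: "mat \<zeta> (\<theta>((l, 0) := False, (l, i) := True)) = (mat \<zeta> \<theta>)(l := (noisy l (\<zeta> l) \<theta>)(i := True))"
        "mat \<zeta> (\<theta>((l, 0) := True, (l, i) := True)) = (mat \<zeta> \<theta>)(l := (all_but (\<zeta> l) \<theta>)(i := True))" for \<theta>
      using l i False by (auto simp: fun_eq_iff mat_def noisy_def all_but_def)
    have "avg Q (\<lambda>\<omega>. hellinger (rng i l) (P \<zeta> l \<omega> i (noisy l (\<zeta> l)) True) (P \<zeta> l \<omega> i (all_but (\<zeta> l)) True))
       = cond_hellinger (rng i l) Idx (past l) (?F False) (?F True)"
      unfolding cols by (rule cond_hellinger_eq_avg_hellinger[symmetric]) (rule noisy_past all_but_past)+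
    also have "\<dots> \<le> avg Q (\<lambda>\<upsilon>. cond_hellinger (rng i l) Idx (past l) (\<lambda>\<eta>. ?F False (override_on \<eta> \<upsilon> ?U)) (\<lambda>\<eta>. ?F True (override_on \<eta> \<upsilon> ?U)))"
      using i by (intro cond_hellinger_le_avg_override) (auto simp: past_def)
    also have "\<dots> = avg Q (\<lambda>\<upsilon>. ?A l (\<upsilon>((l, i) := True)))"
    proof -
      have "(override_on \<eta> \<upsilon> ?U)((l, 0) := b, (l, i) := True) = override_on (\<eta>((l, 0) := b)) (\<upsilon>((l, i) := True)) ?U"
        for \<eta> \<upsilon> :: "nat \<times> nat \<Rightarrow> bool" and b
        using i by (auto simp: fun_eq_iff override_on_def)
      then show ?thesis by simp
    qed
    \<comment> \<open>Half of all \<open>\<upsilon>\<close> have a 1 at \<open>(l, i)\<close>, the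
      value that both columns prescribe.\<close>
    also have "\<dots> = 2 * avg Q (\<lambda>\<upsilon>. of_bool (\<upsilon> (l, i)) * ?A l \<upsilon>)"
      by (subst avg_bit[OF finite_Idx Idx, of "\<lambda>\<upsilon>. of_bool (\<upsilon> (l, i)) * ?A l \<upsilon>"]) (simp add: avg_def)
    finally show ?thesis using False by simp
  qed
  then have "(\<Sum>l<n. if \<zeta> l = i then 0 else
      avg Q (\<lambda>\<omega>. hellinger (rng i l) (P \<zeta> l \<omega> i (noisy l (\<zeta> l)) True) (P \<zeta> l \<omega> i (all_but (\<zeta> l)) True)))
     \<le> 2 * (\<Sum>l<n. avg Q (\<lambda>\<upsilon>. of_bool (\<upsilon> (l, i)) * ?A l \<upsilon>))"
    unfolding sum_distrib_left by (intro sum_mono) auto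
  with total show ?thesis by linarith
qed

end

section \<open>From information to advantage\<close>

text \<open>Exchanging \<open>\<zeta> l\<close> with an independent draw \<open>z\<close> is an
  involution.\<close>

lemma avg_coordinate:
  assumes l: "l < (n::nat)" and fin: "finite A" "A \<noteq> {}"
  shows "avg (\<Pi>\<^sub>E j\<in>{..<n}. A) (\<lambda>\<zeta>. avg A (\<lambda>z. g (\<zeta>(l := z)))) = avg (\<Pi>\<^sub>E j\<in>{..<n}. A) g"
proof -
  let ?Z = "\<Pi>\<^sub>E j\<in>{..<n}. A"
  have mem: "\<zeta>(l := z) \<in> ?Z" if "\<zeta> \<in> ?Z" "z \<in> A" for \<zeta> z
    using that l by (auto simp: PiE_iff extensional_def)
  have "(\<Sum>\<zeta>\<in>?Z. \<Sum>z\<in>A. g (\<zeta>(l := z))) = (\<Sum>(\<zeta>, z)\<in>?Z \<times> A. g (\<zeta>(l := z)))"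
    by (simp add: sum.cartesian_product)
  also have "\<dots> = (\<Sum>(\<zeta>, z)\<in>?Z \<times> A. g \<zeta>)"
    by (rule sum.reindex_bij_witness[of _ "\<lambda>(\<zeta>, z). (\<zeta>(l := z), \<zeta> l)" "\<lambda>(\<zeta>, z). (\<zeta>(l := z), \<zeta> l)"])
       (use mem l in \<open>auto simp: PiE_iff\<close>)
  also have "\<dots> = real (card A) * sum g ?Z"
    by (simp add: sum.cartesian_product[symmetric] sum_distrib_left)
  finally show ?thesis
    using fin by (simp add: avg_def sum_divide_distrib[symmetric])
qed

context cut_transcripts
begin

lemma noisy_own: "noisy l z (override_on \<eta> \<eta>' (own l i)) = noisy l z \<eta>"
  unfolding noisy_def own_def by (auto simp: override_on_def fun_eq_iff)

lemma all_but_own: "all_but z (override_on \<eta> \<eta>' (own l i)) = all_but z \<eta>"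
  unfolding all_but_def ..

lemma all_one_own: "all_one (override_on \<eta> \<eta>' (own l i)) = all_one \<eta>"
  unfolding all_one_def ..

lemma all_one_past: "all_one (override_on \<eta> \<omega> (past l)) = all_one \<eta>"
  unfolding all_one_def ..

definition row_dist :: "(nat \<Rightarrow> nat) \<Rightarrow> nat \<Rightarrow> (nat \<times> nat \<Rightarrow> bool) \<Rightarrow> nat \<Rightarrow> nat \<Rightarrow> real" where
  "row_dist \<zeta> l \<omega> i z = hellinger (rng i l) (P \<zeta> l \<omega> i (noisy l z) False) (P \<zeta> l \<omega> i (noisy l z) True)"

definition mode_dist :: "(nat \<Rightarrow> nat) \<Rightarrow> nat \<Rightarrow> (nat \<times> nat \<Rightarrow> bool) \<Rightarrow> nat \<Rightarrow> nat \<Rightarrow> real" where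
  "mode_dist \<zeta> l \<omega> i z = hellinger (rng i l) (P \<zeta> l \<omega> i (noisy l z) True) (P \<zeta> l \<omega> i (all_but z) True)"

lemma dist_nonneg: "0 \<le> row_dist \<zeta> l \<omega> i z" "0 \<le> mode_dist \<zeta> l \<omega> i z"
  unfolding row_dist_def mode_dist_def by simp_all

text \<open>
  Cut and paste turns closeness of \<open>(0, noisy)\<close>, \<open>(1, noisy)\<close> and \<open>(1, all but z)\<close> into closeness of
  \<open>(0, all but z)\<close> and \<open>(1, all but z)\<close>.
\<close>
lemma hellinger_all_but:
  assumes "i \<in> {1..k}" "l < n"
  shows "hellinger (rng i l) (P \<zeta> l \<omega> i (all_but z) False) (P \<zeta> l \<omega> i (all_but z) True) \<le> 4 * row_dist \<zeta> l \<omega> i z + 6 * mode_dist \<zeta> l \<omega> i z"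
proof -
  let ?h = "hellinger (rng i l)" and ?N = "P \<zeta> l \<omega> i (noisy l z)" and ?B = "P \<zeta> l \<omega> i (all_but z)"
  have "?h (?N False) (?B True) = ?h (?N True) (?B False)"
    using assms by (intro P_cut_paste noisy_own all_but_own)
  moreover have "?h (?N False) (?B True) \<le> 2 * ?h (?N False) (?N True) + 2 * ?h (?N True) (?B True)"
    by (rule hellinger_triangle)
  moreover have "?h (?B False) (?B True) \<le> 2 * ?h (?B False) (?N True) + 2 * ?h (?N True) (?B True)"
    by (rule hellinger_triangle)
  ultimately show ?thesis
    unfolding row_dist_def mode_dist_def using hellinger_commute[of "rng i l" "?B False" "?N True"] by linarith
qed

text \<open>Let u be the effect of the bit of \<open>i\<close> while \<open>z\<close> holds 0, and v
  that of the bit of \<open>z\<close> while \<open>i\<close> holds 0. Cut and paste at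
  \<open>i\<close> trades the all-one column for a comparison among the other three columns, and the
  triangle inequalities add up to 4u + 6v. The coefficients follow by inserting
  \<open>hellinger_all_but\<close> for u and for v.\<close>

lemma out_advantage_le:
  assumes i: "i \<in> {1..k}" and z: "z \<in> {1..k}" and iz: "i \<noteq> z" and l: "l < n"
  shows "(law Q (\<lambda>\<eta>. out z (cfg \<zeta> l \<omega> \<eta> ((all_one \<eta>)(i := True)))) True
        - law Q (\<lambda>\<eta>. out z (cfg \<zeta> l \<omega> \<eta> ((all_one \<eta>)(i := False)))) True)\<^sup>2
     \<le> 16 * row_dist \<zeta> l \<omega> i z + 24 * mode_dist \<zeta> l \<omega> i z + 24 * row_dist \<zeta> l \<omega> z i + 36 * mode_dist \<zeta> l \<omega> z i"
proof -
  let ?h = "hellinger (rng i l)" and ?B = "P \<zeta> l \<omega> i (all_but z)" and ?F = "P \<zeta> l \<omega> i all_one"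
  have T_rest: "fixed_by_rest z (T i l)"
    unfolding fixed_by_rest_def
  proof (intro allI impI)
    fix X X' :: "nat \<Rightarrow> nat \<Rightarrow> bool"
    assume "Tr z X = Tr z X'" and rest: "\<forall>l a. a \<noteq> z \<longrightarrow> X l a = X' l a"
    then have "Tr i X = Tr i X'" using Tr_rest[OF z i iz[symmetric], of X X'] by simp
    then show "T i l X = T i l X'" unfolding T_def tail_def using rest iz by simp
  qed
  \<comment> \<open>Only the input of \<open>z\<close> changes here. The distance is therefore
    bounded at the cut of \<open>z\<close>, whose transcript together with the other rows determines
    that of \<open>i\<close>.\<close>
  have "?h (?B False) (?F False) \<le> hellinger (rng z l) (P \<zeta> l \<omega> z (all_but i) False) (P \<zeta> l \<omega> z (all_but i) True)"
  proof -
    have cols: "(all_but z \<eta>)(i := False) = (all_but i \<eta>)(z := False)" "(all_one \<eta>)(i := False) = (all_but i \<eta>)(z := True)" for \<eta>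
      using iz i z by (auto simp: fun_eq_iff all_but_def all_one_def)
    have "?B False = law Q (\<lambda>\<eta>. T i l (cfg \<zeta> l \<omega> \<eta> ((all_but i \<eta>)(z := False))))"
        "?F False = law Q (\<lambda>\<eta>. T i l (cfg \<zeta> l \<omega> \<eta> ((all_but i \<eta>)(z := True))))"
      unfolding P_def cols by (rule refl)+
    then show ?thesis
      using hellinger_rest_le[where y = "all_but i" and b = False and b' = True, OF z l all_but_own T_rest finite_rng[OF i, of l]]
      by (simp add: image_subset_iff)
  qed
  with hellinger_all_but[OF z l, of \<zeta> \<omega> i]
  have s2: "?h (?B False) (?F False) \<le> 4 * row_dist \<zeta> l \<omega> z i + 6 * mode_dist \<zeta> l \<omega> z i" by linarith
  have s1: "?h (?B False) (?B True) \<le> 4 * row_dist \<zeta> l \<omega> i z + 6 * mode_dist \<zeta> l \<omega> i z"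
    by (rule hellinger_all_but[OF i l])
  have "?h (?B True) (?F False) \<le> 2 * ?h (?B True) (?B False) + 2 * ?h (?B False) (?F False)"
    by (rule hellinger_triangle)
  moreover have "?h (?B False) (?F True) = ?h (?B True) (?F False)"
    using i l by (intro P_cut_paste all_but_own all_one_own)
  moreover have "?h (?F False) (?F True) \<le> 2 * ?h (?F False) (?B False) + 2 * ?h (?B False) (?F True)"
    by (rule hellinger_triangle)
  ultimately have "?h (?F False) (?F True)
      \<le> 16 * row_dist \<zeta> l \<omega> i z + 24 * mode_dist \<zeta> l \<omega> i z + 24 * row_dist \<zeta> l \<omega> z i + 36 * mode_dist \<zeta> l \<omega> z i"
    using s1 s2 hellinger_commute[of "rng i l" "?B True" "?B False"] hellinger_commute[of "rng i l" "?F False" "?B False"]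
    by linarith
  moreover have "hellinger UNIV (law Q (\<lambda>\<eta>. out z (cfg \<zeta> l \<omega> \<eta> ((all_one \<eta>)(i := False)))))
      (law Q (\<lambda>\<eta>. out z (cfg \<zeta> l \<omega> \<eta> ((all_one \<eta>)(i := True))))) \<le> ?h (?F False) (?F True)"
  proof -
    have "fixed_by_rest i (out z)"
      unfolding fixed_by_rest_def using Tr_rest[OF i z iz] by blast
    from hellinger_rest_le[OF i l all_one_own this, of UNIV] show ?thesis by simp
  qed
  ultimately show ?thesis
    using power2_law_diff_le_hellinger[of Q "\<lambda>\<eta>. out z (cfg \<zeta> l \<omega> \<eta> ((all_one \<eta>)(i := False)))"
        "\<lambda>\<eta>. out z (cfg \<zeta> l \<omega> \<eta> ((all_one \<eta>)(i := True)))"]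
    by (simp add: power2_commute)
qed

definition adv :: "(nat \<Rightarrow> nat) \<Rightarrow> nat \<Rightarrow> nat \<Rightarrow> nat \<Rightarrow> real" where
  "adv \<zeta> l i z = avg Q (\<lambda>\<omega>. of_bool (out z ((mat \<zeta> \<omega>)(l := (all_one \<omega>)(i := True))))
      - of_bool (out z ((mat \<zeta> \<omega>)(l := (all_one \<omega>)(i := False)))))"

text \<open>The tangent of the square at \<open>d\<close> stands in for Jensen's inequality: it is
  linear in the advantage and survives all averages. Swapping \<open>i\<close> and \<open>z\<close>
  merges the coefficients into 16 + 24 and 24 + 36, and 60 bounds both.\<close>

lemma sum_adv_le:
  assumes l: "l < n"
  shows "(\<Sum>z\<in>{1..k}. \<Sum>i\<in>{1..k}. if i = z then 0 else 2 * d * adv \<zeta> l i z - d\<^sup>2)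
    \<le> 60 * (\<Sum>z\<in>{1..k}. \<Sum>i\<in>{1..k}. if i = z then 0 else avg Q (\<lambda>\<omega>. row_dist \<zeta> l \<omega> i z + mode_dist \<zeta> l \<omega> i z))"
proof -
  let ?a = "\<lambda>i z. avg Q (\<lambda>\<omega>. row_dist \<zeta> l \<omega> i z)" and ?b = "\<lambda>i z. avg Q (\<lambda>\<omega>. mode_dist \<zeta> l \<omega> i z)"
  let ?\<delta> = "\<lambda>i z \<omega>. law Q (\<lambda>\<eta>. out z (cfg \<zeta> l \<omega> \<eta> ((all_one \<eta>)(i := True)))) True
        - law Q (\<lambda>\<eta>. out z (cfg \<zeta> l \<omega> \<eta> ((all_one \<eta>)(i := False)))) True"
  have avg_law: "avg Q (\<lambda>\<omega>. law Q (\<lambda>\<eta>. out z (cfg \<zeta> l \<omega> \<eta> ((all_one \<eta>)(i := b)))) True)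
      = avg Q (\<lambda>\<omega>. of_bool (out z ((mat \<zeta> \<omega>)(l := (all_one \<omega>)(i := b)))))" for i z b
    using avg_override[OF finite_Idx, of "\<lambda>\<omega>. of_bool (out z ((mat \<zeta> \<omega>)(l := (all_one \<omega>)(i := b))))" "past l"]
    unfolding law_def cfg_def all_one_past by simp
  have adv_eq: "adv \<zeta> l i z = avg Q (?\<delta> i z)" for i z
    unfolding adv_def avg_diff avg_law ..
  have "2 * d * adv \<zeta> l i z - d\<^sup>2 \<le> (16 * ?a i z + 24 * ?b i z) + (24 * ?a z i + 36 * ?b z i)"
    if "i \<in> {1..k}" "z \<in> {1..k}" "i \<noteq> z" for i z
  proof -
    have "2 * d * adv \<zeta> l i z - d\<^sup>2 = avg Q (\<lambda>\<omega>. 2 * d * ?\<delta> i z \<omega> - d\<^sup>2)"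
      unfolding adv_eq by (subst avg_diff) (simp add: avg_cmult avg_const)
    also have "\<dots> \<le> avg Q (\<lambda>\<omega>. 16 * row_dist \<zeta> l \<omega> i z + 24 * mode_dist \<zeta> l \<omega> i z
        + 24 * row_dist \<zeta> l \<omega> z i + 36 * mode_dist \<zeta> l \<omega> z i)"
    proof (rule avg_mono)
      fix \<omega>
      have "2 * d * x - d\<^sup>2 \<le> x\<^sup>2" for x :: real
        using zero_le_power2[of "x - d"] by (simp add: power2_eq_square algebra_simps)
      then show "2 * d * ?\<delta> i z \<omega> - d\<^sup>2 \<le> 16 * row_dist \<zeta> l \<omega> i z + 24 * mode_dist \<zeta> l \<omega> i z
        + 24 * row_dist \<zeta> l \<omega> z i + 36 * mode_dist \<zeta> l \<omega> z i"
        using out_advantage_le[OF that l, of \<zeta> \<omega>] by (rule order_trans)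
    qed
    also have "\<dots> = (16 * ?a i z + 24 * ?b i z) + (24 * ?a z i + 36 * ?b z i)"
      by (simp add: avg_add avg_cmult)
    finally show ?thesis .
  qed
  then have "(\<Sum>z\<in>{1..k}. \<Sum>i\<in>{1..k}. if i = z then 0 else 2 * d * adv \<zeta> l i z - d\<^sup>2)
      \<le> (\<Sum>z\<in>{1..k}. \<Sum>i\<in>{1..k}. (if i = z then 0 else 16 * ?a i z + 24 * ?b i z)
           + (if i = z then 0 else 24 * ?a z i + 36 * ?b z i))"
    by (intro sum_mono) (simp split: if_split)
  also have "\<dots> = (\<Sum>z\<in>{1..k}. \<Sum>i\<in>{1..k}. if i = z then 0 else 16 * ?a i z + 24 * ?b i z)
        + (\<Sum>z\<in>{1..k}. \<Sum>i\<in>{1..k}. if i = z then 0 else 24 * ?a z i + 36 * ?b z i)"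
    by (simp only: sum.distrib)
  also have "(\<Sum>z\<in>{1..k}. \<Sum>i\<in>{1..k}. if i = z then 0 else 24 * ?a z i + 36 * ?b z i)
      = (\<Sum>z\<in>{1..k}. \<Sum>i\<in>{1..k}. if i = z then 0 else 24 * ?a i z + 36 * ?b i z)"
    by (subst sum.swap) (intro sum.cong refl if_cong eq_commute)
  also have "(\<Sum>z\<in>{1..k}. \<Sum>i\<in>{1..k}. if i = z then 0 else 16 * ?a i z + 24 * ?b i z) + \<dots>
      = (\<Sum>z\<in>{1..k}. \<Sum>i\<in>{1..k}. if i = z then 0 else 40 * ?a i z + 60 * ?b i z)"
    unfolding sum.distrib[symmetric] by (intro sum.cong) auto
  also have "\<dots> \<le> (\<Sum>z\<in>{1..k}. \<Sum>i\<in>{1..k}. 60 * (if i = z then 0 else ?a i z + ?b i z))"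
  proof (intro sum_mono)
    fix z i
    have "0 \<le> ?a i z" by (intro avg_nonneg dist_nonneg)
    then show "(if i = z then 0 else 40 * ?a i z + 60 * ?b i z) \<le> 60 * (if i = z then 0 else ?a i z + ?b i z)"
      by simp
  qed
  finally show ?thesis by (simp only: sum_distrib_left avg_add)
qed

lemma update_dist: "row_dist (\<zeta>(l := z)) l \<omega> i z' = row_dist \<zeta> l \<omega> i z'"
    "mode_dist (\<zeta>(l := z)) l \<omega> i z' = mode_dist \<zeta> l \<omega> i z'"
  unfolding row_dist_def mode_dist_def P_update by (rule refl)+

text \<open>Information is charged only to pairs with \<open>z = \<zeta> l\<close>; averaging over
  \<open>\<zeta> l\<close> reaches all pairs at the cost of a factor \<open>k\<close>, which cancels
  at the end. The constant is 60 times 16: 60 from \<open>sum_adv_le\<close>, and 8 from each of the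
  two information bounds, with \<open>ln 2\<close> rounded up to 1.\<close>

lemma cost_lower_bound:
  fixes D d :: real
  assumes k: "k \<ge> 1" and d: "0 \<le> d"
    and D: "\<And>X. (\<Sum>i\<in>{1..k}. real (cost i X)) \<le> D"
    and adv: "(\<Sum>l<n. avg (\<Pi>\<^sub>E j\<in>{..<n}. {1..k}) (\<lambda>\<zeta>. \<Sum>z\<in>{1..k}. \<Sum>i\<in>{1..k}. if i = z then 0 else adv \<zeta> l i z))
       \<ge> d * (real n * (real k * (real k - 1)))"
  shows "d\<^sup>2 * (real n * (real k - 1)) \<le> 960 * D"
proof -
  let ?Z = "\<Pi>\<^sub>E j\<in>{..<n}. {1..k}"
  let ?K = "{1..k}"
  define G where "G l \<zeta> z = (\<Sum>i\<in>?K. if i = z then 0 else avg Q (\<lambda>\<omega>. row_dist \<zeta> l \<omega> i z + mode_dist \<zeta> l \<omega> i z))" for l \<zeta> z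
  have Z: "finite ?Z" "?Z \<noteq> {}"
    using k by (auto intro!: finite_PiE simp: PiE_eq_empty_iff)
  have G_le: "(\<Sum>l<n. G l \<zeta> (\<zeta> l)) \<le> 16 * D" for \<zeta>
  proof -
    have "(\<Sum>l<n. G l \<zeta> (\<zeta> l)) = (\<Sum>i\<in>?K. \<Sum>l<n. if \<zeta> l = i then 0 else
        avg Q (\<lambda>\<omega>. row_dist \<zeta> l \<omega> i (\<zeta> l) + mode_dist \<zeta> l \<omega> i (\<zeta> l)))"
      unfolding G_def by (subst sum.swap) (intro sum.cong refl if_cong eq_commute)
    also have "\<dots> \<le> (\<Sum>i\<in>?K. 16 * ln 2 * avg Q (\<lambda>\<omega>. real (cost i (mat \<zeta> \<omega>))))"
    proof (rule sum_mono)
      fix i assume i: "i \<in> ?K"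
      have "(\<Sum>l<n. if \<zeta> l = i then 0 else avg Q (\<lambda>\<omega>. row_dist \<zeta> l \<omega> i (\<zeta> l) + mode_dist \<zeta> l \<omega> i (\<zeta> l)))
         = (\<Sum>l<n. if \<zeta> l = i then 0 else avg Q (\<lambda>\<omega>. row_dist \<zeta> l \<omega> i (\<zeta> l)))
         + (\<Sum>l<n. if \<zeta> l = i then 0 else avg Q (\<lambda>\<omega>. mode_dist \<zeta> l \<omega> i (\<zeta> l)))"
        unfolding sum.distrib[symmetric] by (intro sum.cong) (auto simp: avg_add)
      with row_information[OF i, of \<zeta>] mode_information[OF i, of \<zeta>]
      show "(\<Sum>l<n. if \<zeta> l = i then 0 else avg Q (\<lambda>\<omega>. row_dist \<zeta> l \<omega> i (\<zeta> l) + mode_dist \<zeta> l \<omega> i (\<zeta> l)))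
         \<le> 16 * ln 2 * avg Q (\<lambda>\<omega>. real (cost i (mat \<zeta> \<omega>)))"
        unfolding row_dist_def mode_dist_def by linarith
    qed
    also have "\<dots> = 16 * ln 2 * avg Q (\<lambda>\<omega>. \<Sum>i\<in>?K. real (cost i (mat \<zeta> \<omega>)))"
      by (simp add: avg_sum sum_distrib_left)
    also have "\<dots> \<le> 16 * ln 2 * avg Q (\<lambda>\<omega>. D)"
      by (intro mult_left_mono avg_mono D) auto
    also have "\<dots> \<le> 16 * 1 * D"
    proof -
      have "0 \<le> D" using D[of undefined] sum_nonneg[of ?K "\<lambda>i. real (cost i undefined)"] by linarith
      then show ?thesis using ln_2_less_1 by (simp add: avg_const mult_right_mono)
    qed
    finally show ?thesis by simp
  qed
  have "(\<Sum>l<n. avg ?Z (\<lambda>\<zeta>. G l \<zeta> (\<zeta> l))) = avg ?Z (\<lambda>\<zeta>. \<Sum>l<n. G l \<zeta> (\<zeta> l))"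
    by (rule avg_sum[symmetric])
  also have "\<dots> \<le> avg ?Z (\<lambda>\<zeta>. 16 * D)" by (intro avg_mono G_le)
  also have "\<dots> = 16 * D" using Z by (simp add: avg_const)
  finally have up: "(\<Sum>l<n. avg ?Z (\<lambda>\<zeta>. G l \<zeta> (\<zeta> l))) \<le> 16 * D" .
  let ?A = "\<lambda>l. avg ?Z (\<lambda>\<zeta>. \<Sum>z\<in>?K. \<Sum>i\<in>?K. if i = z then 0 else adv \<zeta> l i z)"
  have low: "2 * d * ?A l - d\<^sup>2 * (real k * (real k - 1)) \<le> 60 * real k * avg ?Z (\<lambda>\<zeta>. G l \<zeta> (\<zeta> l))" if l: "l < n" for l
  proof -
    have "avg ?Z (\<lambda>\<zeta>. G l \<zeta> (\<zeta> l)) = avg ?Z (\<lambda>\<zeta>. avg ?K (\<lambda>z. G l (\<zeta>(l := z)) z))"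
      using avg_coordinate[OF l, of ?K "\<lambda>\<zeta>. G l \<zeta> (\<zeta> l)"] k by simp
    also have "\<dots> = avg ?Z (\<lambda>\<zeta>. (\<Sum>z\<in>?K. G l \<zeta> z)) / real k"
      unfolding G_def update_dist by (simp add: avg_def sum_divide_distrib mult.commute)
    finally have "60 * real k * avg ?Z (\<lambda>\<zeta>. G l \<zeta> (\<zeta> l)) = avg ?Z (\<lambda>\<zeta>. 60 * (\<Sum>z\<in>?K. G l \<zeta> z))"
      using k by (simp add: avg_cmult)
    also have "\<dots> \<ge> avg ?Z (\<lambda>\<zeta>. \<Sum>z\<in>?K. \<Sum>i\<in>?K. if i = z then 0 else 2 * d * adv \<zeta> l i z - d\<^sup>2)"
      unfolding G_def by (intro avg_mono sum_adv_le l)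
    finally have "avg ?Z (\<lambda>\<zeta>. \<Sum>z\<in>?K. \<Sum>i\<in>?K. if i = z then 0 else 2 * d * adv \<zeta> l i z - d\<^sup>2)
       \<le> 60 * real k * avg ?Z (\<lambda>\<zeta>. G l \<zeta> (\<zeta> l))" .
    moreover have "(\<Sum>z\<in>?K. \<Sum>i\<in>?K. if i = z then 0 else 2 * d * adv \<zeta> l i z - d\<^sup>2)
       = 2 * d * (\<Sum>z\<in>?K. \<Sum>i\<in>?K. if i = z then 0 else adv \<zeta> l i z) - d\<^sup>2 * (real k * (real k - 1))" for \<zeta>
    proof -
      have lin: "(\<Sum>z\<in>?K. \<Sum>i\<in>?K. c * f z i - e * g z i) = c * (\<Sum>z\<in>?K. \<Sum>i\<in>?K. f z i) - e * (\<Sum>z\<in>?K. \<Sum>i\<in>?K. g z i)"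
        for c e :: real and f g
        by (simp add: sum_subtractf sum_distrib_left)
      have "(\<Sum>z\<in>?K. \<Sum>i\<in>?K. if i = z then 0 else 2 * d * adv \<zeta> l i z - d\<^sup>2)
         = (\<Sum>z\<in>?K. \<Sum>i\<in>?K. 2 * d * (if i = z then 0 else adv \<zeta> l i z) - d\<^sup>2 * (1 - of_bool (i = z)))"
        by (intro sum.cong) auto
      also have "\<dots> = 2 * d * (\<Sum>z\<in>?K. \<Sum>i\<in>?K. if i = z then 0 else adv \<zeta> l i z)
          - d\<^sup>2 * (\<Sum>z\<in>?K. \<Sum>i\<in>?K. 1 - of_bool (i = z))"
        by (rule lin)
      also have "(\<Sum>z\<in>?K. \<Sum>i\<in>?K. 1 - of_bool (i = z)) = real k * (real k - 1)"
        by (simp add: sum_subtractf of_bool_def)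
      finally show ?thesis .
    qed
    ultimately show ?thesis
      using Z by (simp add: avg_diff avg_cmult avg_const)
  qed
  have "2 * d * (\<Sum>l<n. ?A l) - d\<^sup>2 * (real n * (real k * (real k - 1)))
      = (\<Sum>l<n. 2 * d * ?A l - d\<^sup>2 * (real k * (real k - 1)))"
    by (simp add: sum_subtractf sum_distrib_left)
  also have "\<dots> \<le> (\<Sum>l<n. 60 * real k * avg ?Z (\<lambda>\<zeta>. G l \<zeta> (\<zeta> l)))"
    by (intro sum_mono low) auto
  also have "\<dots> \<le> 60 * real k * (16 * D)"
    unfolding sum_distrib_left[symmetric] by (intro mult_left_mono up) auto
  finally have "2 * d * (\<Sum>l<n. ?A l) - d\<^sup>2 * (real n * (real k * (real k - 1))) \<le> 60 * real k * (16 * D)" .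
  moreover have "2 * d * (d * (real n * (real k * (real k - 1)))) \<le> 2 * d * (\<Sum>l<n. ?A l)"
    using adv d by (intro mult_left_mono) auto
  ultimately have "d\<^sup>2 * (real n * (real k * (real k - 1))) \<le> 60 * real k * (16 * D)"
    by (simp add: power2_eq_square algebra_simps)
  then have "real k * (d\<^sup>2 * (real n * (real k - 1))) \<le> real k * (960 * D)"
    by (simp add: algebra_simps)
  then show ?thesis using k by (simp add: mult_le_cancel_left)
qed

end

section \<open>Runs of a protocol\<close>

definition comparable :: "'a list \<Rightarrow> 'a list \<Rightarrow> bool" where
  "comparable u v \<longleftrightarrow> prefix u v \<or> prefix v u"

lemma comparable_refl [simp]: "comparable u u"
  unfolding comparable_def by simp

lemma comparable_commute: "comparable u v \<longleftrightarrow> comparable v u"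
  unfolding comparable_def by blast

lemma comparable_prefix: "comparable u v \<Longrightarrow> prefix u' u \<Longrightarrow> comparable u' v"
  unfolding comparable_def by (meson prefix_order.trans prefix_same_cases)

lemma comparable_append: "comparable (p @ u) (p @ v) \<longleftrightarrow> comparable u v"
  unfolding comparable_def by simp

lemma comparable_same_length: "comparable u v \<Longrightarrow> length u = length v \<Longrightarrow> u = v"
  unfolding comparable_def by (auto simp: prefix_def)

lemma prefix_concat: "prefix xs ys \<Longrightarrow> prefix (concat xs) (concat ys)"
  by (auto simp: prefix_def)

section \<open>Local states and halting\<close>

locale halting_run =
  fixes k :: nat and X :: "nat \<Rightarrow> 'x set" and \<pi> :: "'x protocol" and r :: randomness and \<sigma> :: "nat \<Rightarrow> event"
  assumes protocol: "is_protocol k X \<pi>"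
    and r: "r \<in> space (rand_space k)"
    and \<sigma>: "\<sigma> \<in> schedules k"
    and halts: "\<And>x i. x \<in> inputs k X \<Longrightarrow> i \<in> {1..k} \<Longrightarrow> \<exists>w. outputs \<pi> x r \<sigma> i w"
begin

abbreviation K :: "nat set" where "K \<equiv> {1..k}"

abbreviation run :: "(nat \<Rightarrow> 'x) \<Rightarrow> nat \<Rightarrow> config" where "run x t \<equiv> exec \<pi> x r \<sigma> t"

text \<open>All that player \<open>b\<close> has observed and done. Unread messages and arrival
  counters are left out, since they reflect the progress of the other players and of the
  schedule.\<close>

definition local_state :: "config \<Rightarrow> nat \<Rightarrow> nat \<times> phase \<times> (nat \<Rightarrow> nat) \<times> (nat \<Rightarrow> bits list) \<times> (nat \<Rightarrow> bits list)" where
  "local_state c b = (rnd c b, phase c b, (\<lambda>a. nread c a b), (\<lambda>a. take (nread c a b) (sent c a b)), sent c b)"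

lemma local_state_eqD:
  assumes "local_state c b = local_state c' b"
  shows "rnd c b = rnd c' b" "phase c b = phase c' b" "nread c a b = nread c' a b"
    "take (nread c a b) (sent c a b) = take (nread c' a b) (sent c' a b)" "sent c b = sent c' b"
  using assms unfolding local_state_def prod.inject fun_eq_iff by blast+

text \<open>The bound \<open>1 \<le> rnd c b\<close> is carried along because
  \<open>is_protocol\<close> constrains \<open>recv\<close> only from round 1 on.\<close>

definition wf_config :: "config \<Rightarrow> bool" where
  "wf_config c \<longleftrightarrow> (\<forall>a b. nread c a b \<le> arrived c a b \<and> arrived c a b \<le> length (sent c a b)) \<and>
     (\<forall>b\<in>K. 1 \<le> rnd c b \<and> nread c b b = 0 \<and> (\<forall>S. phase c b = Waiting S \<longrightarrow> S \<subseteq> K - {b}))"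

lemma Waiting_subset: "wf_config c \<Longrightarrow> b \<in> K \<Longrightarrow> phase c b = Waiting S \<Longrightarrow> S \<subseteq> K - {b}"
  unfolding wf_config_def by blast

lemma recv_subset: "i \<in> K \<Longrightarrow> 1 \<le> l \<Longrightarrow> recv \<pi> i l v \<subseteq> K - {i}"
  using protocol unfolding is_protocol_def by blast

lemma event_in: "\<sigma> t \<in> events k"
  using \<sigma> unfolding schedules_def by auto

lemma wf_step:
  assumes wf: "wf_config c" and e: "e \<in> events k"
  shows "wf_config (step \<pi> x r e c)"
proof (cases e)
  case (Deliver i j)
  then show ?thesis using wf unfolding wf_config_def by (auto simp: Suc_le_eq le_SucI)
next
  case (Act i)
  with e have i: "i \<in> K" unfolding events_def by auto
  show ?thesis
  proof (cases "phase c i")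
    case Ready
    then show ?thesis
      using wf i recv_subset[OF i, of "rnd c i" "view_of x r c i"] unfolding wf_config_def Act
      by (auto simp: Let_def intro: le_SucI split: option.splits if_splits)
  next
    case (Waiting S)
    then have "i \<notin> S" using Waiting_subset[OF wf i] by blast
    then show ?thesis
      using Waiting wf i unfolding wf_config_def Act
      by (auto simp: Suc_le_eq split: if_splits)
  next
    case (Stopped w)
    then show ?thesis using wf Act by simp
  qed
qed

lemma wf_run: "wf_config (run x t)"
proof (induction t)
  case 0
  show ?case by (simp add: wf_config_def init_def)
next
  case (Suc t)
  then show ?case by (simp add: wf_step event_in)
qed

lemma local_state_other:
  assumes "wf_config c" "e \<noteq> Act b"
  shows "local_state (step \<pi> x r e c) b = local_state c b"
  using assms unfolding wf_config_def
  by (cases e) (auto simp: local_state_def Let_def fun_eq_iff split: phase.splits option.splits if_splits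
      intro: order_trans)

lemma local_state_run_other: "\<sigma> t \<noteq> Act b \<Longrightarrow> local_state (run x (Suc t)) b = local_state (run x t) b"
  by (simp add: local_state_other wf_run)

lemma sent_step: "prefix (sent c a b) (sent (step \<pi> x r e c) a b)"
  by (cases e) (auto simp: Let_def split: phase.splits option.splits if_splits)

lemma nread_step: "nread c a b \<le> nread (step \<pi> x r e c) a b"
  by (cases e) (auto simp: Let_def split: phase.splits option.splits if_splits)

lemma sent_mono: "t \<le> t' \<Longrightarrow> prefix (sent (run x t) a b) (sent (run x t') a b)"
proof (induction t' rule: dec_induct)
  case (step m)
  then show ?case using sent_step[of "run x m" a b x "\<sigma> m"] by (auto intro: prefix_order.trans)
qed simp

lemma nread_mono: "t \<le> t' \<Longrightarrow> nread (run x t) a b \<le> nread (run x t') a b"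
proof (induction t' rule: dec_induct)
  case (step m)
  then show ?case using nread_step[of "run x m" a b x "\<sigma> m"] by auto
qed simp

lemma local_state_stopped:
  assumes "phase (run x t) b = Stopped w" "t \<le> t'"
  shows "local_state (run x t') b = local_state (run x t) b"
  using assms(2)
proof (induction t' rule: dec_induct)
  case (step m)
  then have ph: "phase (run x m) b = Stopped w" using assms(1) by (simp add: local_state_def)
  show ?case
  proof (cases "\<sigma> m = Act b")
    case True
    then show ?thesis using step ph by simp
  next
    case False
    then show ?thesis using step local_state_other[OF wf_run] by simp
  qed
qed simp

text \<open>Stopped players keep their local state, so \<open>final_state\<close> does not depend on
  which such time is chosen.\<close>

definition halt_time :: "(nat \<Rightarrow> 'x) \<Rightarrow> nat" where
  "halt_time x = (SOME t. \<forall>b\<in>K. \<exists>w. phase (run x t) b = Stopped w)"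

definition final_state :: "(nat \<Rightarrow> 'x) \<Rightarrow> nat \<Rightarrow> nat \<times> phase \<times> (nat \<Rightarrow> nat) \<times> (nat \<Rightarrow> bits list) \<times> (nat \<Rightarrow> bits list)" where
  "final_state x b = local_state (run x (halt_time x)) b"

lemma halt_time:
  assumes x: "x \<in> inputs k X" and b: "b \<in> K"
  shows "\<exists>w. phase (run x (halt_time x)) b = Stopped w"
proof -
  from halts[OF x] have "\<forall>b\<in>K. \<exists>t w. phase (run x t) b = Stopped w"
    unfolding outputs_def by blast
  then obtain t where t: "\<And>b. b \<in> K \<Longrightarrow> \<exists>w. phase (run x (t b)) b = Stopped w" by metis
  have "\<exists>w. phase (run x (Max (t ` K))) b = Stopped w" if b: "b \<in> K" for b
  proof -
    from t[OF b] obtain w where w: "phase (run x (t b)) b = Stopped w" by blast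
    moreover have "t b \<le> Max (t ` K)" using b by auto
    ultimately have "local_state (run x (Max (t ` K))) b = local_state (run x (t b)) b" by (rule local_state_stopped)
    then show ?thesis using w by (auto simp: local_state_def)
  qed
  then have "\<forall>b\<in>K. \<exists>w. phase (run x (halt_time x)) b = Stopped w"
    unfolding halt_time_def by (intro someI[of "\<lambda>t. \<forall>b\<in>K. \<exists>w. phase (run x t) b = Stopped w"]) blast
  with b show ?thesis by blast
qed

lemma local_state_eq_final:
  assumes x: "x \<in> inputs k X" "b \<in> K" and w: "phase (run x t) b = Stopped w"
  shows "local_state (run x t) b = final_state x b"
proof -
  from halt_time[OF x] obtain w' where w': "phase (run x (halt_time x)) b = Stopped w'" by blast
  show ?thesis
    using local_state_stopped[OF w, of "halt_time x"] local_state_stopped[OF w', of t] unfolding final_state_def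
    by (cases "t \<le> halt_time x") auto
qed

text \<open>Message boundaries are forgotten, so that the length of the string is at most the number
  of bits sent. Self-delimitation recovers the boundaries.\<close>

definition received_upto :: "(nat \<Rightarrow> 'x) \<Rightarrow> nat \<Rightarrow> nat \<Rightarrow> nat \<Rightarrow> bits" where
  "received_upto x t a b = concat (take (nread (run x t) a b) (sent (run x t) a b))"

definition received :: "(nat \<Rightarrow> 'x) \<Rightarrow> nat \<Rightarrow> nat \<Rightarrow> bits" where
  "received x a b = received_upto x (halt_time x) a b"

definition sent_bits :: "(nat \<Rightarrow> 'x) \<Rightarrow> nat \<Rightarrow> nat \<Rightarrow> bits" where
  "sent_bits x a b = concat (sent (run x (halt_time x)) a b)"

lemma received_prefix_sent_bits: "prefix (received x a b) (sent_bits x a b)"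
  unfolding received_def sent_bits_def received_upto_def by (intro prefix_concat) (rule take_is_prefix)

lemma final_state_eqD:
  assumes "final_state x b = final_state x' b"
  shows "received x a b = received x' a b" "sent_bits x b d = sent_bits x' b d"
    "phase (run x (halt_time x)) b = phase (run x' (halt_time x')) b"
  using local_state_eqD[OF assms[unfolded final_state_def]] unfolding received_def sent_bits_def received_upto_def by simp_all

lemma received_self: "b \<in> K \<Longrightarrow> received x b b = []"
  using wf_run[of x "halt_time x"] unfolding wf_config_def received_def received_upto_def by auto

lemma take_prefix_mono:
  assumes "prefix xs ys" "m \<le> n" "m \<le> length xs"
  shows "prefix (take m xs) (take n ys)"
proof -
  from assms(1) obtain zs where "ys = xs @ zs" by (auto simp: prefix_def)
  then have "take m xs = take m ys" using assms(3) by simp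
  also have "prefix (take m ys) (take n ys)"
    using assms(2) by (metis min_absorb1 take_is_prefix take_take)
  finally show ?thesis .
qed

lemma received_upto_prefix:
  assumes "x \<in> inputs k X" "b \<in> K"
  shows "prefix (received_upto x t a b) (received x a b)"
proof (cases "t \<le> halt_time x")
  case True
  have "nread (run x t) a b \<le> length (sent (run x t) a b)"
    using wf_run[of x t] unfolding wf_config_def by (meson order_trans)
  then show ?thesis
    unfolding received_def received_upto_def using sent_mono[OF True] nread_mono[OF True]
    by (intro prefix_concat take_prefix_mono)
next
  case False
  from halt_time[OF assms] obtain w where w: "phase (run x (halt_time x)) b = Stopped w" by blast
  have "local_state (run x t) b = local_state (run x (halt_time x)) b"
    using False by (intro local_state_stopped[OF w]) simp
  from local_state_eqD(4)[OF this] show ?thesis unfolding received_def received_upto_def by simp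
qed

text \<open>Both strings are initial parts of what the link carries at the later of the two
  times.\<close>

lemma comparable_sent_received:
  "comparable (concat (take m (sent (run x t) a b))) (received x a b)"
proof -
  let ?M = "max t (halt_time x)"
  have "prefix (take m (sent (run x t) a b)) (sent (run x ?M) a b)"
    by (rule prefix_order.trans[OF take_is_prefix sent_mono]) simp
  moreover have "prefix (take (nread (run x (halt_time x)) a b) (sent (run x (halt_time x)) a b)) (sent (run x ?M) a b)"
    by (rule prefix_order.trans[OF take_is_prefix sent_mono]) simp
  ultimately show ?thesis
    unfolding received_def received_upto_def comparable_def
    by (intro prefix_same_cases[OF prefix_concat prefix_concat])
qed

section \<open>Simulation of a run by template runs\<close>

lemma local_state_step_Ready:
  assumes "local_state c b = local_state c' b" "x b = x' b" "phase c b = Ready" "wf_config c" "wf_config c'"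
  shows "local_state (step \<pi> x r (Act b) c) b = local_state (step \<pi> x' r (Act b) c') b"
proof -
  have eqs: "rnd c b = rnd c' b" "phase c' b = Ready" "\<And>a. nread c a b = nread c' a b"
    "\<And>a. take (nread c a b) (sent c a b) = take (nread c' a b) (sent c' a b)" "sent c b = sent c' b"
    using local_state_eqD[OF assms(1)] assms(3) by simp_all
  have v: "view_of x r c b = view_of x' r c' b"
    unfolding view_of_def using eqs assms(2) by simp
  have len: "nread c a b \<le> length (sent c a b)" "nread c' a b \<le> length (sent c' a b)" for a
    using assms(4,5) unfolding wf_config_def by (meson order_trans)+
  show ?thesis
    using assms(3) eqs(1,2,3,5) len v eqs(4)
    by (auto simp: local_state_def Let_def fun_eq_iff)
qed

lemma local_state_step_Waiting:
  assumes "local_state c b = local_state c' b" "phase c b = Waiting S" "wf_config c" "wf_config c'"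
    and en: "\<forall>a\<in>S. nread c a b < arrived c a b" "\<forall>a\<in>S. nread c' a b < arrived c' a b"
    and msg: "\<And>a. a \<in> S \<Longrightarrow> sent c a b ! nread c a b = sent c' a b ! nread c' a b"
  shows "local_state (step \<pi> x r (Act b) c) b = local_state (step \<pi> x' r (Act b) c') b"
proof -
  have eqs: "rnd c b = rnd c' b" "phase c' b = Waiting S" "\<And>a. nread c a b = nread c' a b"
    "\<And>a. take (nread c a b) (sent c a b) = take (nread c' a b) (sent c' a b)" "sent c b = sent c' b"
    using local_state_eqD[OF assms(1)] assms(2) by simp_all
  have len: "nread c a b < length (sent c a b)" "nread c' a b < length (sent c' a b)" if "a \<in> S" for a
    using assms(3,4) en that unfolding wf_config_def by (meson order.strict_trans2)+
  show ?thesis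
    using assms(2) eqs(1,2,3,5) len en eqs(4) msg
    by (auto simp: local_state_def fun_eq_iff take_Suc_conv_app_nth)
qed

lemma last_time:
  fixes m :: nat
  assumes "P t'" "\<not> P m" "t' \<le> m"
  shows "\<exists>t\<ge>t'. P t \<and> \<not> P (Suc t)"
proof (rule ccontr)
  assume "\<not> ?thesis"
  then have step: "P (Suc t)" if "t' \<le> t" "P t" for t using that by blast
  have "P m" using assms(3) by (induction m rule: dec_induct) (use assms(1) step in auto)
  with assms(2) show False by simp
qed

lemma possible_messageI:
  assumes "x \<in> inputs k X" "phase (run x t) b = Waiting S" "a \<in> S" "nread (run x t) a b < length (sent (run x t) a b)"
  shows "sent (run x t) a b ! nread (run x t) a b \<in> possible_messages k X \<pi> a b (view_of x r (run x t) b)"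
  unfolding possible_messages_def Let_def mem_Collect_eq using assms r \<sigma> by blast

lemma comparable_messages:
  assumes "a \<in> K" "b \<in> K" "m \<in> possible_messages k X \<pi> a b v" "m' \<in> possible_messages k X \<pi> a b v" "comparable m m'"
  shows "m = m'"
proof -
  have "\<forall>m\<in>possible_messages k X \<pi> a b v. \<forall>m'\<in>possible_messages k X \<pi> a b v. prefix m m' \<longrightarrow> m = m'"
    using protocol assms(1,2) unfolding is_protocol_def self_delimiting_def by blast
  then show ?thesis using assms(3-5) unfolding comparable_def by blast
qed

text \<open>
  If \<open>y\<close> gives to each player \<open>b\<close> its input in the run on \<open>tmpl b\<close>, and the strings read on the
  links fit together, then in the run on \<open>y\<close> each player only passes through local states of its own
  template run.  The step is the reading of a message: the candidates in the two runs are
  comparable, hence equal because they are self-delimiting for the same view.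
\<close>
lemma simulation:
  assumes y: "y \<in> inputs k X" and tmpl: "\<And>b. b \<in> K \<Longrightarrow> tmpl b \<in> inputs k X" "\<And>b. b \<in> K \<Longrightarrow> y b = tmpl b b"
    and links: "\<And>a b. a \<in> K \<Longrightarrow> b \<in> K \<Longrightarrow>
       received (tmpl a) a b = received (tmpl b) a b \<or> comparable (received y a b) (received (tmpl b) a b)"
  shows "\<forall>b\<in>K. \<exists>t'. local_state (run y t) b = local_state (run (tmpl b) t') b"
proof (induction t)
  case 0
  show ?case by (auto intro!: exI[of _ 0])
next
  case (Suc t)
  show ?case
  proof
    fix b assume b: "b \<in> K"
    let ?c = "run y t" and ?x = "tmpl b"
    from Suc b obtain t' where t': "local_state ?c b = local_state (run ?x t') b" by blast
    show "\<exists>t'. local_state (run y (Suc t)) b = local_state (run ?x t') b"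
    proof (cases "local_state (run y (Suc t)) b = local_state ?c b")
      case True
      then show ?thesis using t' by auto
    next
      case changed: False
      then have act: "\<sigma> t = Act b" using local_state_run_other by metis
      have running: "phase ?c b \<noteq> Stopped w" for w
        using changed act by auto
      have "\<not> halt_time ?x \<le> t'"
      proof
        assume le: "halt_time ?x \<le> t'"
        from halt_time[OF tmpl(1)[OF b] b] obtain w where "phase (run ?x (halt_time ?x)) b = Stopped w" by blast
        from local_state_stopped[OF this le] this t' running show False by (auto simp: local_state_def)
      qed
      moreover have "local_state (run ?x (halt_time ?x)) b \<noteq> local_state ?c b"
        using halt_time[OF tmpl(1)[OF b] b] running by (auto simp: local_state_def)
      \<comment> \<open>A time at which the template run leaves the current local state of
        \<open>b\<close>, hence takes the step to be matched. It exists because this state is not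
        stopped, whereas the final one is.\<close>
      ultimately obtain t3 where t3: "local_state (run ?x t3) b = local_state ?c b" "local_state (run ?x (Suc t3)) b \<noteq> local_state ?c b"
        using last_time[of "\<lambda>t. local_state (run ?x t) b = local_state ?c b" t' "halt_time ?x"] t' by auto
      let ?d = "run ?x t3"
      from t3 have act': "\<sigma> t3 = Act b" using local_state_run_other by metis
      have "local_state (step \<pi> y r (Act b) ?c) b = local_state (step \<pi> ?x r (Act b) ?d) b"
      proof (cases "phase ?c b")
        case Ready
        then show ?thesis by (intro local_state_step_Ready wf_run) (use t3 tmpl(2)[OF b] in auto)
      next
        case (Stopped w)
        then show ?thesis using running by simp
      next
        case (Waiting S)
        then have Waiting': "phase ?d b = Waiting S" using t3(1) by (auto simp: local_state_def)
        have en: "\<forall>a\<in>S. nread ?c a b < arrived ?c a b"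
          using changed act Waiting by (auto split: if_splits)
        have en': "\<forall>a\<in>S. nread ?d a b < arrived ?d a b"
          using t3 act' Waiting' by (auto split: if_splits)
        show ?thesis
        proof (intro local_state_step_Waiting[OF _ Waiting wf_run wf_run en en'])
          fix a assume a: "a \<in> S"
          then have aK: "a \<in> K" using Waiting_subset[OF wf_run b Waiting] by blast
          let ?m = "sent ?c a b ! nread ?c a b" and ?m' = "sent ?d a b ! nread ?d a b"
          have len: "nread ?c a b < length (sent ?c a b)" "nread ?d a b < length (sent ?d a b)"
            using wf_run en en' a unfolding wf_config_def by (meson order.strict_trans2)+
          have nr: "nread ?d a b = nread ?c a b"
            and prior: "take (nread ?d a b) (sent ?d a b) = take (nread ?c a b) (sent ?c a b)"
            and view: "view_of ?x r ?d b = view_of y r ?c b"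
            using local_state_eqD[OF t3(1)] tmpl(2)[OF b] unfolding view_of_def by simp_all
          have suc: "received_upto y (Suc t) a b = concat (take (nread ?c a b) (sent ?c a b)) @ ?m"
            "received_upto ?x (Suc t3) a b = concat (take (nread ?d a b) (sent ?d a b)) @ ?m'"
            using Waiting Waiting' en en' a act act' len unfolding received_upto_def
            by (simp_all add: take_Suc_conv_app_nth)
          have "comparable (received_upto y (Suc t) a b) (received ?x a b)"
            using links[OF aK b]
          proof
            \<comment> \<open>The sender has followed its own template so far, so the log of the
              link is one that occurs in the run on \<open>tmpl a\<close>.\<close>
            assume eq: "received (tmpl a) a b = received ?x a b"
            from Suc aK obtain ta where "local_state ?c a = local_state (run (tmpl a) ta) a" by blast
            then have "sent ?c a b = sent (run (tmpl a) ta) a b" by (rule local_state_eqD(5)[THEN fun_cong])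
            moreover from this have "comparable (concat (take (Suc (nread ?c a b)) (sent (run (tmpl a) ta) a b))) (received (tmpl a) a b)"
              by (intro comparable_sent_received)
            ultimately show ?thesis
              unfolding suc eq using len by (simp add: take_Suc_conv_app_nth)
          next
            assume "comparable (received y a b) (received ?x a b)"
            then show ?thesis using received_upto_prefix[OF y b] by (rule comparable_prefix)
          qed
          then have "comparable (received_upto ?x (Suc t3) a b) (received_upto y (Suc t) a b)"
            using comparable_prefix[OF _ received_upto_prefix[OF tmpl(1)[OF b] b]] comparable_commute[of "received ?x a b"] by blast
          then have "comparable ?m' ?m" unfolding suc prior comparable_append .
          moreover have "?m \<in> possible_messages k X \<pi> a b (view_of y r ?c b)"
            by (rule possible_messageI[OF y Waiting a len(1)])
          moreover have "?m' \<in> possible_messages k X \<pi> a b (view_of y r ?c b)"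
            using possible_messageI[OF tmpl(1)[OF b] Waiting' a len(2)] unfolding view .
          ultimately have "?m' = ?m" by (intro comparable_messages[OF aK b])
          then show "?m = ?m'" by (rule sym)
        qed (use t3 in auto)
      qed
      then show ?thesis using act act' by (intro exI[of _ "Suc t3"]) simp
    qed
  qed
qed

corollary final_state_simulation:
  assumes y: "y \<in> inputs k X" and tmpl: "\<And>b. b \<in> K \<Longrightarrow> tmpl b \<in> inputs k X" "\<And>b. b \<in> K \<Longrightarrow> y b = tmpl b b"
    and links: "\<And>a b. a \<in> K \<Longrightarrow> b \<in> K \<Longrightarrow>
       received (tmpl a) a b = received (tmpl b) a b \<or> comparable (received y a b) (received (tmpl b) a b)"
    and b: "b \<in> K"
  shows "final_state y b = final_state (tmpl b) b"
proof -
  from simulation[OF y tmpl links, where t="halt_time y"] b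
  obtain t' where t': "final_state y b = local_state (run (tmpl b) t') b" unfolding final_state_def by blast
  from halt_time[OF y b] obtain w where "phase (run y (halt_time y)) b = Stopped w" by blast
  with t' have "phase (run (tmpl b) t') b = Stopped w" unfolding final_state_def local_state_def by auto
  from local_state_eq_final[OF tmpl(1)[OF b] b this] t' show ?thesis by simp
qed

text \<open>Simulation of the run on \<open>x\<close> with template \<open>x'\<close> on
  \<open>B\<close> and \<open>x\<close> itself elsewhere; only links entering \<open>B\<close> from
  outside need a comparison.\<close>

corollary final_state_eq_of_comparable:
  assumes x: "x \<in> inputs k X" "x' \<in> inputs k X" and B: "B \<subseteq> K" "\<And>b. b \<in> B \<Longrightarrow> x b = x' b"
    and links: "\<And>a b. a \<in> K - B \<Longrightarrow> b \<in> B \<Longrightarrow> comparable (received x a b) (received x' a b)"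
    and b: "b \<in> B"
  shows "final_state x b = final_state x' b"
proof -
  have "final_state x b = final_state (if b \<in> B then x' else x) b"
  proof (rule final_state_simulation[OF x(1)])
    fix a b assume "a \<in> K" "b \<in> K"
    then show "received (if a \<in> B then x' else x) a b = received (if b \<in> B then x' else x) a b \<or>
        comparable (received x a b) (received (if b \<in> B then x' else x) a b)"
      using links[of a b] by auto
  qed (use x B b in auto)
  with b show ?thesis by simp
qed

end

section \<open>Kraft's inequality and codes for cuts\<close>

lemma card_extensions:
  assumes "length p \<le> N"
  shows "card {w :: bool list. length w = N \<and> prefix p w} = 2 ^ (N - length p)"
proof -
  have "{w :: bool list. length w = N \<and> prefix p w} = (@) p ` {w. length w = N - length p}"
    using assms by (auto simp: prefix_def image_iff)
  then have "card {w :: bool list. length w = N \<and> prefix p w} = card {w :: bool list. length w = N - length p}"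
    by (simp add: card_image inj_on_def)
  also have "\<dots> = 2 ^ (N - length p)"
    using card_lists_length_eq[of "UNIV :: bool set" "N - length p"] by simp
  finally show ?thesis .
qed

text \<open>
  Each tuple of strings defines a cylinder of tuples of strings of a common length \<open>N\<close>, and these
  cylinders are disjoint.
\<close>
lemma kraft:
  fixes code :: "'v \<Rightarrow> 'l \<Rightarrow> bool list"
  assumes fin: "finite V" "finite L"
    and incomp: "\<And>v v'. v \<in> V \<Longrightarrow> v' \<in> V \<Longrightarrow> (\<And>l. l \<in> L \<Longrightarrow> comparable (code v l) (code v' l)) \<Longrightarrow> v = v'"
  shows "(\<Sum>v\<in>V. (1/2) ^ (\<Sum>l\<in>L. length (code v l))) \<le> (1::real)"
proof -
  obtain N where N: "\<And>v l. v \<in> V \<Longrightarrow> l \<in> L \<Longrightarrow> length (code v l) \<le> N"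
  proof
    fix v l assume "v \<in> V" "l \<in> L"
    then show "length (code v l) \<le> Max ((\<lambda>(v, l). length (code v l)) ` (V \<times> L))"
      using fin by (intro Max_ge) auto
  qed
  define E where "E v = (\<Pi>\<^sub>E l\<in>L. {w. length w = N \<and> prefix (code v l) w})" for v
  define W where "W = (\<Pi>\<^sub>E l\<in>L. {w :: bool list. length w = N})"
  have finW: "finite {w :: bool list. length w = N}"
    using finite_lists_length_eq[of "UNIV :: bool set" N] by simp
  have cardW: "real (card W) = (2 ^ N) ^ card L"
    using card_lists_length_eq[of "UNIV :: bool set" N] fin unfolding W_def by (simp add: card_PiE)
  have "finite W" unfolding W_def using fin finW by (intro finite_PiE) auto
  have sub: "E v \<subseteq> W" for v unfolding E_def W_def by (intro PiE_mono) auto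
  have "real (card (E v)) = (2 ^ N) ^ card L * (1/2) ^ (\<Sum>l\<in>L. length (code v l))" if "v \<in> V" for v
  proof -
    have "real (card (E v)) = (\<Prod>l\<in>L. 2 ^ (N - length (code v l)))"
      unfolding E_def using fin by (simp add: card_PiE card_extensions N[OF that])
    also have "\<dots> = (\<Prod>l\<in>L. 2 ^ N * (1/2) ^ length (code v l))"
      using N[OF that] by (intro prod.cong refl) (simp add: power_diff power_divide)
    also have "\<dots> = (2 ^ N) ^ card L * (1/2) ^ (\<Sum>l\<in>L. length (code v l))"
      by (simp add: prod.distrib power_sum)
    finally show ?thesis .
  qed
  then have "(2 ^ N) ^ card L * (\<Sum>v\<in>V. (1/2) ^ (\<Sum>l\<in>L. length (code v l))) = (\<Sum>v\<in>V. real (card (E v)))"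
    by (simp add: sum_distrib_left)
  also have "\<dots> = real (card (\<Union>v\<in>V. E v))"
  proof (subst card_UN_disjoint)
    show "\<forall>v\<in>V. finite (E v)" using sub \<open>finite W\<close> finite_subset by blast
    show "\<forall>v\<in>V. \<forall>v'\<in>V. v \<noteq> v' \<longrightarrow> E v \<inter> E v' = {}"
    proof (intro ballI impI)
      fix v v' assume v: "v \<in> V" "v' \<in> V" "v \<noteq> v'"
      show "E v \<inter> E v' = {}"
      proof (rule ccontr)
        assume "E v \<inter> E v' \<noteq> {}"
        then obtain w where "\<And>l. l \<in> L \<Longrightarrow> prefix (code v l) (w l)" "\<And>l. l \<in> L \<Longrightarrow> prefix (code v' l) (w l)"
          unfolding E_def by (auto simp: PiE_iff)
        then have "comparable (code v l) (code v' l)" if "l \<in> L" for l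
          using that prefix_same_cases unfolding comparable_def by blast
        with incomp v show False by blast
      qed
    qed
  qed (use fin in simp_all)
  also have "\<dots> \<le> real (card W)"
    using sub \<open>finite W\<close> by (intro of_nat_mono card_mono) auto
  finally show ?thesis unfolding cardW by (simp add: mult_le_cancel_left1)
qed

text \<open>For \<open>m \<le> N\<close> the length is always \<open>N\<close>, so comparable words
  with the same \<open>N\<close> are equal.\<close>

definition unary :: "nat \<Rightarrow> nat \<Rightarrow> bits" where
  "unary m N = replicate m True @ replicate (N - m) False"

lemma length_unary: "m \<le> N \<Longrightarrow> length (unary m N) = N"
  unfolding unary_def by simp

lemma unary_inj: "unary m N = unary m' N \<Longrightarrow> m = m'"
proof -
  have "count_list (unary m N) True = m" for m
    unfolding unary_def by (induction m) (simp_all add: count_list_0_iff)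
  then show "unary m N = unary m' N \<Longrightarrow> m = m'" by metis
qed

context halting_run
begin

lemma length_received_le: "length (received x a b) \<le> length (sent_bits x a b)"
  using received_prefix_sent_bits by (rule prefix_length_le)

text \<open>
  Given the inputs on the side \<open>B\<close>, the strings read on the links into \<open>B\<close> determine the
  strings sent on the links out of \<open>B\<close>.  The length of the part that is read of the latter is
  encoded in unary, padded to the length of what is sent.
\<close>
lemma code_exists:
  fixes x0 :: "nat \<Rightarrow> 'x" and In Out :: "(nat \<times> nat) set" and f :: "(nat \<Rightarrow> 'x) \<Rightarrow> 't"
  assumes fin: "finite In" "finite Out" "finite (inputs k X)"
    and B: "B \<subseteq> K" "\<And>a b. (a, b) \<in> In \<Longrightarrow> b \<in> B" "\<And>a b. (a, b) \<in> Out \<Longrightarrow> a \<in> B"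
    and cut: "\<And>a b. a \<in> K - B \<Longrightarrow> b \<in> B \<Longrightarrow> (a, b) \<in> In"
    and f: "\<And>x x'. x \<in> inputs k X \<Longrightarrow> x' \<in> inputs k X \<Longrightarrow>
       f x = f x' \<longleftrightarrow> (\<forall>(a, b)\<in>In \<union> Out. received x a b = received x' a b)"
  defines "A \<equiv> {x\<in>inputs k X. \<forall>b\<in>B. x b = x0 b}"
  shows "\<exists>len::'t \<Rightarrow> nat. (\<Sum>t\<in>f ` A. (1/2) ^ len t) \<le> (1::real) \<and>
     (\<forall>x\<in>A. len (f x) \<le> (\<Sum>(a, b)\<in>In. length (sent_bits x a b)) + (\<Sum>(a, b)\<in>Out. length (sent_bits x a b)))"
proof -
  define L where "L = In <+> Out"
  define code where "code x l = (case l of Inl (a, b) \<Rightarrow> received x a b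
      | Inr (a, b) \<Rightarrow> unary (length (received x a b)) (length (sent_bits x a b)))" for x and l :: "(nat \<times> nat) + (nat \<times> nat)"
  have key: "final_state x b = final_state x' b" if "x \<in> A" "x' \<in> A" "\<And>a b. (a, b) \<in> In \<Longrightarrow> comparable (received x a b) (received x' a b)" "b \<in> B" for x x' b
  proof (rule final_state_eq_of_comparable[of x x' B])
    show "x \<in> inputs k X" "x' \<in> inputs k X" "\<And>b. b \<in> B \<Longrightarrow> x b = x' b"
      using that(1,2) unfolding A_def by auto
  qed (use that(3,4) cut B(1) in blast)+
  have same: "f x = f x'" if x: "x \<in> A" "x' \<in> A" and c: "\<And>l. l \<in> L \<Longrightarrow> comparable (code x l) (code x' l)" for x x'
  proof -
    have "comparable (received x a b) (received x' a b)" if "(a, b) \<in> In" for a b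
      using c[of "Inl (a, b)"] that unfolding L_def code_def by auto
    then have fin_eq: "final_state x b = final_state x' b" if "b \<in> B" for b using key[OF x] that by blast
    have "received x a b = received x' a b" if "(a, b) \<in> In" for a b
      using final_state_eqD(1)[OF fin_eq[OF B(2)[OF that]]] .
    moreover have "received x a b = received x' a b" if ab: "(a, b) \<in> Out" for a b
    proof -
      have sent_bits: "sent_bits x a b = sent_bits x' a b" using final_state_eqD(2)[OF fin_eq[OF B(3)[OF ab]]] .
      have "comparable (unary (length (received x a b)) (length (sent_bits x a b))) (unary (length (received x' a b)) (length (sent_bits x' a b)))"
        using c[of "Inr (a, b)"] ab unfolding L_def code_def by auto
      then have "unary (length (received x a b)) (length (sent_bits x a b)) = unary (length (received x' a b)) (length (sent_bits x a b))"
        using length_received_le[of x a b] length_received_le[of x' a b] sent_bits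
        by (intro comparable_same_length) (simp_all add: length_unary)
      then have "length (received x a b) = length (received x' a b)" by (rule unary_inj)
      moreover have "comparable (received x a b) (received x' a b)"
        using prefix_same_cases[OF received_prefix_sent_bits[of x a b]] received_prefix_sent_bits[of x' a b] unfolding sent_bits comparable_def by blast
      ultimately show ?thesis by (intro comparable_same_length)
    qed
    ultimately have "\<forall>(a, b)\<in>In \<union> Out. received x a b = received x' a b" by blast
    then show ?thesis using f[of x x'] x unfolding A_def by blast
  qed
  \<comment> \<open>Code lengths may depend on the transcript only, so one input per transcript is
    chosen. Any other input in \<open>A\<close> with this transcript reads the same strings on the
    cut and sends the same ones out of \<open>B\<close>.\<close>
  define rep where "rep = inv_into A f"
  have rep: "rep t \<in> A \<and> f (rep t) = t" if "t \<in> f ` A" for t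
    unfolding rep_def using that by (simp add: inv_into_into f_inv_into_f)
  let ?len = "\<lambda>t. \<Sum>l\<in>L. length (code (rep t) l)"
  have "(\<Sum>t\<in>f ` A. (1/2) ^ ?len t) \<le> (1::real)"
  proof (rule kraft[where code = "\<lambda>t. code (rep t)"])
    show "finite (f ` A)" using fin unfolding A_def by simp
    show "finite L" using fin unfolding L_def by simp
    fix t t' assume t: "t \<in> f ` A" "t' \<in> f ` A" and c: "\<And>l. l \<in> L \<Longrightarrow> comparable (code (rep t) l) (code (rep t') l)"
    have "f (rep t) = f (rep t')" using rep[OF t(1)] rep[OF t(2)] c by (intro same) simp_all
    then show "t = t'" using rep[OF t(1)] rep[OF t(2)] by simp
  qed
  moreover have "?len (f x) \<le> (\<Sum>(a, b)\<in>In. length (sent_bits x a b)) + (\<Sum>(a, b)\<in>Out. length (sent_bits x a b))" if x: "x \<in> A" for x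
  proof -
    let ?y = "rep (f x)"
    have y: "?y \<in> A" "f ?y = f x" using rep[of "f x"] x by auto
    then have received: "received ?y a b = received x a b" if "(a, b) \<in> In \<union> Out" for a b
    proof -
      have "?y \<in> inputs k X" "x \<in> inputs k X" using y(1) x unfolding A_def by auto
      from f[OF this] y(2) that show ?thesis by blast
    qed
    then have fin_eq: "final_state ?y b = final_state x b" if "b \<in> B" for b using key[OF y(1) x] that by simp
    have sent_bits: "sent_bits ?y a b = sent_bits x a b" if "(a, b) \<in> Out" for a b
      using final_state_eqD(2)[OF fin_eq[OF B(3)[OF that]]] .
    have "?len (f x) = (\<Sum>l\<in>In. length (code ?y (Inl l))) + (\<Sum>l\<in>Out. length (code ?y (Inr l)))"
      unfolding L_def by (subst sum.Plus) (use fin in auto)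
    also have "\<dots> \<le> (\<Sum>(a, b)\<in>In. length (sent_bits x a b)) + (\<Sum>(a, b)\<in>Out. length (sent_bits x a b))"
    proof (intro add_mono sum_mono)
      fix l assume "l \<in> In"
      then show "length (code ?y (Inl l)) \<le> (case l of (a, b) \<Rightarrow> length (sent_bits x a b))"
        using received[of "fst l" "snd l"] length_received_le[of x "fst l" "snd l"] by (cases l) (simp add: code_def)
    next
      fix l assume "l \<in> Out"
      then show "length (code ?y (Inr l)) \<le> (case l of (a, b) \<Rightarrow> length (sent_bits x a b))"
        using received[of "fst l" "snd l"] sent_bits[of "fst l" "snd l"] length_received_le[of x "fst l" "snd l"]
        by (cases l) (simp add: code_def length_unary)
    qed
    finally show ?thesis .
  qed
  ultimately show ?thesis by (intro exI[of _ ?len] conjI ballI)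
qed

section \<open>Cut transcripts of a protocol\<close>

text \<open>What is read, not what is sent: an unread message influences nobody. The entry
  \<open>j = i\<close> is empty and only keeps the indexing uniform.\<close>

definition cut_strings :: "nat \<Rightarrow> (nat \<Rightarrow> 'x) \<Rightarrow> bits list \<times> bits list" where
  "cut_strings i x = (map (\<lambda>j. received x j i) [1..<Suc k], map (\<lambda>j. received x i j) [1..<Suc k])"

definition outputs_one :: "nat \<Rightarrow> (nat \<Rightarrow> 'x) \<Rightarrow> bool" where
  "outputs_one i x \<longleftrightarrow> outputs \<pi> x r \<sigma> i [True]"

text \<open>Sent bits rather than read ones, because the unary part of the code is as long as what
  is sent.\<close>

definition traffic :: "nat \<Rightarrow> (nat \<Rightarrow> 'x) \<Rightarrow> nat" where
  "traffic i x = (\<Sum>j\<in>K - {i}. length (sent_bits x j i)) + (\<Sum>j\<in>K - {i}. length (sent_bits x i j))"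

lemma cut_strings_eq_iff: "cut_strings i x = cut_strings i x' \<longleftrightarrow> (\<forall>j\<in>K. received x j i = received x' j i \<and> received x i j = received x' i j)"
  unfolding cut_strings_def by (auto simp: less_Suc_eq_le)

lemma outputs_iff:
  assumes "x \<in> inputs k X" "i \<in> K"
  shows "outputs \<pi> x r \<sigma> i w \<longleftrightarrow> phase (run x (halt_time x)) i = Stopped w"
proof
  assume "outputs \<pi> x r \<sigma> i w"
  then obtain t where t: "phase (run x t) i = Stopped w" unfolding outputs_def by blast
  from local_state_eqD(2)[OF local_state_eq_final[OF assms t, unfolded final_state_def]] t
  show "phase (run x (halt_time x)) i = Stopped w" by simp
qed (auto simp: outputs_def)

text \<open>Rectangle property by simulation, with template \<open>x\<close> for \<open>i\<close>
  and \<open>x'\<close> for all others; equal cut strings make the links between the two groups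
  fit.\<close>

lemma cut_strings_mix:
  assumes i: "i \<in> K" and x: "x \<in> inputs k X" "x' \<in> inputs k X" and y: "y \<in> inputs k X"
    and eq: "cut_strings i x = cut_strings i x'" and mix: "y i = x i" "\<And>j. j \<in> K \<Longrightarrow> j \<noteq> i \<Longrightarrow> y j = x' j"
  shows "cut_strings i y = cut_strings i x"
proof -
  have fin: "final_state y b = final_state (if b = i then x else x') b" if "b \<in> K" for b
  proof (rule final_state_simulation[OF y _ _ _ that])
    fix a b assume "a \<in> K" "b \<in> K"
    then show "received (if a = i then x else x') a b = received (if b = i then x else x') a b \<or>
        comparable (received y a b) (received (if b = i then x else x') a b)"
      using eq unfolding cut_strings_eq_iff by auto
  qed (use x mix in auto)
  have "received y j i = received x j i \<and> received y i j = received x i j" if j: "j \<in> K" for j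
    using final_state_eqD(1)[OF fin[OF i], of j] final_state_eqD(1)[OF fin[OF j], of i] eq j unfolding cut_strings_eq_iff
    by (auto split: if_splits)
  then show ?thesis unfolding cut_strings_eq_iff by blast
qed

lemma cut_strings_rest:
  assumes i: "i \<in> K" and j: "j \<in> K" "i \<noteq> j" and x: "x \<in> inputs k X" "x' \<in> inputs k X"
    and eq: "cut_strings i x = cut_strings i x'" and rest: "\<And>a. a \<in> K \<Longrightarrow> a \<noteq> i \<Longrightarrow> x a = x' a"
  shows "cut_strings j x = cut_strings j x' \<and> outputs_one j x = outputs_one j x'"
proof -
  have fin: "final_state x b = final_state x' b" if "b \<in> K - {i}" for b
    using eq by (intro final_state_eq_of_comparable[OF x, of "K - {i}"]) (use rest that in \<open>auto simp: cut_strings_eq_iff\<close>)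
  have "received x a j = received x' a j \<and> received x j a = received x' j a" if a: "a \<in> K" for a
    using final_state_eqD(1)[OF fin, of j a] final_state_eqD(1)[OF fin, of a j] eq[unfolded cut_strings_eq_iff, rule_format, OF j(1)] a j
    by (cases "a = i") auto
  then show ?thesis
    using final_state_eqD(3)[OF fin, of j] j x unfolding cut_strings_eq_iff outputs_one_def by (auto simp: outputs_iff)
qed

lemma cut_strings_eq_iff_links:
  assumes "i \<in> K"
  shows "cut_strings i x = cut_strings i x' \<longleftrightarrow> (\<forall>(a, b)\<in>(\<lambda>j. (j, i)) ` (K - {i}) \<union> (\<lambda>j. (i, j)) ` (K - {i}). received x a b = received x' a b)"
proof -
  have "received x i i = received x' i i" using received_self[OF assms] by simp
  then have "cut_strings i x = cut_strings i x' \<longleftrightarrow> (\<forall>j\<in>K - {i}. received x j i = received x' j i \<and> received x i j = received x' i j)"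
    unfolding cut_strings_eq_iff by blast
  also have "\<dots> \<longleftrightarrow> (\<forall>(a, b)\<in>(\<lambda>j. (j, i)) ` (K - {i}) \<union> (\<lambda>j. (i, j)) ` (K - {i}). received x a b = received x' a b)"
    by blast
  finally show ?thesis .
qed

lemma sum_links:
  "(\<Sum>(a, b)\<in>(\<lambda>j. (j, i)) ` S. g a b) = (\<Sum>j\<in>S. g j i)"
  "(\<Sum>(a, b)\<in>(\<lambda>j. (i, j)) ` S. g a b) = (\<Sum>j\<in>S. g i j)"
  by (simp_all add: sum.reindex inj_on_def)

lemma code_own:
  assumes "i \<in> K" "finite (inputs k X)"
  shows "\<exists>len::bits list \<times> bits list \<Rightarrow> nat. (\<Sum>t\<in>cut_strings i ` {x\<in>inputs k X. x i = x0 i}. (1/2) ^ len t) \<le> (1::real) \<and>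
     (\<forall>x\<in>inputs k X. x i = x0 i \<longrightarrow> len (cut_strings i x) \<le> traffic i x)"
proof -
  have "\<exists>len::bits list \<times> bits list \<Rightarrow> nat. (\<Sum>t\<in>cut_strings i ` {x\<in>inputs k X. \<forall>a\<in>{i}. x a = x0 a}. (1/2) ^ len t) \<le> (1::real) \<and>
     (\<forall>x\<in>{x\<in>inputs k X. \<forall>a\<in>{i}. x a = x0 a}. len (cut_strings i x) \<le>
        (\<Sum>(a, b)\<in>(\<lambda>j. (j, i)) ` (K - {i}). length (sent_bits x a b)) + (\<Sum>(a, b)\<in>(\<lambda>j. (i, j)) ` (K - {i}). length (sent_bits x a b)))"
    by (rule code_exists) (use assms cut_strings_eq_iff_links[OF assms(1)] in auto)
  then show ?thesis unfolding sum_links traffic_def by (simp add: Ball_def imp_conjL)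
qed

lemma code_others:
  assumes "i \<in> K" "finite (inputs k X)"
  shows "\<exists>len::bits list \<times> bits list \<Rightarrow> nat. (\<Sum>t\<in>cut_strings i ` {x\<in>inputs k X. \<forall>a\<in>K - {i}. x a = x0 a}. (1/2) ^ len t) \<le> (1::real) \<and>
     (\<forall>x\<in>inputs k X. (\<forall>a\<in>K - {i}. x a = x0 a) \<longrightarrow> len (cut_strings i x) \<le> traffic i x)"
proof -
  have "\<exists>len::bits list \<times> bits list \<Rightarrow> nat. (\<Sum>t\<in>cut_strings i ` {x\<in>inputs k X. \<forall>a\<in>K - {i}. x a = x0 a}. (1/2) ^ len t) \<le> (1::real) \<and>
     (\<forall>x\<in>{x\<in>inputs k X. \<forall>a\<in>K - {i}. x a = x0 a}. len (cut_strings i x) \<le>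
        (\<Sum>(a, b)\<in>(\<lambda>j. (i, j)) ` (K - {i}). length (sent_bits x a b)) + (\<Sum>(a, b)\<in>(\<lambda>j. (j, i)) ` (K - {i}). length (sent_bits x a b)))"
  proof (rule code_exists)
    show "cut_strings i x = cut_strings i x' \<longleftrightarrow> (\<forall>(a, b)\<in>(\<lambda>j. (i, j)) ` (K - {i}) \<union> (\<lambda>j. (j, i)) ` (K - {i}). received x a b = received x' a b)" for x x'
      unfolding cut_strings_eq_iff_links[OF assms(1)] by (simp only: Un_commute)
  qed (use assms in auto)
  then show ?thesis unfolding sum_links traffic_def by (simp add: Ball_def imp_conjL add.commute)
qed

text \<open>A link lies in the cuts of both its ends.\<close>

lemma sum_traffic_le: "(\<Sum>i\<in>K. traffic i x) \<le> 2 * bits_sent k (run x (halt_time x))"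
proof -
  let ?g = "\<lambda>a b. length (sent_bits x a b)"
  have bits: "bits_sent k (run x (halt_time x)) = (\<Sum>i\<in>K. \<Sum>j\<in>K. ?g i j)"
    unfolding bits_sent_def sent_bits_def by (simp add: length_concat)
  have "(\<Sum>i\<in>K. traffic i x) \<le> (\<Sum>i\<in>K. (\<Sum>j\<in>K. ?g j i) + (\<Sum>j\<in>K. ?g i j))"
    unfolding traffic_def by (intro sum_mono add_mono sum_mono2) auto
  also have "\<dots> = 2 * bits_sent k (run x (halt_time x))"
    unfolding bits sum.distrib using sum.swap[of "\<lambda>i j. ?g j i" K K] by simp
  finally show ?thesis .
qed

end

section \<open>The lower bound\<close>

lemma schedules_nonempty:
  assumes "k \<ge> 1"
  shows "schedules k \<noteq> {}"
proof -
  have ne: "events k \<noteq> {}" using assms unfolding events_def by auto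
  have "events k \<subseteq> Act ` {1..k} \<union> (\<lambda>(i, j). Deliver i j) ` ({1..k} \<times> {1..k})"
    unfolding events_def by auto
  then have "finite (events k)" by (rule finite_subset) simp
  then have cnt: "countable (events k)" by (rule countable_finite)
  \<comment> \<open>The first component of a decoded pair takes every value infinitely
    often.\<close>
  let ?\<sigma> = "\<lambda>t. from_nat_into (events k) (fst (prod_decode t))"
  have "\<exists>\<^sub>\<infinity>t. ?\<sigma> t = e" if e: "e \<in> events k" for e
  proof -
    obtain m where m: "from_nat_into (events k) m = e"
      using from_nat_into_surj[OF cnt e] by blast
    have "range (\<lambda>j. prod_encode (m, j)) \<subseteq> {t. ?\<sigma> t = e}" using m by auto
    moreover have "infinite (range (\<lambda>j. prod_encode (m, j)))"
      by (intro range_inj_infinite injI) (simp add: inj_eq[OF inj_prod_encode])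
    ultimately show ?thesis
      unfolding frequently_cofinite by (rule infinite_super)
  qed
  then have "?\<sigma> \<in> schedules k"
    unfolding schedules_def using from_nat_into[OF ne] by auto
  then show ?thesis by blast
qed

lemma prob_space_rand_space: "prob_space (rand_space k)"
proof -
  have coin: "prob_space coin_space"
    unfolding coin_space_def by (intro prob_space_PiM prob_space_measure_pmf)
  show ?thesis
    unfolding rand_space_def by (intro prob_space_pair prob_space_PiM coin)
qed

lemma integral_avg:
  assumes "\<And>x. x \<in> A \<Longrightarrow> integrable M (f x)"
  shows "integrable M (\<lambda>r. avg A (\<lambda>x. f x r))" "(\<integral>r. avg A (\<lambda>x. f x r) \<partial>M) = avg A (\<lambda>x. \<integral>r. f x r \<partial>M)"
  unfolding avg_def using assms by auto

lemma (in prob_space) exists_ge_expectation: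
  assumes "integrable M W" "expectation W \<ge> (c :: real)"
  shows "\<exists>r\<in>space M. W r \<ge> c"
proof (rule ccontr)
  assume "\<not> ?thesis"
  then have "expectation W < c"
    using assms(1) by (intro expectation_less AE_I2) auto
  with assms(2) show False by simp
qed

lemma finite_inputs_disj: "finite (inputs k (disj_inputs n))"
  unfolding inputs_def disj_inputs_def
  using finite_lists_length_eq[of "UNIV :: bool set" n] by (intro finite_PiE) auto

context hard_inputs
begin

definition inp_of :: "(nat \<Rightarrow> nat \<Rightarrow> bool) \<Rightarrow> nat \<Rightarrow> bits" where
  "inp_of X = (\<lambda>i\<in>{1..k}. map (\<lambda>l. X l i) [0..<n])"

definition hard :: "(nat \<Rightarrow> nat) \<Rightarrow> nat \<Rightarrow> nat \<Rightarrow> (nat \<times> nat \<Rightarrow> bool) \<Rightarrow> bool \<Rightarrow> nat \<Rightarrow> nat \<Rightarrow> bool" where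
  "hard \<zeta> l i \<omega> b = (mat \<zeta> \<omega>)(l := (all_one \<omega>)(i := b))"

abbreviation Z :: "(nat \<Rightarrow> nat) set" where
  "Z \<equiv> \<Pi>\<^sub>E j\<in>{..<n}. {1..k}"

lemma inp_of_in: "inp_of X \<in> inputs k (disj_inputs n)"
  unfolding inp_of_def inputs_def disj_inputs_def by auto

lemma Disj_inp_of: "Disj k n (inp_of X) = [\<exists>l<n. \<forall>i\<in>{1..k}. X l i]"
  unfolding Disj_def inp_of_def by (simp cong: conj_cong)

text \<open>Every coordinate but \<open>l\<close> keeps its planted zero, and in column
  \<open>l\<close> the bit of \<open>i\<close> decides.\<close>

lemma Disj_hard:
  assumes "\<zeta> \<in> Z" "i \<in> {1..k}" "l < n"
  shows "Disj k n (inp_of (hard \<zeta> l i \<omega> b)) = [b]"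
proof -
  have "\<zeta> j \<in> {1..k}" if "j < n" for j using assms(1) that by (auto simp: PiE_iff)
  then have "\<not> hard \<zeta> l i \<omega> b j (\<zeta> j)" if "j < n" "j \<noteq> l" for j
    using that unfolding hard_def mat_def by simp
  moreover have "(\<forall>a\<in>{1..k}. hard \<zeta> l i \<omega> b l a) \<longleftrightarrow> b"
    using assms(2) unfolding hard_def all_one_def by auto
  ultimately have "(\<exists>j<n. \<forall>a\<in>{1..k}. hard \<zeta> l i \<omega> b j a) \<longleftrightarrow> b"
    using assms(3) \<open>\<And>j. j < n \<Longrightarrow> \<zeta> j \<in> {1..k}\<close> by metis
  then show ?thesis unfolding Disj_inp_of by simp
qed

lemma pair_average:
  assumes "\<And>l \<zeta> i z \<omega>. l < n \<Longrightarrow> \<zeta> \<in> Z \<Longrightarrow> i \<in> {1..k} \<Longrightarrow> z \<in> {1..k} \<Longrightarrow> h l \<zeta> i z \<omega> \<ge> (d :: real)"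
    and "k \<ge> 1"
  shows "(\<Sum>l<n. avg Z (\<lambda>\<zeta>. \<Sum>z\<in>{1..k}. \<Sum>i\<in>{1..k}. if i = z then 0 else avg Q (\<lambda>\<omega>. h l \<zeta> i z \<omega>)))
     \<ge> d * (real n * (real k * (real k - 1)))"
proof -
  have Z: "finite Z" "Z \<noteq> {}"
    using assms(2) by (auto intro!: finite_PiE simp: PiE_eq_empty_iff)
  have "(\<Sum>z\<in>{1..k}. \<Sum>i\<in>{1..k}. if i = z then 0 else d) = d * (real k * (real k - 1))"
  proof -
    have "(\<Sum>i\<in>{1..k}. if i = z then 0 else d) = d * (real k - 1)" if "z \<in> {1..k}" for z
      using assms(2) that by (subst sum.remove[OF _ that]) (simp_all add: of_nat_diff)
    then show ?thesis by simp
  qed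
  then have "d * (real n * (real k * (real k - 1))) = (\<Sum>l<n. avg Z (\<lambda>\<zeta>. \<Sum>z\<in>{1..k}. \<Sum>i\<in>{1..k}. if i = z then 0 else avg Q (\<lambda>\<omega>. d)))"
    using Z unfolding avg_const[OF finite_cube[OF finite_Idx] cube_nonempty] by (simp add: avg_const)
  also have "\<dots> \<le> (\<Sum>l<n. avg Z (\<lambda>\<zeta>. \<Sum>z\<in>{1..k}. \<Sum>i\<in>{1..k}. if i = z then 0 else avg Q (\<lambda>\<omega>. h l \<zeta> i z \<omega>)))"
    using assms(1) by (intro sum_mono avg_mono) (auto intro!: avg_mono)
  finally show ?thesis .
qed

definition good :: "bits protocol \<Rightarrow> (nat \<Rightarrow> event) \<Rightarrow> randomness \<Rightarrow> (nat \<Rightarrow> nat \<Rightarrow> bool) \<Rightarrow> bool" where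
  "good \<pi> \<sigma> r X \<longleftrightarrow> (\<forall>i\<in>{1..k}. outputs \<pi> (inp_of X) r \<sigma> i (Disj k n (inp_of X)))"

text \<open>One value of the randomness has to serve all hard inputs at once, so a single linear
  quantity is averaged over it. The advantage is expressed through correctness events because
  \<open>eps_computes\<close> gives measurability for these.\<close>

lemma exists_good_randomness:
  assumes k: "k \<ge> 1" and \<epsilon>: "\<epsilon> < 1" and \<sigma>: "\<sigma> \<in> schedules k"
    and comp: "eps_computes k (disj_inputs n) \<pi> \<epsilon> (Disj k n)"
  shows "\<exists>r\<in>space (rand_space k).
     (\<Sum>l<n. avg Z (\<lambda>\<zeta>. \<Sum>z\<in>{1..k}. \<Sum>i\<in>{1..k}. if i = z then 0 else
        avg Q (\<lambda>\<omega>. of_bool (good \<pi> \<sigma> r (hard \<zeta> l i \<omega> True)) + of_bool (good \<pi> \<sigma> r (hard \<zeta> l i \<omega> False)) - 1)))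
     \<ge> (1 - 2 * \<epsilon>) * (real n * (real k * (real k - 1)))"
proof -
  interpret prob_space "rand_space k" by (rule prob_space_rand_space)
  let ?M = "rand_space k"
  have g: "integrable ?M (\<lambda>r. of_bool (good \<pi> \<sigma> r X) :: real)" "(\<integral>r. of_bool (good \<pi> \<sigma> r X) \<partial>?M) \<ge> 1 - \<epsilon>" for X
  proof -
    let ?G = "{r \<in> space ?M. good \<pi> \<sigma> r X}"
    have prob: "measure ?M ?G \<ge> 1 - \<epsilon>"
      using comp \<sigma> inp_of_in unfolding eps_computes_def good_def by blast
    then have meas: "?G \<in> sets ?M"
      using \<epsilon> measure_notin_sets[of ?G ?M] by (cases "?G \<in> sets ?M") auto
    have eq: "of_bool (good \<pi> \<sigma> r X) = indicat_real ?G r" if "r \<in> space ?M" for r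
      using that by (simp add: indicator_def of_bool_def)
    have "integrable ?M (indicat_real ?G)" using meas by (simp add: integrable_indicator_iff emeasure_eq_measure)
    then show "integrable ?M (\<lambda>r. of_bool (good \<pi> \<sigma> r X) :: real)"
      by (subst Bochner_Integration.integrable_cong[OF refl eq])
    have "(\<integral>r. of_bool (good \<pi> \<sigma> r X) \<partial>?M) = (\<integral>r. indicat_real ?G r \<partial>?M)"
      by (intro Bochner_Integration.integral_cong refl eq)
    also have "\<dots> = measure ?M ?G" using meas by simp
    finally show "(\<integral>r. of_bool (good \<pi> \<sigma> r X) \<partial>?M) \<ge> 1 - \<epsilon>" using prob by simp
  qed
  let ?h = "\<lambda>l \<zeta> i \<omega> r. of_bool (good \<pi> \<sigma> r (hard \<zeta> l i \<omega> True)) + of_bool (good \<pi> \<sigma> r (hard \<zeta> l i \<omega> False)) - 1 :: real"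
  have h: "integrable ?M (?h l \<zeta> i \<omega>)" "(\<integral>r. ?h l \<zeta> i \<omega> r \<partial>?M) \<ge> 1 - 2 * \<epsilon>" for l \<zeta> i \<omega>
  proof -
    show "integrable ?M (?h l \<zeta> i \<omega>)" by (intro Bochner_Integration.integrable_diff Bochner_Integration.integrable_add g) simp
    have "(\<integral>r. ?h l \<zeta> i \<omega> r \<partial>?M) = (\<integral>r. of_bool (good \<pi> \<sigma> r (hard \<zeta> l i \<omega> True)) \<partial>?M)
        + (\<integral>r. of_bool (good \<pi> \<sigma> r (hard \<zeta> l i \<omega> False)) \<partial>?M) - 1"
      using g by (simp add: prob_space)
    then show "(\<integral>r. ?h l \<zeta> i \<omega> r \<partial>?M) \<ge> 1 - 2 * \<epsilon>"
      using g(2)[of "hard \<zeta> l i \<omega> True"] g(2)[of "hard \<zeta> l i \<omega> False"] by linarith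
  qed
  let ?W = "\<lambda>r. \<Sum>l<n. avg Z (\<lambda>\<zeta>. \<Sum>z\<in>{1..k}. \<Sum>i\<in>{1..k}. if i = z then 0 else avg Q (\<lambda>\<omega>. ?h l \<zeta> i \<omega> r))"
  have int1: "integrable ?M (\<lambda>r. if i = z then 0 else avg Q (\<lambda>\<omega>. ?h l \<zeta> i \<omega> r))"
    "(\<integral>r. (if i = z then 0 else avg Q (\<lambda>\<omega>. ?h l \<zeta> i \<omega> r)) \<partial>?M) = (if i = z then 0 else avg Q (\<lambda>\<omega>. \<integral>r. ?h l \<zeta> i \<omega> r \<partial>?M))"
    for l i z :: nat and \<zeta> :: "nat \<Rightarrow> nat"
    using integral_avg[of Q ?M "?h l \<zeta> i", OF h(1)] by (cases "i = z"; simp)+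
  have int2: "integrable ?M (\<lambda>r. \<Sum>z\<in>{1..k}. \<Sum>i\<in>{1..k}. if i = z then 0 else avg Q (\<lambda>\<omega>. ?h l \<zeta> i \<omega> r))"
    "(\<integral>r. (\<Sum>z\<in>{1..k}. \<Sum>i\<in>{1..k}. if i = z then 0 else avg Q (\<lambda>\<omega>. ?h l \<zeta> i \<omega> r)) \<partial>?M)
      = (\<Sum>z\<in>{1..k}. \<Sum>i\<in>{1..k}. if i = z then 0 else avg Q (\<lambda>\<omega>. \<integral>r. ?h l \<zeta> i \<omega> r \<partial>?M))" for l \<zeta>
    unfolding int1(2)[symmetric] by (auto intro!: Bochner_Integration.integrable_sum int1(1)
        simp: Bochner_Integration.integral_sum[OF Bochner_Integration.integrable_sum[OF int1(1)]]
          Bochner_Integration.integral_sum[OF int1(1)] simp del: if_split)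
  have "integrable ?M ?W"
    by (intro Bochner_Integration.integrable_sum integral_avg(1) int2(1))
  moreover have "(\<integral>r. ?W r \<partial>?M) = (\<Sum>l<n. avg Z (\<lambda>\<zeta>. \<Sum>z\<in>{1..k}. \<Sum>i\<in>{1..k}. if i = z then 0 else avg Q (\<lambda>\<omega>. \<integral>r. ?h l \<zeta> i \<omega> r \<partial>?M)))"
    unfolding int2(2)[symmetric] integral_avg(2)[OF int2(1), symmetric]
    by (intro Bochner_Integration.integral_sum integral_avg(1) int2(1))
  moreover have "\<dots> \<ge> (1 - 2 * \<epsilon>) * (real n * (real k * (real k - 1)))"
    using h(2) k by (intro pair_average)
  ultimately show ?thesis
    using exists_ge_expectation[of ?W "(1 - 2 * \<epsilon>) * (real n * (real k * (real k - 1)))"] by simp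
qed

text \<open>The constant 3840 is 960 times 4: each bit is counted at two cuts, and
  \<open>real k - 1\<close> is at least \<open>real k / 2\<close>.\<close>

lemma CC_protocol_ge:
  assumes k: "k \<ge> 2" and \<epsilon>: "0 \<le> \<epsilon>" "\<epsilon> < 1/2"
    and prot: "is_protocol k (disj_inputs n) \<pi>"
    and comp: "eps_computes k (disj_inputs n) \<pi> \<epsilon> (Disj k n)"
    and N: "CC_protocol k (disj_inputs n) \<pi> = enat N"
  shows "(1 - 2 * \<epsilon>)\<^sup>2 / 3840 * (real k * real n) \<le> real N"
proof -
  obtain \<sigma> where \<sigma>: "\<sigma> \<in> schedules k" using schedules_nonempty[of k] k by fastforce
  obtain r where r: "r \<in> space (rand_space k)"
    and W: "(\<Sum>l<n. avg Z (\<lambda>\<zeta>. \<Sum>z\<in>{1..k}. \<Sum>i\<in>{1..k}. if i = z then 0 else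
        avg Q (\<lambda>\<omega>. of_bool (good \<pi> \<sigma> r (hard \<zeta> l i \<omega> True)) + of_bool (good \<pi> \<sigma> r (hard \<zeta> l i \<omega> False)) - 1)))
     \<ge> (1 - 2 * \<epsilon>) * (real n * (real k * (real k - 1)))"
    using exists_good_randomness[OF _ _ \<sigma> comp] k \<epsilon> by force
  interpret halting_run k "disj_inputs n" \<pi> r \<sigma>
    using comp prot r \<sigma> by unfold_locales (auto simp: eps_computes_def)
  define Tr' where "Tr' i X = cut_strings i (inp_of X)" for i X
  define out' where "out' i X = outputs_one i (inp_of X)" for i X
  define cost' where "cost' i X = traffic i (inp_of X)" for i X
  interpret cut_transcripts k n Tr' out' cost'
  proof unfold_locales
    fix i assume i: "i \<in> {1..k}"
    have "range (Tr' i) \<subseteq> cut_strings i ` inputs k (disj_inputs n)"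
      using inp_of_in unfolding Tr'_def by auto
    then show "finite (range (Tr' i))"
      using finite_inputs_disj finite_subset by blast
    show "Tr' i (mix i X X') = \<tau>" if "Tr' i X = \<tau>" "Tr' i X' = \<tau>" for X X' \<tau>
      using cut_strings_mix[OF i inp_of_in[of X] inp_of_in[of X'] inp_of_in[of "mix i X X'"]] that i
      unfolding Tr'_def by (simp add: inp_of_def mix_def)
    show "Tr' j X = Tr' j X' \<and> out' j X = out' j X'"
      if "j \<in> {1..k}" "i \<noteq> j" "Tr' i X = Tr' i X'" "\<And>l a. a \<noteq> i \<Longrightarrow> X l a = X' l a" for j X X'
      using cut_strings_rest[OF i that(1,2) inp_of_in[of X] inp_of_in[of X']] that(3,4)
      unfolding Tr'_def out'_def by (simp add: inp_of_def)
    fix X0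
    have codes: "\<exists>len::bits list \<times> bits list \<Rightarrow> nat. (\<Sum>t\<in>Tr' i ` {X. R X}. (1/2) ^ len t) \<le> (1::real) \<and>
        (\<forall>X. R X \<longrightarrow> len (Tr' i X) \<le> cost' i X)"
      if "\<exists>len::bits list \<times> bits list \<Rightarrow> nat. (\<Sum>t\<in>cut_strings i ` {x\<in>inputs k (disj_inputs n). R' x}. (1/2) ^ len t) \<le> (1::real) \<and>
         (\<forall>x\<in>inputs k (disj_inputs n). R' x \<longrightarrow> len (cut_strings i x) \<le> traffic i x)"
        "\<And>X. R X \<Longrightarrow> R' (inp_of X)" for R R'
    proof -
      from that(1) obtain len :: "bits list \<times> bits list \<Rightarrow> nat" where
        len: "(\<Sum>t\<in>cut_strings i ` {x\<in>inputs k (disj_inputs n). R' x}. (1/2) ^ len t) \<le> (1::real)"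
          "\<And>x. x \<in> inputs k (disj_inputs n) \<Longrightarrow> R' x \<Longrightarrow> len (cut_strings i x) \<le> traffic i x" by blast
      have "(\<Sum>t\<in>Tr' i ` {X. R X}. (1/2) ^ len t) \<le> (\<Sum>t\<in>cut_strings i ` {x\<in>inputs k (disj_inputs n). R' x}. (1/2) ^ len t :: real)"
        using that(2) inp_of_in finite_inputs_disj unfolding Tr'_def by (intro sum_mono2) auto
      with len(1) have "(\<Sum>t\<in>Tr' i ` {X. R X}. (1/2) ^ len t) \<le> (1::real)" by linarith
      moreover have "len (Tr' i X) \<le> cost' i X" if "R X" for X
        unfolding Tr'_def cost'_def using len(2) inp_of_in \<open>\<And>X. R X \<Longrightarrow> R' (inp_of X)\<close>[OF that] by blast
      ultimately show ?thesis by blast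
    qed
    show "\<exists>len::bits list \<times> bits list \<Rightarrow> nat. (\<Sum>t\<in>Tr' i ` {X. \<forall>l. X l i = X0 l i}. (1/2) ^ len t) \<le> (1::real) \<and>
        (\<forall>X. (\<forall>l. X l i = X0 l i) \<longrightarrow> len (Tr' i X) \<le> cost' i X)"
      by (rule codes[OF code_own[OF i finite_inputs_disj, of "inp_of X0"]]) (simp add: inp_of_def)
    show "\<exists>len::bits list \<times> bits list \<Rightarrow> nat. (\<Sum>t\<in>Tr' i ` {X. \<forall>l a. a \<noteq> i \<longrightarrow> X l a = X0 l a}. (1/2) ^ len t) \<le> (1::real) \<and>
        (\<forall>X. (\<forall>l a. a \<noteq> i \<longrightarrow> X l a = X0 l a) \<longrightarrow> len (Tr' i X) \<le> cost' i X)"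
      by (rule codes[OF code_others[OF i finite_inputs_disj, of "inp_of X0"]]) (simp add: inp_of_def)
  qed
  have "(\<Sum>i\<in>{1..k}. real (cost' i X)) \<le> 2 * real N" for X
  proof -
    let ?b = "bits_sent k (exec \<pi> (inp_of X) r \<sigma> (halt_time (inp_of X)))"
    have "enat ?b \<le> CC_protocol k (disj_inputs n) \<pi>"
      unfolding CC_protocol_def
      by (rule SUP_upper2[OF inp_of_in], rule SUP_upper2[OF r], rule SUP_upper2[OF \<sigma>], rule SUP_upper) simp
    then have "?b \<le> N" unfolding N by simp
    then have "(\<Sum>i\<in>{1..k}. cost' i X) \<le> 2 * N"
      using sum_traffic_le[of "inp_of X"] unfolding cost'_def by linarith
    then have "real (\<Sum>i\<in>{1..k}. cost' i X) \<le> real (2 * N)" by (simp only: of_nat_le_iff)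
    then show ?thesis by simp
  qed
  moreover have "(1 - 2 * \<epsilon>) * (real n * (real k * (real k - 1)))
      \<le> (\<Sum>l<n. avg Z (\<lambda>\<zeta>. \<Sum>z\<in>{1..k}. \<Sum>i\<in>{1..k}. if i = z then 0 else adv \<zeta> l i z))"
  proof (rule order_trans[OF W], intro sum_mono avg_mono)
    fix l \<zeta> z i assume l: "l \<in> {..<n}" and \<zeta>: "\<zeta> \<in> Z" and z: "z \<in> {1..k}" and i: "i \<in> {1..k}"
    have "of_bool (good \<pi> \<sigma> r (hard \<zeta> l i \<omega> True)) + of_bool (good \<pi> \<sigma> r (hard \<zeta> l i \<omega> False)) - 1
        \<le> (of_bool (out' z (hard \<zeta> l i \<omega> True)) - of_bool (out' z (hard \<zeta> l i \<omega> False)) :: real)" for \<omega>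
    proof -
      have "out' z (hard \<zeta> l i \<omega> True)" if "good \<pi> \<sigma> r (hard \<zeta> l i \<omega> True)"
        using that z Disj_hard[OF \<zeta> i, of l \<omega> True] l unfolding good_def out'_def outputs_one_def by auto
      moreover have "\<not> out' z (hard \<zeta> l i \<omega> False)" if "good \<pi> \<sigma> r (hard \<zeta> l i \<omega> False)"
        using that z Disj_hard[OF \<zeta> i, of l \<omega> False] l unfolding good_def out'_def outputs_one_def
        by (auto simp: outputs_iff[OF inp_of_in])
      ultimately show ?thesis by (auto simp: of_bool_def)
    qed
    then show "(if i = z then 0 else
        avg Q (\<lambda>\<omega>. of_bool (good \<pi> \<sigma> r (hard \<zeta> l i \<omega> True)) + of_bool (good \<pi> \<sigma> r (hard \<zeta> l i \<omega> False)) - 1))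
       \<le> (if i = z then 0 else adv \<zeta> l i z)"
      unfolding adv_def hard_def[symmetric] by (auto intro!: avg_mono)
  qed
  ultimately have "(1 - 2 * \<epsilon>)\<^sup>2 * (real n * (real k - 1)) \<le> 960 * (2 * real N)"
    using k \<epsilon> by (intro cost_lower_bound) auto
  moreover have "(1 - 2 * \<epsilon>)\<^sup>2 * (real n * (real k / 2)) \<le> (1 - 2 * \<epsilon>)\<^sup>2 * (real n * (real k - 1))"
    using k by (intro mult_left_mono) auto
  ultimately show ?thesis by (simp add: algebra_simps)
qed

end

theorem theorem6p5:
  fixes \<epsilon> :: real
  assumes "0 \<le> \<epsilon>" and "\<epsilon> < 1/2"
  shows "\<exists>\<alpha>>0. \<exists>c>0. \<forall>k n. k \<ge> 2 \<and> real n \<ge> (1 / \<alpha>) * real k \<longrightarrow>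
           ereal_of_enat (CC k (disj_inputs n) \<epsilon> (Disj k n)) \<ge> ereal (c * (real k * real n))"
proof -
  define c where "c = (1 - 2 * \<epsilon>)\<^sup>2 / 3840"
  have "0 < c" using assms unfolding c_def by simp
  have "ereal (c * (real k * real n)) \<le> ereal_of_enat (CC k (disj_inputs n) \<epsilon> (Disj k n))" if "k \<ge> 2" for k n
  proof -
    \<comment> \<open>\<open>CC\<close> takes values in \<open>enat\<close>, so the real bound is
      rounded up; nothing is lost because numbers of bits are integers.\<close>
    let ?m = "nat \<lceil>c * (real k * real n)\<rceil>"
    have "enat ?m \<le> CC k (disj_inputs n) \<epsilon> (Disj k n)"
      unfolding CC_def
    proof (rule INF_greatest)
      fix \<pi> assume \<pi>: "\<pi> \<in> {\<pi>. is_protocol k (disj_inputs n) \<pi> \<and> eps_computes k (disj_inputs n) \<pi> \<epsilon> (Disj k n)}"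
      show "enat ?m \<le> CC_protocol k (disj_inputs n) \<pi>"
      proof (cases "CC_protocol k (disj_inputs n) \<pi>")
        case (enat N)
        have "c * (real k * real n) \<le> real N"
          unfolding c_def using \<pi> by (intro hard_inputs.CC_protocol_ge[OF that assms _ _ enat]) auto
        then show ?thesis unfolding enat by (simp add: ceiling_le_iff)
      qed simp
    qed
    then have "ereal_of_enat (enat ?m) \<le> ereal_of_enat (CC k (disj_inputs n) \<epsilon> (Disj k n))"
      by (simp only: ereal_of_enat_le_iff)
    moreover have "ereal (c * (real k * real n)) \<le> ereal_of_enat (enat ?m)"
      by simp linarith
    ultimately show ?thesis by (rule order_trans[rotated])
  qed
  with \<open>0 < c\<close> show ?thesis by (intro exI[of _ 1] exI[of _ c] conjI) auto
qed

end
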